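(* Let $p_1,p_2\ge1$, $\alpha_1,\alpha_2>0$, $\mathbb{Q}\in\{\mathbb{T},\mathbb{H}\}$, $\beta=(\beta_1,\beta_2)\in\mathbb{R}^2$, $\gamma\ge0$ and $\nu>0$ be fixed, and let $n_2=\nu n_1$ with $n_1\to\infty$. Consider the matrices (nested case) $$A_{\mathbf n,\mathbf p}=\frac1\nu\,M^{\mathbb{Q}_{\alpha_2}}_{n_2,p_2}\otimes K^{\mathbb{Q}_{\alpha_1}}_{n_1,p_1}+\nu\,K^{\mathbb{Q}_{\alpha_2}}_{n_2,p_2}\otimes M^{\mathbb{Q}_{\alpha_1}}_{n_1,p_1}+\frac{\beta_1}{\nu n_1}\,M^{\mathbb{Q}_{\alpha_2}}_{n_2,p_2}\otimes H^{\mathbb{Q}_{\alpha_1}}_{n_1,p_1}+\frac{\beta_2}{n_1}\,H^{\mathbb{Q}_{\alpha_2}}_{n_2,p_2}\otimes M^{\mathbb{Q}_{\alpha_1}}_{n_1,p_1}+\frac{\gamma}{\nu n_1^2}\,M^{\mathbb{Q}_{\alpha_2}}_{n_2,p_2}\otimes M^{\mathbb{Q}_{\alpha_1}}_{n_1,p_1}.$$ Then the sequence $\{A_{\mathbf n,\mathbf p}\}_{n_1}$ is distributed in the sense of the eigenvalues like the function $g_{p_1,p_2}:[-\pi,\pi]^2\to\mathbb{R}$, $$g_{p_1,p_2}(\theta_1,\theta_2)=\frac1\nu\,h_{p_2}(\theta_1)f_{p_1}(\theta_2)+\nu\,f_{p_2}(\theta_1)h_{p_1}(\theta_2).$$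
   Context: GB-splines: For $\mu>0$ and $p\ge1$ let $\mathbb{P}^{\mathbb{T}_\mu}_p=\mathrm{span}\{1,x,\dots,x^{p-2},\cos(\mu x),\sin(\mu x)\}$ and $\mathbb{P}^{\mathbb{H}_\mu}_p=\mathrm{span}\{1,x,\dots,x^{p-2},\cosh(\mu x),\sinh(\mu x)\}$ (for $p=1$ only the two transcendental functions). For $n\ge2$ take the open uniform knots $s_1=\dots=s_{p+1}=0$, $s_{p+i+1}=i/n$ ($i=0,\dots,n$), $s_{n+p+1}=\dots=s_{n+2p+1}=1$. The GB-spline space consists of $C^{p-1}$ functions on $[0,1]$ whose restriction to each $[i/n,(i+1)/n]$ lies in $\mathbb{P}^{\mathbb{Q}_\mu}_p$; $N^{\mathbb{Q}_\mu}_{i,p}$, $i=1,\dots,n+p$, is its B-spline-type basis (nonnegative, $N^{\mathbb{Q}_\mu}_{i,p}$ supported on $[s_i,s_{i+p+1}]$, partition of unity). In the trigonometric case $\mu/n<\pi$ is assumed. With indices $i,j=1,\dots,n+p-2$: $K^{\mathbb{Q}_\mu}_{n,p}=[\frac1n\int_0^1(N^{\mathbb{Q}_\mu}_{j+1,p})'(N^{\mathbb{Q}_\mu}_{i+1,p})'dx]$, $H^{\mathbb{Q}_\mu}_{n,p}=[\int_0^1(N^{\mathbb{Q}_\mu}_{j+1,p})'N^{\mathbb{Q}_\mu}_{i+1,p}dx]$, $M^{\mathbb{Q}_\mu}_{n,p}=[n\int_0^1N^{\mathbb{Q}_\mu}_{j+1,p}N^{\mathbb{Q}_\mu}_{i+1,p}dx]$.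 In the nested case the phase parameter $\alpha_k$ is fixed independently of $n_k$. The matrix $A_{\mathbf n,\mathbf p}$ equals the Galerkin matrix $[a(\varphi_j,\varphi_i)]$ for $-\Delta u+\beta\cdot\nabla u+\gamma u=f$ on $(0,1)^2$ with $u=0$ on the boundary, $a(u,v)=\int\nabla u\cdot\nabla v+\int(\beta\cdot\nabla u)v+\gamma\int uv$, using the basis $\varphi_{(n_1+p_1-2)(j-1)+i}(x,y)=N^{\mathbb{Q}_{\alpha_1}}_{i+1,p_1}(x)N^{\mathbb{Q}_{\alpha_2}}_{j+1,p_2}(y)$ built on $n_1$ intervals in $x$ and $n_2$ in $y$; its size is $d=(n_1+p_1-2)(n_2+p_2-2)$. ($n_2$ is taken as the integer best approximating $\nu n_1$.) Symbols: let $\phi_q$ be the cardinal polynomial B-spline of degree $q$ with knots $0,1,\dots,q+1$ ($\phi_0=\mathbf 1_{[0,1)}$, $\phi_q(t)=\frac tq\phi_{q-1}(t)+\frac{q+1-t}{q}\phi_{q-1}(t-1)$); $h_p(\theta)=\phi_{2p+1}(p+1)+2\sum_{k=1}^p\phi_{2p+1}(p+1-k)\cos(k\theta)$ and $f_p(\theta)=-\phi''_{2p+1}(p+1)-2\sum_{k=1}^p\phi''_{2p+1}(p+1-k)\cos(k\theta)$. Eigenvalue distribution: a sequence $\{X_{n_1}\}$ of matrices of size $d_{n_1}\to\infty$ with eigenvalues $\lambda_j(X_{n_1})$ is distributed like $g:[-\pi,\pi]^2\to\mathbb{R}$ if for every continuous compactly supported $F:\mathbb{C}\to\mathbb{C}$,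 $\lim_{n_1\to\infty}\frac1{d_{n_1}}\sum_{j=1}^{d_{n_1}}F(\lambda_j(X_{n_1}))=\frac1{4\pi^2}\int_{[-\pi,\pi]^2}F(g(\theta_1,\theta_2))\,d\theta_1d\theta_2$. *)

theory Defs
  imports "HOL-Analysis.Analysis" "Jordan_Normal_Form.Char_Poly"
begin

datatype gbkind = Trig | Hyp

definition gbS :: "gbkind \<Rightarrow> real \<Rightarrow> real \<Rightarrow> real" where
  "gbS Q mu x = (case Q of Trig \<Rightarrow> sin (mu * x) | Hyp \<Rightarrow> sinh (mu * x))"

text \<open>Knots s_1 = ... = s_{p+1} = 0, s_{p+i+1} = i/n (i = 0..n), s_{n+p+1} = ... = s_{n+2p+1} = 1
  (1-based index k).\<close>
definition knot :: "nat \<Rightarrow> nat \<Rightarrow> nat \<Rightarrow> real" where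
  "knot n p k = (if k \<le> p + 1 then 0 else if k \<le> n + p + 1 then real (k - p - 1) / real n else 1)"

text \<open>gbspl Q mu n p q i: the i-th (1-based) GB-spline of degree q on the knot vector of the
  degree-p open uniform partition with n intervals; the basis functions of the statement are
  gbspl Q mu n p p i, i = 1..n+p.  Degree 1: the generalized hat functions in span{cos,sin}
  (resp. span{cosh,sinh}).  Degree q+1 (q >= 1): the standard integral recurrence
  N_{i,q+1} = Phi_{i,q} - Phi_{i+1,q}, Phi_{i,q}(x) = (int_{s_i}^x N_{i,q}) / (int N_{i,q}),
  where for a degenerate support (all its knots equal, only possible at 0 or 1) Phi_{i,q} is
  the limiting step function (identically 1 on [0,1] if the knot is 0, identically 0 on [0,1]
  if the knot is 1).\<close>
fun gbspl :: "gbkind \<Rightarrow> real \<Rightarrow> nat \<Rightarrow> nat \<Rightarrow> nat \<Rightarrow> nat \<Rightarrow> real \<Rightarrow> real" where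
  "gbspl Q mu n p 0 i x =
     (if knot n p i \<le> x \<and> x < knot n p (i+1) then 1 else 0)"
| "gbspl Q mu n p (Suc 0) i x =
     (let a = knot n p i; b = knot n p (i+1); c = knot n p (i+2) in
      if a < b \<and> a \<le> x \<and> (x < b \<or> (x = b \<and> b = 1 \<and> c = 1))
        then gbS Q mu (x - a) / gbS Q mu (b - a)
      else if b < c \<and> b \<le> x \<and> (x < c \<or> (x = c \<and> c = 1))
        then gbS Q mu (c - x) / gbS Q mu (c - b)
      else 0)"
| "gbspl Q mu n p (Suc (Suc q)) i x =
     (let Phi = (\<lambda>k. let a = knot n p k; b = knot n p (k + q + 2) in
                   if a < b
                   then integral {a..x} (\<lambda>y. gbspl Q mu n p (Suc q) k y)
                        / integral {a..b} (\<lambda>y. gbspl Q mu n p (Suc q) k y)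
                   else (if a < 1 \<and> a \<le> x then 1 else 0))
      in Phi i - Phi (i+1))"

definition GBN :: "gbkind \<Rightarrow> real \<Rightarrow> nat \<Rightarrow> nat \<Rightarrow> nat \<Rightarrow> real \<Rightarrow> real" where
  "GBN Q mu n p i = gbspl Q mu n p p i"

section \<open>Matrices (size n+p-2, 0-based entries (i,j) correspond to 1-based (i+1,j+1))\<close>

definition Kmat :: "gbkind \<Rightarrow> real \<Rightarrow> nat \<Rightarrow> nat \<Rightarrow> real mat" where
  "Kmat Q mu n p = mat (n + p - 2) (n + p - 2) (\<lambda>(i,j).
     (1 / real n) * integral {0..1} (\<lambda>x. deriv (GBN Q mu n p (j+2)) x * deriv (GBN Q mu n p (i+2)) x))"

definition Hmat :: "gbkind \<Rightarrow> real \<Rightarrow> nat \<Rightarrow> nat \<Rightarrow> real mat" where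
  "Hmat Q mu n p = mat (n + p - 2) (n + p - 2) (\<lambda>(i,j).
     integral {0..1} (\<lambda>x. deriv (GBN Q mu n p (j+2)) x * GBN Q mu n p (i+2) x))"

definition Mmat :: "gbkind \<Rightarrow> real \<Rightarrow> nat \<Rightarrow> nat \<Rightarrow> real mat" where
  "Mmat Q mu n p = mat (n + p - 2) (n + p - 2) (\<lambda>(i,j).
     real n * integral {0..1} (\<lambda>x. GBN Q mu n p (j+2) x * GBN Q mu n p (i+2) x))"

definition kron :: "'a :: times mat \<Rightarrow> 'a mat \<Rightarrow> 'a mat" where
  "kron X Y = mat (dim_row X * dim_row Y) (dim_col X * dim_col Y)
     (\<lambda>(r,c). X $$ (r div dim_row Y, c div dim_col Y) * Y $$ (r mod dim_row Y, c mod dim_col Y))"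

definition eigvals :: "real mat \<Rightarrow> complex multiset" where
  "eigvals A = proots (char_poly (map_mat complex_of_real A))"

fun cardB :: "nat \<Rightarrow> real \<Rightarrow> real" where
  "cardB 0 t = (if 0 \<le> t \<and> t < 1 then 1 else 0)"
| "cardB (Suc q) t = t / real (Suc q) * cardB q t + (real q + 2 - t) / real (Suc q) * cardB q (t - 1)"

definition hsym :: "nat \<Rightarrow> real \<Rightarrow> real" where
  "hsym p \<theta> = cardB (2*p+1) (real p + 1)
     + 2 * (\<Sum>k=1..p. cardB (2*p+1) (real p + 1 - real k) * cos (real k * \<theta>))"

definition fsym :: "nat \<Rightarrow> real \<Rightarrow> real" where
  "fsym p \<theta> = - deriv (deriv (cardB (2*p+1))) (real p + 1)
     - 2 * (\<Sum>k=1..p. deriv (deriv (cardB (2*p+1))) (real p + 1 - real k) * cos (real k * \<theta>))"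


definition n2of :: "real \<Rightarrow> nat \<Rightarrow> nat" where
  "n2of \<nu> n1 = nat (round (\<nu> * real n1))"

definition Amat :: "gbkind \<Rightarrow> real \<Rightarrow> real \<Rightarrow> nat \<Rightarrow> nat \<Rightarrow> real \<Rightarrow> real \<Rightarrow> real \<Rightarrow> real \<Rightarrow> nat \<Rightarrow> real mat" where
  "Amat Q \<alpha>1 \<alpha>2 p1 p2 \<beta>1 \<beta>2 \<gamma> \<nu> n1 = (let n2 = n2of \<nu> n1 in
        (1 / \<nu>) \<cdot>\<^sub>m kron (Mmat Q \<alpha>2 n2 p2) (Kmat Q \<alpha>1 n1 p1)
      + \<nu> \<cdot>\<^sub>m kron (Kmat Q \<alpha>2 n2 p2) (Mmat Q \<alpha>1 n1 p1)
      + (\<beta>1 / (\<nu> * real n1)) \<cdot>\<^sub>m kron (Mmat Q \<alpha>2 n2 p2) (Hmat Q \<alpha>1 n1 p1)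
      + (\<beta>2 / real n1) \<cdot>\<^sub>m kron (Hmat Q \<alpha>2 n2 p2) (Mmat Q \<alpha>1 n1 p1)
      + (\<gamma> / (\<nu> * (real n1)\<^sup>2)) \<cdot>\<^sub>m kron (Mmat Q \<alpha>2 n2 p2) (Mmat Q \<alpha>1 n1 p1))"

end

theory Submission
  imports Defs "Jordan_Normal_Form.Schur_Decomposition" "HOL-Real_Asymp.Real_Asymp"
begin

text \<open>At mesh width \<open>1 / n\<close> the phase \<open>\<mu> / n\<close> of the generalized splines tends to zero, so the
  GB-splines and their slopes approach polynomial B-splines uniformly. Away from the boundary the
  scaled mass and stiffness matrices therefore approach Toeplitz matrices whose entries are
  autocorrelations of the cardinal B-spline and of its slope, that is, values and second derivatives
  of the cardinal B-spline of degree \<open>2p + 1\<close>. The matrix \<open>A\<close> is, up to vanishing lower-order terms, a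
  combination of Kronecker products of these, hence a two-level banded Toeplitz matrix perturbed near
  the boundary. The trace of its \<open>k\<close>-th power counts closed walks of \<open>k\<close> bounded steps; all but a
  negligible proportion of them stay away from the boundary, so the \<open>k\<close>-th moment of the eigenvalues
  converges to the constant Fourier coefficient of the \<open>k\<close>-th power of the symbol. The skew part
  vanishes, so the eigenvalues approach the real axis inside a fixed disc, and Weierstrass
  approximation extends the convergence from polynomials to continuous test functions.\<close>

section \<open>Cardinal B-splines\<close>

lemma cardB_eq_0: "t < 0 \<or> t \<ge> real q + 1 \<Longrightarrow> cardB q t = 0"
  by (induction q arbitrary: t) (auto split: if_splits)

lemma cardB_recurrence:
  "(real q + 1) * cardB (Suc q) t = t * cardB q t + (real q + 2 - t) * cardB q (t - 1)"
proof -
  have "real (Suc q) * (t / real (Suc q) * A + v / real (Suc q) * B) = t * A + v * B" for v A B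
    by (simp add: distrib_left del: of_nat_Suc)
  then have "real (Suc q) * cardB (Suc q) t = t * cardB q t + (real q + 2 - t) * cardB q (t - 1)"
    unfolding cardB.simps(2) .
  then show ?thesis by (simp add: add.commute)
qed

declare cardB.simps(2) [simp del]

lemma cardB_nonneg: "0 \<le> cardB q t"
proof (induction q arbitrary: t)
  case (Suc q)
  have "0 \<le> t * cardB q t"
    using Suc[of t] cardB_eq_0[of t q] by (cases "t < 0") auto
  moreover have "0 \<le> (real q + 2 - t) * cardB q (t - 1)"
    using Suc[of "t - 1"] cardB_eq_0[of "t - 1" q] by (cases "t > real q + 2") auto
  ultimately have "0 \<le> (real q + 1) * cardB (Suc q) t" unfolding cardB_recurrence by simp
  then show ?case by (simp add: zero_le_mult_iff)
qed simp

lemma cardB_le: "cardB q t \<le> 2 ^ q"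
proof (induction q arbitrary: t)
  case (Suc q)
  have "t * cardB q t \<le> (real q + 1) * 2 ^ q"
  proof (cases "0 \<le> t \<and> t < real q + 1")
    case True
    then show ?thesis using Suc[of t] by (intro mult_mono cardB_nonneg) auto
  qed (use cardB_eq_0[of t q] in auto)
  moreover have "(real q + 2 - t) * cardB q (t - 1) \<le> (real q + 1) * 2 ^ q"
  proof (cases "0 \<le> t - 1 \<and> t - 1 < real q + 1")
    case True
    then show ?thesis using Suc[of "t - 1"] by (intro mult_mono cardB_nonneg) auto
  qed (use cardB_eq_0[of "t - 1" q] in auto)
  ultimately have "(real q + 1) * cardB (Suc q) t \<le> (real q + 1) * 2 ^ Suc q"
    unfolding cardB_recurrence by simp
  then show ?case by (rule mult_left_le_imp_le) simp
qed simp

lemma abs_cardB_le: "\<bar>cardB q t\<bar> \<le> 2 ^ q"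
  using cardB_nonneg cardB_le by simp

lemma cardB_borel [measurable]: "cardB q \<in> borel_measurable borel"
proof (induction q)
  case 0
  have "cardB 0 = indicator {0..<1}" by (auto simp: fun_eq_iff indicator_def)
  then show ?case by simp
next
  case (Suc q)
  note [measurable] = Suc
  have "cardB (Suc q)
      = (\<lambda>t. t / real (Suc q) * cardB q t + (real q + 2 - t) / real (Suc q) * cardB q (t - 1))"
    by (simp add: fun_eq_iff cardB.simps(2))
  then show ?case by simp
qed

lemma cardB_Suc_0: "cardB (Suc 0) t = max 0 (min t (2 - t))"
  by (auto simp: cardB.simps(2) max_def min_def)

lemma isCont_cardB: "isCont (cardB (Suc q)) t"
proof (induction q arbitrary: t)
  case 0
  have "cardB (Suc 0) = (\<lambda>t. max 0 (min t (2 - t)))" using cardB_Suc_0 by blast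
  then show ?case by (auto intro!: continuous_intros)
next
  case (Suc q)
  have "cardB (Suc (Suc q)) = (\<lambda>t. t / real (Suc (Suc q)) * cardB (Suc q) t
      + (real (Suc q) + 2 - t) / real (Suc (Suc q)) * cardB (Suc q) (t - 1))"
    by (rule ext) (rule cardB.simps(2))
  moreover have "isCont (\<lambda>t. cardB (Suc q) (t - 1)) t"
    by (rule isCont_o2[OF _ Suc]) (auto intro!: continuous_intros)
  ultimately show ?case using Suc[of t] by (auto intro!: continuous_intros)
qed

lemma DERIV_cardB_Suc_0:
  assumes "t \<notin> \<int>"
  shows "(cardB (Suc 0) has_real_derivative cardB 0 t - cardB 0 (t - 1)) (at t)"
proof -
  have "t \<noteq> of_int 0" "t \<noteq> of_int 1" "t \<noteq> of_int 2" using assms Ints_of_int by blast+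
  then consider (negative) "t < 0" | (rising) "0 < t" "t < 1" | (falling) "1 < t" "t < 2" | (beyond) "2 < t"
    by fastforce
  then show ?thesis
  proof cases
    case negative
    show ?thesis
      by (rule has_field_derivative_transform_within_open[of "\<lambda>_. 0" _ t "{..<0}"])
        (use negative in \<open>auto simp: cardB_Suc_0\<close>)
  next
    case rising
    show ?thesis
      by (rule has_field_derivative_transform_within_open[of "\<lambda>u. u" _ t "{0<..<1}"])
        (use rising in \<open>auto simp: cardB_Suc_0\<close>)
  next
    case falling
    show ?thesis
      by (rule has_field_derivative_transform_within_open[of "\<lambda>u. 2 - u" _ t "{1<..<2}"])
        (use falling in \<open>auto simp: cardB_Suc_0 intro!: derivative_eq_intros\<close>)
  next
    case beyond
    show ?thesis
      by (rule has_field_derivative_transform_within_open[of "\<lambda>_. 0" _ t "{2<..}"])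
        (use beyond in \<open>auto simp: cardB_Suc_0\<close>)
  qed
qed

lemma DERIV_cardB_not_Ints:
  "t \<notin> \<int> \<Longrightarrow> (cardB (Suc q) has_real_derivative cardB q t - cardB q (t - 1)) (at t)"
proof (induction q arbitrary: t)
  case 0
  then show ?case by (rule DERIV_cardB_Suc_0)
next
  case (Suc q)
  have shifted_notin: "t - 1 \<notin> \<int>" using Suc.prems by (metis Ints_1 Ints_add diff_add_cancel)
  have "((\<lambda>t. cardB (Suc q) (t - 1)) has_real_derivative (cardB q (t - 1) - cardB q (t - 2)) * 1) (at t)"
    using Suc.IH[OF shifted_notin]
    by (intro DERIV_chain2[where f = "cardB (Suc q)"]) (auto intro!: derivative_eq_intros)
  then have shifted: "((\<lambda>t. cardB (Suc q) (t - 1)) has_real_derivative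
      cardB q (t - 1) - cardB q (t - 2)) (at t)"
    by simp
  have "((\<lambda>t. t * cardB (Suc q) t + (real q + 3 - t) * cardB (Suc q) (t - 1)) has_real_derivative
      cardB (Suc q) t + (cardB q t - cardB q (t - 1)) * t
      + (- cardB (Suc q) (t - 1) + (cardB q (t - 1) - cardB q (t - 2)) * (real q + 3 - t))) (at t)"
    by (rule derivative_eq_intros Suc.IH[OF Suc.prems] shifted refl | simp)+
  also have "cardB (Suc q) t + (cardB q t - cardB q (t - 1)) * t
      + (- cardB (Suc q) (t - 1) + (cardB q (t - 1) - cardB q (t - 2)) * (real q + 3 - t))
      = (real q + 2) * (cardB (Suc q) t - cardB (Suc q) (t - 1))"
    using cardB_recurrence[of q t] cardB_recurrence[of q "t - 1"] by (simp add: algebra_simps)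
  also have "(\<lambda>t. t * cardB (Suc q) t + (real q + 3 - t) * cardB (Suc q) (t - 1))
      = (\<lambda>t. (real q + 2) * cardB (Suc (Suc q)) t)"
    using cardB_recurrence[of "Suc q"] by (simp add: add.commute)
  finally show ?case using DERIV_cdivide[where c = "real q + 2"] by fastforce
qed

lemma finite_affine_Ints:
  fixes n :: real
  assumes "n > 0" shows "finite {x \<in> {a..b}. n * x - c \<in> \<int>}"
proof (rule finite_imageD)
  have "(\<lambda>x. n * x - c) ` {x \<in> {a..b}. n * x - c \<in> \<int>} \<subseteq> {y \<in> \<int>. n * a - c \<le> y \<and> y \<le> n * b - c}"
    using assms by auto
  then show "finite ((\<lambda>x. n * x - c) ` {x \<in> {a..b}. n * x - c \<in> \<int>})"
    by (rule finite_subset) (rule finite_int_segment)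
  show "inj_on (\<lambda>x. n * x - c) {x \<in> {a..b}. n * x - c \<in> \<int>}"
    using assms by (auto simp: inj_on_def)
qed

text \<open>The fundamental theorem of calculus with finitely many exceptional points also covers
  degree 0, where the integrand jumps at the knots.\<close>
lemma cardB_difference_has_integral:
  assumes "n > 0" "a \<le> b"
  shows "((\<lambda>y. n * (cardB q (n * y - c) - cardB q (n * y - c - 1))) has_integral
    cardB (Suc q) (n * b - c) - cardB (Suc q) (n * a - c)) {a..b}"
proof (rule fundamental_theorem_of_calculus_interior_strong[OF
      finite_affine_Ints[OF assms(1), of a b c] assms(2)])
  fix x assume "x \<in> {a<..<b} - {x \<in> {a..b}. n * x - c \<in> \<int>}"
  then have "n * x - c \<notin> \<int>" by auto
  from DERIV_cardB_not_Ints[OF this, of q]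
  have "((\<lambda>x. cardB (Suc q) (n * x - c)) has_real_derivative
     (cardB q (n * x - c) - cardB q (n * x - c - 1)) * n) (at x)"
    by (rule DERIV_chain2) (auto intro!: derivative_eq_intros)
  then show "((\<lambda>x. cardB (Suc q) (n * x - c)) has_vector_derivative
     n * (cardB q (n * x - c) - cardB q (n * x - c - 1))) (at x)"
    by (simp add: has_real_derivative_iff_has_vector_derivative mult.commute)
next
  show "continuous_on {a..b} (\<lambda>x. cardB (Suc q) (n * x - c))"
    by (intro continuous_at_imp_continuous_on ballI isCont_o2[OF _ isCont_cardB])
      (auto intro!: continuous_intros)
qed

lemma DERIV_cardB:
  "(cardB (Suc (Suc q)) has_real_derivative cardB (Suc q) t - cardB (Suc q) (t - 1)) (at t)"
proof (rule has_field_derivative_transform_within_open)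
  let ?g = "\<lambda>y. cardB (Suc q) y - cardB (Suc q) (y - 1)"
  have "isCont ?g y" for y
    by (intro continuous_intros isCont_cardB isCont_o2[OF _ isCont_cardB])
  then have "((\<lambda>u. integral {t - 1..u} ?g) has_real_derivative ?g t) (at t within {t - 1..t + 1})"
    by (intro integral_has_real_derivative continuous_at_imp_continuous_on) auto
  then show "((\<lambda>u. cardB (Suc (Suc q)) (t - 1) + integral {t - 1..u} ?g) has_real_derivative ?g t) (at t)"
    by (auto simp: at_within_Icc_at intro!: derivative_eq_intros)
  show "cardB (Suc (Suc q)) (t - 1) + integral {t - 1..u} ?g = cardB (Suc (Suc q)) u"
    if "u \<in> {t - 1 <..}" for u
    using integral_unique[OF cardB_difference_has_integral[of 1 "t - 1" u "Suc q" 0]] that by simp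
qed auto

lemma deriv_deriv_cardB:
  "deriv (deriv (cardB (Suc (Suc (Suc q))))) t
    = cardB (Suc q) t - 2 * cardB (Suc q) (t - 1) + cardB (Suc q) (t - 2)"
proof -
  have first: "deriv (cardB (Suc (Suc (Suc q)))) = (\<lambda>t. cardB (Suc (Suc q)) t - cardB (Suc (Suc q)) (t - 1))"
    by (rule ext, rule DERIV_imp_deriv, rule DERIV_cardB)
  have "((\<lambda>t. cardB (Suc (Suc q)) (t - 1)) has_real_derivative
      (cardB (Suc q) (t - 1) - cardB (Suc q) (t - 1 - 1)) * 1) (at t)"
    by (rule DERIV_chain2[OF DERIV_cardB]) (auto intro!: derivative_eq_intros)
  from DERIV_diff[OF DERIV_cardB[of q t] this]
  have "((\<lambda>t. cardB (Suc (Suc q)) t - cardB (Suc (Suc q)) (t - 1)) has_real_derivative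
      cardB (Suc q) t - 2 * cardB (Suc q) (t - 1) + cardB (Suc q) (t - 2)) (at t)"
    by (simp add: algebra_simps)
  then show ?thesis unfolding first by (rule DERIV_imp_deriv)
qed

lemma cardB_Suc_nonpos: "t \<le> 0 \<Longrightarrow> cardB (Suc q) t = 0"
  using cardB_recurrence[of q t] cardB_eq_0[of t q] cardB_eq_0[of "t - 1" q] by (cases "t = 0") auto

subsection \<open>Convolutions and correlations\<close>

lemma cardB_has_integral_unit_interval: "(cardB q has_integral cardB (Suc q) (t + 1)) {t..t + 1}"
proof -
  obtain N :: nat where N: "t + 1 < real N" using reals_Archimedean2 by blast
  let ?C = "\<lambda>k. cardB (Suc q) (t + 1 - real k)"
  have "((\<lambda>y. \<Sum>k<N. cardB q (y - real k) - cardB q (y - real (Suc k)))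
      has_integral (\<Sum>k<N. ?C k - ?C (Suc k))) {t..t + 1}"
  proof (rule has_integral_sum)
    show "((\<lambda>y. cardB q (y - real k) - cardB q (y - real (Suc k))) has_integral ?C k - ?C (Suc k)) {t..t + 1}"
        for k
      using cardB_difference_has_integral[of 1 t "t + 1" q "real k"] by (simp add: algebra_simps)
  qed simp
  also have "(\<Sum>k<N. ?C k - ?C (Suc k)) = cardB (Suc q) (t + 1)"
    using N sum_lessThan_telescope'[of ?C N] by (simp add: cardB_eq_0)
  finally show ?thesis
  proof (rule has_integral_eq[rotated])
    show "(\<Sum>k<N. cardB q (y - real k) - cardB q (y - real (Suc k))) = cardB q y" if "y \<in> {t..t + 1}" for y
      using N that sum_lessThan_telescope'[of "\<lambda>k. cardB q (y - real k)" N] by (simp add: cardB_eq_0)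
  qed
qed

lemma integrable_mult_bounded_support:
  fixes f g :: "real \<Rightarrow> real"
  assumes f: "\<And>x. \<bar>f x\<bar> \<le> B" and g: "\<And>x. \<bar>g x\<bar> \<le> C"
    and [measurable]: "f \<in> borel_measurable borel" "g \<in> borel_measurable borel"
    and support: "\<And>x. x \<notin> {a..b} \<Longrightarrow> f x = 0"
  shows "integrable lborel (\<lambda>x. f x * g x)"
proof (rule Bochner_Integration.integrable_bound)
  show "integrable lborel (\<lambda>x. B * C * indicator {a..b} x :: real)"
    by (intro integrable_mult_right integrable_real_indicator) (auto simp: emeasure_lborel_Icc_eq)
  have "\<bar>f x\<bar> * \<bar>g x\<bar> \<le> \<bar>B\<bar> * \<bar>C\<bar>" for x
    using f[of x] g[of x] by (intro mult_mono) auto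
  then show "AE x in lborel. norm (f x * g x) \<le> norm (B * C * indicator {a..b} x :: real)"
    by (intro AE_I2) (auto simp: abs_mult support split: split_indicator)
qed simp

lemma integrable_cardB_mult:
  assumes "g \<in> borel_measurable borel" "\<And>x. \<bar>g x\<bar> \<le> B"
  shows "integrable lborel (\<lambda>x. cardB q x * g x)"
  using assms
  by (intro integrable_mult_bounded_support[OF abs_cardB_le _ cardB_borel, where a = 0 and b = "real q + 1"])
    (auto intro!: cardB_eq_0)

lemma cardB_Suc_average:
  "cardB (Suc q) (t + 1) = (\<integral>s. indicator {0..1} s * cardB q (t + s) \<partial>lborel)"
proof -
  have "set_integrable lborel {t..t + 1} (cardB q)"
    using integrable_cardB_mult[of "indicator {t..t + 1}" 1 q]
    by (simp add: set_integrable_def mult.commute indicator_def)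
  then have "cardB (Suc q) (t + 1) = (\<integral>s. indicator {t..t + 1} s * cardB q s \<partial>lborel)"
    using set_borel_integral_eq_integral(2)[of "{t..t + 1}" "cardB q"]
      integral_unique[OF cardB_has_integral_unit_interval]
    by (simp add: set_lebesgue_integral_def)
  also have "\<dots> = (\<integral>s. indicator {t..t + 1} (t + s) * cardB q (t + s) \<partial>lborel)"
    by (subst lborel_integral_real_affine[where c = 1 and t = t]) simp_all
  also have "\<dots> = (\<integral>s. indicator {0..1} s * cardB q (t + s) \<partial>lborel)"
    by (intro Bochner_Integration.integral_cong) (auto split: split_indicator)
  finally show ?thesis .
qed

lemma cardB_Suc_convolution:
  "cardB (Suc q) t = (\<integral>s. indicator {0..1} s * cardB q (t - s) \<partial>lborel)"
  using cardB_Suc_average[of q "t - 1"]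
  by (subst (asm) lborel_integral_real_affine[where c = "-1" and t = 1])
    (auto simp: indicator_def algebra_simps intro!: Bochner_Integration.integral_cong)

lemma integrable_cardB_convolution:
  "integrable (lborel \<Otimes>\<^sub>M lborel) (\<lambda>(t, s). indicator {0..1} s * (cardB a (t - s) * cardB b (t + y)) :: real)"
    (is "integrable _ ?F")
proof (rule Bochner_Integration.integrable_bound)
  let ?box = "{0..real a + 2} \<times> {0..1::real}"
  show "integrable (lborel \<Otimes>\<^sub>M lborel) (\<lambda>x. 2 ^ a * 2 ^ b * indicator ?box x :: real)"
    by (intro integrable_mult_right integrable_real_indicator)
      (auto simp: lborel.emeasure_pair_measure_Times ennreal_mult_less_top)
  show "?F \<in> borel_measurable (lborel \<Otimes>\<^sub>M lborel)" by measurable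
  show "AE x in lborel \<Otimes>\<^sub>M lborel. norm (?F x) \<le> norm (2 ^ a * 2 ^ b * indicator ?box x :: real)"
  proof (rule AE_I2)
    fix x :: "real \<times> real"
    obtain t s where x: "x = (t, s)" by force
    have "\<bar>cardB a (t - s)\<bar> * \<bar>cardB b (t + y)\<bar> \<le> 2 ^ a * 2 ^ b"
      by (intro mult_mono abs_cardB_le) auto
    then show "norm (?F x) \<le> norm (2 ^ a * 2 ^ b * indicator ?box x :: real)"
      using cardB_eq_0[of "t - s" a] by (auto simp: x abs_mult split: split_indicator)
  qed
qed

definition correlation :: "(real \<Rightarrow> real) \<Rightarrow> (real \<Rightarrow> real) \<Rightarrow> real \<Rightarrow> real" where
  "correlation f g y = (\<integral>t. f t * g (t + y) \<partial>lborel)"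

lemma correlation_cardB: "correlation (cardB a) (cardB b) y = cardB (a + b + 1) (real a + 1 + y)"
  unfolding correlation_def
proof (induction a arbitrary: y)
  case 0
  have "(\<integral>t. cardB 0 t * cardB b (t + y) \<partial>lborel) = (\<integral>t. indicator {0..1} t * cardB b (y + t) \<partial>lborel)"
  proof (rule integral_cong_AE)
    have "AE t in lborel. t \<noteq> (1::real)" by (rule AE_lborel_singleton)
    then show "AE t in lborel. cardB 0 t * cardB b (t + y) = indicator {0..1} t * cardB b (y + t)"
      by eventually_elim (auto simp: add.commute)
  qed auto
  also have "\<dots> = cardB (Suc b) (y + 1)" by (rule cardB_Suc_average[symmetric])
  finally show ?case by (simp add: add.commute)
next
  case (Suc a)
  let ?F = "\<lambda>t s. indicator {0..1} s * (cardB a (t - s) * cardB b (t + y))"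
  have "(\<integral>t. cardB (Suc a) t * cardB b (t + y) \<partial>lborel) = (\<integral>t. (\<integral>s. ?F t s \<partial>lborel) \<partial>lborel)"
    unfolding cardB_Suc_convolution by (simp add: mult.assoc[symmetric])
  also have "\<dots> = (\<integral>s. (\<integral>t. ?F t s \<partial>lborel) \<partial>lborel)"
    by (rule lborel_pair.Fubini_integral[OF integrable_cardB_convolution, symmetric])
  also have "\<dots> = (\<integral>s. indicator {0..1} s * cardB (a + b + 1) (real a + 1 + y + s) \<partial>lborel)"
  proof (rule Bochner_Integration.integral_cong[OF refl])
    fix s :: real
    have "(\<integral>t. cardB a (t - s) * cardB b (t + y) \<partial>lborel) = (\<integral>t. cardB a t * cardB b (t + (y + s)) \<partial>lborel)"
      by (subst lborel_integral_real_affine[where c = 1 and t = s]) (simp_all add: ac_simps)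
    also have "\<dots> = cardB (a + b + 1) (real a + 1 + (y + s))" by (rule Suc)
    finally show "(\<integral>t. ?F t s \<partial>lborel) = indicator {0..1} s * cardB (a + b + 1) (real a + 1 + y + s)"
      by (simp add: add.assoc)
  qed
  also have "\<dots> = cardB (Suc (a + b + 1)) (real a + 1 + y + 1)"
    by (rule cardB_Suc_average[symmetric])
  finally show ?case by (simp add: ac_simps)
qed

definition cardB_slope :: "nat \<Rightarrow> real \<Rightarrow> real" where
  "cardB_slope q t = cardB q t - cardB q (t - 1)"

lemma correlation_cardB_slope:
  "correlation (cardB_slope q) (cardB_slope q) y = - deriv (deriv (cardB (2 * q + 3))) (real q + 2 + y)"
proof -
  let ?I = "\<lambda>u v. (\<integral>t. cardB q (t + u) * cardB q (t + v) \<partial>lborel)"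
  have int: "integrable lborel (\<lambda>t. cardB q (t + u) * cardB q (t + v))" for u v
    using lborel_integrable_real_affine[OF
        integrable_cardB_mult[of "\<lambda>t. cardB q (t - u + v)" "2 ^ q" q], of 1 u]
    by (simp add: abs_cardB_le add.commute)
  have shifted_correlation: "?I u v = cardB (2 * q + 1) (real q + 1 + (v - u))" for u v
    using lborel_integral_real_affine[of 1 "\<lambda>t. cardB q t * cardB q (t + (v - u))" u]
      correlation_cardB[of q q "v - u"]
    by (simp add: correlation_def add.commute mult_2)
  have "correlation (cardB_slope q) (cardB_slope q) y
      = (\<integral>t. cardB q (t + 0) * cardB q (t + y) - cardB q (t + 0) * cardB q (t + (y - 1))
        - cardB q (t + (-1)) * cardB q (t + y) + cardB q (t + (-1)) * cardB q (t + (y - 1)) \<partial>lborel)"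
    unfolding correlation_def cardB_slope_def
    by (intro Bochner_Integration.integral_cong) (auto simp: algebra_simps)
  also have "\<dots> = ?I 0 y - ?I 0 (y - 1) - ?I (-1) y + ?I (-1) (y - 1)"
    by (simp only: Bochner_Integration.integral_add Bochner_Integration.integral_diff
        Bochner_Integration.integrable_diff int)
  also have "\<dots> = 2 * cardB (2 * q + 1) (real q + 1 + y) - cardB (2 * q + 1) (real q + y)
      - cardB (2 * q + 1) (real q + 2 + y)"
    unfolding shifted_correlation by (simp add: algebra_simps)
  also have "\<dots> = - deriv (deriv (cardB (2 * q + 3))) (real q + 2 + y)"
    using deriv_deriv_cardB[of "2 * q" "real q + 2 + y"] by (simp add: eval_nat_numeral algebra_simps)
  finally show ?thesis .
qed

section \<open>Localised functions and distribution functions on the unit interval\<close>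

definition localized :: "real \<Rightarrow> real \<Rightarrow> real \<Rightarrow> (real \<Rightarrow> real) \<Rightarrow> bool" where
  "localized a b C f \<longleftrightarrow> f \<in> borel_measurable (lebesgue_on {0..1})
    \<and> (\<forall>x\<in>{0..1}. \<bar>f x\<bar> \<le> C) \<and> (\<forall>x\<in>{0..1}. x \<notin> {a..b} \<longrightarrow> f x = 0)"

lemma localizedD:
  assumes "localized a b C f"
  shows "f \<in> borel_measurable (lebesgue_on {0..1})"
    and "x \<in> {0..1} \<Longrightarrow> \<bar>f x\<bar> \<le> C"
    and "x \<in> {0..1} \<Longrightarrow> x \<notin> {a..b} \<Longrightarrow> f x = 0"
  using assms by (simp_all add: localized_def)

lemma localized_bound_nonneg:
  assumes "localized a b C f" shows "0 \<le> C"
  using localizedD(2)[OF assms, of 0] by simp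

lemma localized_continuous:
  assumes "continuous_on {0..1} f" "\<And>x. x \<in> {0..1} \<Longrightarrow> \<bar>f x\<bar> \<le> C"
    "\<And>x. x \<in> {0..1} \<Longrightarrow> x \<notin> {a..b} \<Longrightarrow> f x = 0"
  shows "localized a b C f"
  using continuous_imp_measurable_on_sets_lebesgue[OF assms(1)] assms(2,3) by (simp add: localized_def)

lemma localized_cong:
  assumes "\<And>x. x \<in> {0..1} \<Longrightarrow> f x = g x"
  shows "localized a b C f \<longleftrightarrow> localized a b C g"
  using assms measurable_cong[of "lebesgue_on {0..1}" f g borel] by (simp add: localized_def)

lemma localized_mono:
  "localized a b B f \<Longrightarrow> a' \<le> a \<Longrightarrow> b \<le> b' \<Longrightarrow> B \<le> B' \<Longrightarrow> localized a' b' B' f"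
  unfolding localized_def by force

lemma localized_sharpen:
  "localized a b B f \<Longrightarrow> (\<And>x. x \<in> {0..1} \<Longrightarrow> \<bar>f x\<bar> \<le> C) \<Longrightarrow> localized a b C f"
  by (simp add: localized_def)

lemma localized_add:
  assumes "localized a b B f" "localized a b C g"
  shows "localized a b (B + C) (\<lambda>x. f x + g x)"
proof -
  have "\<bar>f x + g x\<bar> \<le> B + C" if "x \<in> {0..1}" for x
    using localizedD(2)[OF assms(1) that] localizedD(2)[OF assms(2) that] by linarith
  then show ?thesis using assms by (simp add: localized_def borel_measurable_add)
qed

lemma localized_cmult: "localized a b B f \<Longrightarrow> localized a b (\<bar>c\<bar> * B) (\<lambda>x. c * f x)"
  unfolding localized_def by (auto simp: abs_mult mult_left_mono)

lemma localized_diff: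
  assumes "localized a b B f" "localized a b C g"
  shows "localized a b (B + C) (\<lambda>x. f x - g x)"
  using localized_add[OF assms(1) localized_cmult[OF assms(2), of "-1"]] by simp

lemma localized_mult:
  assumes "localized a b B f" "localized c d C g"
  shows "localized a b (B * C) (\<lambda>x. f x * g x)"
  using assms localized_bound_nonneg[OF assms(1)] unfolding localized_def
  by (auto simp: abs_mult intro!: borel_measurable_times mult_mono)

lemma localized_integrable_on:
  assumes "localized a b C f" "0 \<le> u" "v \<le> 1"
  shows "f integrable_on {u..v}"
proof -
  have "f integrable_on {0..1}"
  proof (rule measurable_bounded_by_integrable_imp_integrable_real)
    show "(\<lambda>_. C) integrable_on {0..1::real}" by (rule integrable_const_ivl)
  qed (use localizedD[OF assms(1)] in simp_all)
  then show ?thesis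
    by (rule integrable_on_subinterval) (use assms in auto)
qed

lemma localized_integral_Int:
  assumes "localized a b C f" "0 \<le> u" "v \<le> 1"
  shows "integral {u..v} f = integral ({a..b} \<inter> {u..v}) f"
proof -
  have "integral {u..v} f = integral {u..v} (\<lambda>x. if x \<in> {a..b} then f x else 0)"
    using assms by (intro integral_cong) (auto simp: localized_def)
  also have "\<dots> = integral ({a..b} \<inter> {u..v}) f" by (rule integral_restrict_Int)
  finally show ?thesis .
qed

lemma abs_integral_localized_le:
  assumes f: "localized a b C f" and "a \<le> b" "0 \<le> u" "v \<le> 1"
  shows "\<bar>integral {u..v} f\<bar> \<le> C * (b - a)"
proof -
  have "\<bar>integral {max a u..min b v} f\<bar> \<le> integral {max a u..min b v} (\<lambda>_. C)"
    unfolding real_norm_def[symmetric] using assms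
    by (intro integral_norm_bound_integral localized_integrable_on[OF f] integrable_const_ivl)
      (auto intro: localizedD(2)[OF f])
  also have "\<dots> \<le> C * (b - a)"
    using \<open>a \<le> b\<close> localized_bound_nonneg[OF f] by (auto simp: content_real_if mult_left_mono mult.commute)
  finally show ?thesis unfolding localized_integral_Int[OF f assms(3,4)] Int_atLeastAtMost .
qed

lemma integral_mult_localized_disjoint:
  assumes "localized a b B f" "localized c d C g" "b \<le> c"
  shows "integral {0..1} (\<lambda>x. f x * g x) = 0"
proof -
  have "integral {0..1} (\<lambda>x. f x * g x) = integral {0..1} (\<lambda>_::real. 0::real)"
  proof (rule integral_spike[of "{c}"])
    fix x assume x: "x \<in> {0..1} - {c}"
    then have "x \<notin> {a..b} \<or> x \<notin> {c..d}" using assms(3) by auto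
    then show "0 = f x * g x" using localizedD(3)[OF assms(1)] localizedD(3)[OF assms(2)] x by auto
  qed simp
  then show ?thesis by simp
qed

text \<open>In the degenerate case \<open>a = b\<close> the density is zero, but its distribution function is the step
  function of the point mass at \<open>a\<close>, for which only \<open>a = 0\<close> and \<open>a = 1\<close> are allowed.\<close>
definition unit_density :: "real \<Rightarrow> real \<Rightarrow> real \<Rightarrow> (real \<Rightarrow> real) \<Rightarrow> bool" where
  "unit_density a b C f \<longleftrightarrow> 0 \<le> a \<and> a \<le> b \<and> b \<le> 1 \<and> localized a b C f
    \<and> (if a < b then integral {0..1} f = 1 else (a = 0 \<or> a = 1) \<and> f = (\<lambda>_. 0))"

definition cdf_on :: "real \<Rightarrow> real \<Rightarrow> (real \<Rightarrow> real) \<Rightarrow> real \<Rightarrow> real" where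
  "cdf_on a b f x = (if a < b then integral {0..x} f else if a < 1 then 1 else 0)"

definition normalized :: "real \<Rightarrow> real \<Rightarrow> (real \<Rightarrow> real) \<Rightarrow> real \<Rightarrow> real" where
  "normalized a b f x = (if a < b then f x / integral {0..1} f else 0)"

lemma unit_densityD:
  assumes "unit_density a b C f"
  shows "0 \<le> a" "a \<le> b" "b \<le> 1" "localized a b C f" "a < b \<Longrightarrow> integral {0..1} f = 1"
    "\<not> a < b \<Longrightarrow> a = b \<and> (a = 0 \<or> a = 1)" "\<not> a < b \<Longrightarrow> f = (\<lambda>_. 0)"
  using assms by (auto simp: unit_density_def)

lemma unit_density_normalized:
  assumes f: "localized a b C f" and ab: "0 \<le> a" "a \<le> b" "b \<le> 1" "a < b \<or> a = 0 \<or> a = 1"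
    and mass: "0 \<le> K" "a < b \<Longrightarrow> 0 < K" "a < b \<Longrightarrow> K \<le> integral {0..1} f"
  shows "unit_density a b (C / K) (normalized a b f)"
proof (cases "a < b")
  case True
  then have "\<bar>1 / integral {0..1} f\<bar> * C \<le> C / K"
    using mass(2,3) localized_bound_nonneg[OF f] by (auto simp: frac_le)
  with localized_mono[OF localized_cmult[OF f]]
  have "localized a b (C / K) (\<lambda>x. (1 / integral {0..1} f) * f x)"
    by blast
  then show ?thesis using True ab mass(2,3) by (simp add: unit_density_def normalized_def[abs_def])
next
  case False
  have "0 \<le> C / K" using mass(1) localized_bound_nonneg[OF f] by simp
  then show ?thesis using False ab by (auto simp: unit_density_def normalized_def[abs_def] localized_def)
qed

lemma quotient_perturbation:
  fixes u v U V :: real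
  assumes V: "V = l / m" and l: "l > 0" and m: "m > 0" and U: "\<bar>U - V\<bar> \<le> e * l"
    and e: "2 * m * e \<le> 1" and uv: "\<bar>u - v\<bar> \<le> e" and v: "\<bar>v\<bar> \<le> C"
  shows "\<bar>u / U - v / V\<bar> \<le> 2 * m * (1 + C * m) * e / l" "l / (2 * m) \<le> U"
proof -
  have "2 * m * e * l \<le> 1 * l" using e l by (intro mult_right_mono) auto
  then have "e * l \<le> V / 2" using m unfolding V by (simp add: field_simps)
  then have lower: "V / 2 \<le> U" using U by linarith
  then show "l / (2 * m) \<le> U" using V by simp
  have V_pos: "V > 0" using V l m by simp
  then have U_pos: "U > 0" using lower by linarith
  have "u / U - v / V = (u - v) / U + v * (V - U) / (U * V)"
    using U_pos V_pos by (simp add: field_simps)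
  then have "\<bar>u / U - v / V\<bar> \<le> \<bar>u - v\<bar> / U + \<bar>v\<bar> * \<bar>U - V\<bar> / (U * V)"
    using abs_triangle_ineq[of "(u - v) / U" "v * (V - U) / (U * V)"] U_pos V_pos
    by (simp add: abs_mult abs_minus_commute)
  also have "\<dots> \<le> e / (V / 2) + C * (e * l) / ((V / 2) * V)"
    using uv v U lower V_pos U_pos by (intro add_mono frac_le mult_mono) auto
  also have "\<dots> = 2 * m * (1 + C * m) * e / l"
    using l m unfolding V by (simp add: field_simps)
  finally show "\<bar>u / U - v / V\<bar> \<le> 2 * m * (1 + C * m) * e / l" .
qed

lemma localized_normalized_diff:
  assumes g: "localized a b B g" and close: "localized a b e (\<lambda>x. f x - g x)"
    and ab: "0 \<le> a" "a \<le> b" "b \<le> 1" and mass: "integral {0..1} g = (b - a) / m" "m > 0" "2 * m * e \<le> 1"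
    and gap: "a < b \<Longrightarrow> h \<le> b - a" "h > 0"
  shows "localized a b (2 * m * (1 + B * m) * e / h) (\<lambda>x. normalized a b f x - normalized a b g x)"
    and "a < b \<Longrightarrow> (b - a) / (2 * m) \<le> integral {0..1} f"
proof -
  have f: "localized a b (e + B) f" using localized_add[OF close g] by simp
  have nonneg: "0 \<le> e" "0 \<le> B" by (rule localized_bound_nonneg[OF close], rule localized_bound_nonneg[OF g])
  have "\<bar>integral {0..1} f - integral {0..1} g\<bar> \<le> e * (b - a)"
    using abs_integral_localized_le[OF close ab(2) order.refl order.refl]
      Henstock_Kurzweil_Integration.integral_diff[OF localized_integrable_on[OF f order.refl order.refl]
        localized_integrable_on[OF g order.refl order.refl]] by simp
  note quotient = quotient_perturbation[OF mass(1) _ mass(2) this mass(3)]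
  show "(b - a) / (2 * m) \<le> integral {0..1} f" if "a < b"
    using quotient(2)[where u = 0 and v = 0 and C = 0] that nonneg by simp
  show "localized a b (2 * m * (1 + B * m) * e / h) (\<lambda>x. normalized a b f x - normalized a b g x)"
    unfolding localized_def
  proof (intro conjI ballI impI)
    show "(\<lambda>x. normalized a b f x - normalized a b g x) \<in> borel_measurable (lebesgue_on {0..1})"
      unfolding normalized_def using localizedD(1)[OF f] localizedD(1)[OF g]
      by (cases "a < b") (auto intro!: borel_measurable_diff borel_measurable_divide)
    fix x :: real assume x: "x \<in> {0..1}"
    show "\<bar>normalized a b f x - normalized a b g x\<bar> \<le> 2 * m * (1 + B * m) * e / h"
    proof (cases "a < b")
      case True
      have "\<bar>f x / integral {0..1} f - g x / integral {0..1} g\<bar> \<le> 2 * m * (1 + B * m) * e / (b - a)"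
        using True localizedD(2)[OF close x] localizedD(2)[OF g x] by (intro quotient(1)) auto
      also have "\<dots> \<le> 2 * m * (1 + B * m) * e / h"
        using gap True mass(2) nonneg by (intro divide_left_mono mult_nonneg_nonneg) auto
      finally show ?thesis using True by (simp add: normalized_def)
    qed (use mass(2) gap(2) nonneg in \<open>simp add: normalized_def\<close>)
    assume "x \<notin> {a..b}"
    then show "normalized a b f x - normalized a b g x = 0"
      using localizedD(3)[OF f x] localizedD(3)[OF g x] by (simp add: normalized_def)
  qed
qed

lemma cdf_on_normalized:
  assumes f: "localized a b C f" and ab: "0 \<le> a" "b \<le> 1" "a < b \<or> a = 0 \<or> a = 1" and x: "x \<in> {0..1}"
  shows "cdf_on a b (normalized a b f) x
    = (if a < b then integral {a..x} f / integral {a..b} f else if a < 1 \<and> a \<le> x then 1 else 0)"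
proof (cases "a < b")
  case True
  have "integral {0..x} f = integral {a..x} f"
    using localized_integral_Int[OF f, of 0 x] localized_integral_Int[OF f, of a x] ab x
    by (simp add: max_absorb1)
  moreover have "integral {0..1} f = integral {a..b} f"
    using localized_integral_Int[OF f, of 0 1] ab by (simp add: max_absorb1 min_absorb1)
  ultimately show ?thesis using True by (simp add: cdf_on_def normalized_def[abs_def])
qed (use ab x in \<open>auto simp: cdf_on_def\<close>)

lemma cdf_on_left:
  assumes f: "unit_density a b C f" and x: "0 \<le> x" "x < a"
  shows "cdf_on a b f x = 0"
proof -
  note unit_densityD[OF f]
  moreover have "integral {0..x} f = integral {} f"
    using localized_integral_Int[OF unit_densityD(4)[OF f], of 0 x] unit_densityD(2,3)[OF f] x by simp
  ultimately show ?thesis using x by (auto simp: cdf_on_def)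
qed

lemma cdf_on_right:
  assumes f: "unit_density a b C f" and x: "b < x" "x \<le> 1"
  shows "cdf_on a b f x = 1"
proof -
  note D = unit_densityD[OF f]
  have "{a..b} \<inter> {0..x} = {a..b} \<inter> {0..1}" using x D(3) by auto
  then have "integral {0..x} f = integral {0..1} f"
    using localized_integral_Int[OF D(4), of 0 x] localized_integral_Int[OF D(4), of 0 1] x by simp
  then show ?thesis using D x by (auto simp: cdf_on_def)
qed

lemma abs_cdf_on_le:
  assumes f: "unit_density a b C f" and x: "x \<le> 1"
  shows "\<bar>cdf_on a b f x\<bar> \<le> 1 + C * (b - a)"
proof (cases "a < b")
  case True
  then show ?thesis
    using abs_integral_localized_le[OF unit_densityD(4)[OF f] unit_densityD(2)[OF f] order.refl x]
    by (simp add: cdf_on_def)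
next
  case False
  then show ?thesis using unit_densityD(6)[OF f] by (simp add: cdf_on_def)
qed

lemma continuous_on_cdf_on:
  assumes "unit_density a b C f"
  shows "continuous_on {0..1} (cdf_on a b f)"
  using localized_integrable_on[OF unit_densityD(4)[OF assms]] unfolding cdf_on_def
  by (cases "a < b") (auto intro!: indefinite_integral_continuous_1)

lemma DERIV_cdf_on:
  assumes f: "unit_density a b C f" and x: "x \<in> {0<..<1}" "isCont f x"
  shows "(cdf_on a b f has_real_derivative f x) (at x)"
proof (cases "a < b")
  case True
  have "((\<lambda>u. integral {0..u} f) has_vector_derivative f x) (at x within ({0..1} - {}))"
    using x localized_integrable_on[OF unit_densityD(4)[OF f]]
    by (intro integral_has_vector_derivative_continuous_at)
      (auto intro: continuous_at_imp_continuous_at_within)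
  then have "((\<lambda>u. integral {0..u} f) has_real_derivative f x) (at x)"
    using x by (simp add: has_real_derivative_iff_has_vector_derivative at_within_Icc_at)
  then show ?thesis using True by (simp add: cdf_on_def[abs_def])
qed (use unit_densityD(7)[OF f] in \<open>simp add: cdf_on_def[abs_def]\<close>)

lemma localized_cdf_on_diff:
  assumes f: "unit_density a b B f" and g: "unit_density c d C g" and ord: "a \<le> c" "b \<le> d"
  shows "localized a d ((1 + B * (b - a)) + (1 + C * (d - c))) (\<lambda>x. cdf_on a b f x - cdf_on c d g x)"
proof (rule localized_continuous)
  show "continuous_on {0..1} (\<lambda>x. cdf_on a b f x - cdf_on c d g x)"
    by (intro continuous_on_diff continuous_on_cdf_on[OF f] continuous_on_cdf_on[OF g])
  fix x :: real assume x: "x \<in> {0..1}"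
  then show "\<bar>cdf_on a b f x - cdf_on c d g x\<bar> \<le> (1 + B * (b - a)) + (1 + C * (d - c))"
    using abs_cdf_on_le[OF f, of x] abs_cdf_on_le[OF g, of x] by simp
  assume "x \<notin> {a..d}"
  then show "cdf_on a b f x - cdf_on c d g x = 0"
    using x ord cdf_on_left[OF f, of x] cdf_on_left[OF g, of x] cdf_on_right[OF f, of x]
      cdf_on_right[OF g, of x]
    by (cases "x < a") auto
qed

lemma abs_cdf_on_diff_le:
  assumes f: "unit_density a b B f" and g: "unit_density a b C g"
    and close: "localized a b e (\<lambda>x. f x - g x)" and x: "x \<le> 1"
  shows "\<bar>cdf_on a b f x - cdf_on a b g x\<bar> \<le> e * (b - a)"
proof (cases "a < b")
  case True
  have "integral {0..x} f - integral {0..x} g = integral {0..x} (\<lambda>x. f x - g x)"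
    using x by (intro Henstock_Kurzweil_Integration.integral_diff[symmetric]
        localized_integrable_on[OF unit_densityD(4)[OF f]]
        localized_integrable_on[OF unit_densityD(4)[OF g]]) auto
  then show ?thesis
    using True abs_integral_localized_le[OF close unit_densityD(2)[OF f] order.refl x]
    by (simp add: cdf_on_def)
qed (use unit_densityD(6)[OF f] in \<open>simp add: cdf_on_def\<close>)

lemma isCont_indicator_atLeastLessThan:
  fixes a b x :: real
  assumes "x \<noteq> a" "x \<noteq> b"
  shows "isCont (indicat_real {a..<b}) x"
proof -
  have "closure {a..<b} \<subseteq> {a..b}" by (rule closure_minimal) auto
  moreover have "{a<..<b} \<subseteq> interior {a..<b}" by (rule interior_maximal) auto
  ultimately have "x \<notin> frontier {a..<b}" using assms unfolding frontier_def by force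
  then show ?thesis by (simp add: isCont_indicator)
qed

lemma has_integral_power:
  fixes a b :: real
  assumes "a \<le> b"
  shows "((\<lambda>x. x ^ m) has_integral (b ^ Suc m / real (Suc m) - a ^ Suc m / real (Suc m))) {a..b}"
proof (rule fundamental_theorem_of_calculus[OF assms])
  fix x assume "x \<in> {a..b}"
  have "((\<lambda>x. x ^ Suc m / real (Suc m)) has_real_derivative
      real (Suc m) * x ^ (Suc m - Suc 0) / real (Suc m)) (at x within {a..b})"
    by (rule DERIV_cdivide[OF DERIV_pow])
  then show "((\<lambda>x. x ^ Suc m / real (Suc m)) has_vector_derivative x ^ m) (at x within {a..b})"
    by (simp add: has_real_derivative_iff_has_vector_derivative del: of_nat_Suc power_Suc)
qed

lemma localized_power_mult: "localized a b C f \<Longrightarrow> localized a b C (\<lambda>x. x ^ m * f x)"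
  using localized_mult[of a b C f 0 1 1 "\<lambda>x. x ^ m"] localized_continuous[of "\<lambda>x. x ^ m" 1 0 1]
  by (simp add: mult.commute power_le_one continuous_intros)

text \<open>Integration by parts; the step functions of the degenerate case fit the same formula with the
  moments of a point mass.\<close>
lemma integral_power_mult_cdf_on:
  assumes f: "unit_density a b C f" and S: "finite S" "\<And>x. x \<in> {0<..<1} - S \<Longrightarrow> isCont f x"
  shows "integral {0..1} (\<lambda>x. x ^ m * cdf_on a b f x)
    = (1 - (if a < b then integral {0..1} (\<lambda>x. x ^ Suc m * f x) else a ^ Suc m)) / real (Suc m)"
proof (cases "a < b")
  case True
  let ?J = "cdf_on a b f"
  have continuous_cdf: "continuous_on {0..1} ?J" by (rule continuous_on_cdf_on[OF f])
  have cdf_ends: "?J 0 = 0" "?J 1 = 1" using True unit_densityD(5)[OF f] by (simp_all add: cdf_on_def)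
  have "((\<lambda>x. x ^ m * ?J x + x ^ Suc m / real (Suc m) * f x) has_integral
     1 ^ Suc m / real (Suc m) * ?J 1 - 0 ^ Suc m / real (Suc m) * ?J 0) {0..1}"
  proof (rule fundamental_theorem_of_calculus_interior_strong[OF S(1)])
    fix x assume x: "x \<in> {0<..<1} - S"
    then have "(?J has_real_derivative f x) (at x)" using S(2) by (intro DERIV_cdf_on[OF f]) auto
    moreover have "((\<lambda>x. x ^ Suc m / real (Suc m)) has_real_derivative x ^ m) (at x)"
      by (rule derivative_eq_intros refl | simp)+
    ultimately show "((\<lambda>x. x ^ Suc m / real (Suc m) * ?J x) has_vector_derivative
        x ^ m * ?J x + x ^ Suc m / real (Suc m) * f x) (at x)"
      using DERIV_mult[of "\<lambda>x. x ^ Suc m / real (Suc m)" "x ^ m" x UNIV ?J "f x"]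
      by (simp add: has_real_derivative_iff_has_vector_derivative add.commute mult.commute)
  qed (auto intro!: continuous_intros continuous_cdf)
  then have "integral {0..1} (\<lambda>x. x ^ m * ?J x + (x ^ Suc m * f x) / real (Suc m)) = 1 / real (Suc m)"
    using cdf_ends by (simp add: integral_unique)
  moreover have "(\<lambda>x. x ^ m * ?J x) integrable_on {0..1}"
    by (intro integrable_continuous_real continuous_intros continuous_cdf)
  moreover have "(\<lambda>x. (x ^ Suc m * f x) / real (Suc m)) integrable_on {0..1}"
    by (intro integrable_on_divide
      localized_integrable_on[OF localized_power_mult[OF unit_densityD(4)[OF f]]]) auto
  ultimately show ?thesis using True
    by (simp add: Henstock_Kurzweil_Integration.integral_add diff_divide_distrib)
next
  case False
  have "integral {0..1} (\<lambda>x::real. x ^ m) = 1 / real (Suc m)"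
    using has_integral_power[of 0 1 m] by (simp add: integral_unique)
  then show ?thesis using False unit_densityD(6)[OF f] by (auto simp: cdf_on_def)
qed

section \<open>B-splines with open knots\<close>

text \<open>The complete homogeneous symmetric polynomial of degree \<open>m\<close> in the \<open>k\<close> variables
  \<open>s i, \<dots>, s (i + k - 1)\<close>.\<close>
fun complete_hom :: "(nat \<Rightarrow> real) \<Rightarrow> nat \<Rightarrow> nat \<Rightarrow> nat \<Rightarrow> real" where
  "complete_hom s i k 0 = 1"
| "complete_hom s i 0 (Suc m) = 0"
| "complete_hom s i (Suc k) (Suc m) = complete_hom s i k (Suc m) + s (i + k) * complete_hom s i (Suc k) m"

lemma complete_hom_remove_first:
  "complete_hom s i (Suc k) (Suc m) = complete_hom s (Suc i) k (Suc m) + s i * complete_hom s i (Suc k) m"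
proof (induction k arbitrary: m)
  case 0
  show ?case by simp
next
  case (Suc k)
  note outer = Suc
  show ?case
  proof (induction m)
    case 0
    show ?case using outer[of 0] by (simp add: algebra_simps)
  next
    case (Suc m)
    let ?h = "\<lambda>k. complete_hom s i k (Suc m)"
    have "s i * ?h (Suc k) + s (i + Suc k) * ?h (Suc (Suc k))
        = s (i + Suc k) * complete_hom s (Suc i) (Suc k) (Suc m) + s i * ?h (Suc (Suc k))"
      using arg_cong[OF Suc, of "\<lambda>z. s (i + Suc k) * z"]
        arg_cong[OF complete_hom.simps(3)[of s i "Suc k" m], of "\<lambda>z. s i * z"]
      by (simp add: algebra_simps del: complete_hom.simps)
    then show ?case
      using outer[of "Suc m"] by simp
  qed
qed

lemma complete_hom_diff:
  "complete_hom s (Suc i) k (Suc m) - complete_hom s i k (Suc m)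
    = (s (i + k) - s i) * complete_hom s i (Suc k) m"
  using complete_hom_remove_first[of s i k m] by (simp add: algebra_simps)

lemma complete_hom_single: "complete_hom s i (Suc 0) m = s i ^ m"
  by (induction m) auto

lemma complete_hom_const:
  "(\<And>j. i \<le> j \<Longrightarrow> j \<le> i + k \<Longrightarrow> s j = c) \<Longrightarrow> complete_hom s i (Suc k) m = c ^ m * real ((m + k) choose m)"
proof (induction m arbitrary: k)
  case (Suc m)
  note outer = Suc
  show ?case
    using Suc.prems
  proof (induction k)
    case 0
    then show ?case using outer(1)[of 0] by simp
  next
    case (Suc k)
    have "complete_hom s i (Suc k) (Suc m) = c ^ Suc m * real ((Suc m + k) choose Suc m)"
      using Suc by simp
    moreover have "complete_hom s i (Suc (Suc k)) m = c ^ m * real ((m + Suc k) choose m)"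
      using Suc.prems by (intro outer(1)) auto
    moreover have "s (i + Suc k) = c" using Suc.prems by simp
    ultimately show ?case by (simp add: algebra_simps)
  qed
qed simp

fun bspline :: "(nat \<Rightarrow> real) \<Rightarrow> nat \<Rightarrow> nat \<Rightarrow> real \<Rightarrow> real" where
  "bspline t 0 i x = indicator {t i..<t (i + 1)} x"
| "bspline t (Suc q) i x =
    cdf_on (t i) (t (i + q + 1)) (normalized (t i) (t (i + q + 1)) (bspline t q i)) x
    - cdf_on (t (i + 1)) (t (i + q + 2)) (normalized (t (i + 1)) (t (i + q + 2)) (bspline t q (i + 1))) x"

definition bspline_density :: "(nat \<Rightarrow> real) \<Rightarrow> nat \<Rightarrow> nat \<Rightarrow> real \<Rightarrow> real" where
  "bspline_density t q i = normalized (t i) (t (i + q + 1)) (bspline t q i)"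

lemma bspline_Suc:
  "bspline t (Suc q) i = (\<lambda>x. cdf_on (t i) (t (i + q + 1)) (bspline_density t q i) x
    - cdf_on (t (i + 1)) (t (i + q + 2)) (bspline_density t q (i + 1)) x)"
  by (simp add: fun_eq_iff bspline_density_def)

lemma bspline_0: "bspline t 0 i = indicator {t i..<t (i + 1)}"
  by (simp add: fun_eq_iff)

declare bspline.simps [simp del]

fun bspline_bound :: "nat \<Rightarrow> real" where
  "bspline_bound 0 = 1"
| "bspline_bound (Suc q) = 2 * (1 + real (q + 1) * bspline_bound q)"

lemma bspline_bound_ge_1: "1 \<le> bspline_bound q"
  by (induction q) auto

lemma Suc_mult_binomial_shift:
  "Suc m * ((Suc m + Suc q) choose Suc m) = Suc (Suc q) * ((m + Suc (Suc q)) choose m)"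
  using Suc_times_binomial_eq[of "m + Suc q" m] Suc_times_binomial_add[of m "Suc q"]
  by (simp add: add.commute mult.commute)

locale open_knots =
  fixes t :: "nat \<Rightarrow> real"
  assumes mono: "i \<le> j \<Longrightarrow> t i \<le> t j" and nonneg: "0 \<le> t i" and le_1: "t i \<le> 1"
    and degenerate: "i < j \<Longrightarrow> t i = t j \<Longrightarrow> t i = 0 \<or> t i = 1"
begin

lemma less_or_degenerate: "i < j \<Longrightarrow> t i < t j \<or> t i = 0 \<or> t i = 1"
  using mono[of i j] degenerate[of i j] by fastforce

text \<open>Integrating a distribution function raises the order of the moment, so the integrals of B-splines
  follow by induction only together with all their moments. Those of the normalized B-splines are
  complete homogeneous polynomials of the knots, up to a binomial factor.\<close>
definition knot_moment :: "nat \<Rightarrow> nat \<Rightarrow> nat \<Rightarrow> real" where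
  "knot_moment q i m = complete_hom t i (q + 2) m / real ((m + q + 1) choose m)"

lemma knot_moment_0: "knot_moment q i 0 = 1"
  by (simp add: knot_moment_def)

lemma knot_moment_degenerate:
  assumes "t i = t (i + q + 1)"
  shows "knot_moment q i m = t i ^ m"
proof -
  have "t j = t i" if "i \<le> j" "j \<le> i + Suc q" for j
    using mono[of i j] mono[of j "i + Suc q"] that assms by simp
  from complete_hom_const[OF this] show ?thesis by (simp add: knot_moment_def)
qed

lemma knot_moment_diff:
  "(knot_moment q (i + 1) (Suc m) - knot_moment q i (Suc m)) / real (Suc m)
    = (t (i + q + 2) - t i) / real (q + 2) * knot_moment (Suc q) i m"
proof -
  let ?h = "\<lambda>i. complete_hom t i (q + 2) (Suc m)" and ?c = "real ((Suc m + Suc q) choose Suc m)"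
  have "(knot_moment q (i + 1) (Suc m) - knot_moment q i (Suc m)) / real (Suc m)
      = (?h (Suc i) - ?h i) / (real (Suc m) * ?c)"
    by (simp add: knot_moment_def diff_divide_distrib mult.commute del: binomial_Suc_Suc complete_hom.simps
      of_nat_Suc)
  also have "\<dots> = (t (i + (q + 2)) - t i) * complete_hom t i (Suc (q + 2)) m / (real (Suc m) * ?c)"
    unfolding complete_hom_diff ..
  also have "real (Suc m) * ?c = real (q + 2) * real ((m + Suc q + 1) choose m)"
    using Suc_mult_binomial_shift[of m q]
    by (simp add: mult.commute flip: of_nat_mult del: binomial_Suc_Suc of_nat_Suc)
  finally show ?thesis by (simp add: knot_moment_def)
qed

lemma bspline_0_moment:
  "integral {0..1} (\<lambda>x. x ^ m * bspline t 0 i x) = (t (i + 1) - t i) * knot_moment 0 i m"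
proof -
  have "integral {0..1} (\<lambda>x. x ^ m * bspline t 0 i x)
      = integral {0..1} (\<lambda>x. if x \<in> {t i..t (i + 1)} then x ^ m else 0)"
    by (rule integral_spike[of "{t (i + 1)}"]) (auto simp: bspline_0 indicator_def)
  also have "\<dots> = integral {t i..t (i + 1)} (\<lambda>x. x ^ m)"
    using nonneg le_1 unfolding integral_restrict_Int by (intro arg_cong2[where f = integral]) auto
  also have "\<dots> = (complete_hom t (Suc i) 1 (Suc m) - complete_hom t i 1 (Suc m)) / real (Suc m)"
    using has_integral_power[OF mono, of i "i + 1" m]
    by (simp add: complete_hom_single integral_unique diff_divide_distrib del: complete_hom.simps)
  also have "\<dots> = (t (i + 1) - t i) * knot_moment 0 i m"
    unfolding complete_hom_diff by (simp add: knot_moment_def numeral_2_eq_2)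
  finally show ?thesis .
qed

lemma localized_bspline_0: "localized (t i) (t (i + 1)) 1 (bspline t 0 i)"
proof -
  have "indicat_real {t i..<t (i + 1)} \<in> borel_measurable lebesgue" by (rule measurable_completion) simp
  then have "(\<lambda>x. indicat_real {t i..<t (i + 1)} x) \<in> borel_measurable (lebesgue_on {0..1})"
    by (rule measurable_restrict_space1)
  then show ?thesis by (auto simp add: localized_def bspline_0 indicator_eq_0_iff)
qed

lemma isCont_bspline_0: "x \<noteq> t i \<Longrightarrow> x \<noteq> t (i + 1) \<Longrightarrow> isCont (bspline t 0 i) x"
  unfolding bspline_0 by (rule isCont_indicator_atLeastLessThan)

context
  fixes q :: nat
  assumes localized_q: "\<And>i. localized (t i) (t (i + q + 1)) (bspline_bound q) (bspline t q i)"
    and moment_q: "\<And>i m. integral {0..1} (\<lambda>x. x ^ m * bspline t q i x)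
      = (t (i + q + 1) - t i) / real (q + 1) * knot_moment q i m"
    and isCont_q: "\<And>i x. x \<in> {0<..<1} - {t i, t (i + 1)} \<Longrightarrow> isCont (bspline t q i) x"
begin

lemma unit_density_bspline_density_step:
  "unit_density (t i) (t (i + q + 1)) (bspline_bound q / ((t (i + q + 1) - t i) / real (q + 1)))
    (bspline_density t q i)"
  unfolding bspline_density_def
  using moment_q[of 0 i] less_or_degenerate[of i "i + q + 1"] mono[of i "i + q + 1"]
  by (intro unit_density_normalized localized_q nonneg le_1) (auto simp: knot_moment_0)

lemma integral_power_mult_cdf_bspline_density:
  "integral {0..1} (\<lambda>x. x ^ m * cdf_on (t i) (t (i + q + 1)) (bspline_density t q i) x)
    = (1 - knot_moment q i (Suc m)) / real (Suc m)"
proof -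
  have cont: "isCont (bspline_density t q i) x" if "x \<in> {0<..<1} - {t i, t (i + 1)}" for x
    using isCont_q[OF that] moment_q[of 0 i]
    by (cases "t i < t (i + q + 1)")
      (auto simp: bspline_density_def normalized_def[abs_def] knot_moment_0 intro!: continuous_intros)
  have "integral {0..1} (\<lambda>x. x ^ m * cdf_on (t i) (t (i + q + 1)) (bspline_density t q i) x)
      = (1 - (if t i < t (i + q + 1) then integral {0..1} (\<lambda>x. x ^ Suc m * bspline_density t q i x)
        else t i ^ Suc m)) / real (Suc m)"
    by (rule integral_power_mult_cdf_on[OF unit_density_bspline_density_step, of "{t i, t (i + 1)}"])
      (auto intro: cont)
  also have "(if t i < t (i + q + 1) then integral {0..1} (\<lambda>x. x ^ Suc m * bspline_density t q i x)
      else t i ^ Suc m)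
      = knot_moment q i (Suc m)"
  proof (cases "t i < t (i + q + 1)")
    case True
    let ?K = "(t (i + q + 1) - t i) / real (q + 1)"
    have "integral {0..1} (\<lambda>x. x ^ Suc m * bspline_density t q i x)
        = integral {0..1} (\<lambda>x. (x ^ Suc m * bspline t q i x) / ?K)"
      using True moment_q[of 0 i]
      by (simp only: bspline_density_def normalized_def if_True times_divide_eq_right power_0 mult_1
        knot_moment_0 mult_1_right)
    also have "\<dots> = ?K * knot_moment q i (Suc m) / ?K"
      unfolding moment_q[symmetric] by (rule integral_divide)
    finally show ?thesis using True by simp
  next
    case False
    then show ?thesis using knot_moment_degenerate[of i q "Suc m"] mono[of i "i + q + 1"] by simp
  qed
  finally show ?thesis .
qed

lemma localized_bspline_step:
  "localized (t i) (t (i + Suc q + 1)) (bspline_bound (Suc q)) (bspline t (Suc q) i)"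
proof -
  define r where "r i = bspline_bound q / ((t (i + q + 1) - t i) / real (q + 1)) * (t (i + q + 1) - t i)"
    for i
  have r: "r i \<le> real (q + 1) * bspline_bound q" for i
    using bspline_bound_ge_1[of q] by (cases "t (i + q + 1) = t i") (auto simp: r_def)
  have "localized (t i) (t (i + Suc q + 1)) ((1 + r i) + (1 + r (i + 1))) (bspline t (Suc q) i)"
    using localized_cdf_on_diff[OF unit_density_bspline_density_step[of i]
      unit_density_bspline_density_step[of "i + 1"]]
      mono by (simp add: bspline_Suc r_def)
  then show ?thesis
    by (rule localized_mono) (use r[of i] r[of "i + 1"] in auto)
qed

lemma continuous_on_bspline_step: "continuous_on {0..1} (bspline t (Suc q) i)"
  using continuous_on_diff[OF continuous_on_cdf_on[OF unit_density_bspline_density_step[of i]]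
      continuous_on_cdf_on[OF unit_density_bspline_density_step[of "i + 1"]]]
  by (simp add: bspline_Suc)

lemma bspline_moment_step:
  "integral {0..1} (\<lambda>x. x ^ m * bspline t (Suc q) i x)
    = (t (i + Suc q + 1) - t i) / real (Suc q + 1) * knot_moment (Suc q) i m"
proof -
  let ?\<Phi> = "\<lambda>i. cdf_on (t i) (t (i + q + 1)) (bspline_density t q i)"
  have int: "(\<lambda>x. x ^ m * ?\<Phi> i x) integrable_on {0..1}" for i
    by (intro integrable_continuous_real continuous_intros
      continuous_on_cdf_on[OF unit_density_bspline_density_step])
  have "integral {0..1} (\<lambda>x. x ^ m * bspline t (Suc q) i x)
      = integral {0..1} (\<lambda>x. x ^ m * ?\<Phi> i x) - integral {0..1} (\<lambda>x. x ^ m * ?\<Phi> (i + 1) x)"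
    using Henstock_Kurzweil_Integration.integral_diff[OF int[of i] int[of "i + 1"]]
    by (simp add: bspline_Suc right_diff_distrib)
  also have "\<dots> = (knot_moment q (i + 1) (Suc m) - knot_moment q i (Suc m)) / real (Suc m)"
    unfolding integral_power_mult_cdf_bspline_density by (simp add: diff_divide_distrib)
  also have "\<dots> = (t (i + Suc q + 1) - t i) / real (Suc q + 1) * knot_moment (Suc q) i m"
    unfolding knot_moment_diff by simp
  finally show ?thesis .
qed

end

lemma bspline_regularity:
  "localized (t i) (t (i + q + 1)) (bspline_bound q) (bspline t q i)
   \<and> (\<forall>m. integral {0..1} (\<lambda>x. x ^ m * bspline t q i x)
      = (t (i + q + 1) - t i) / real (q + 1) * knot_moment q i m)
   \<and> (\<forall>x\<in>{0<..<1} - {t i, t (i + 1)}. isCont (bspline t q i) x)"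
proof (induction q arbitrary: i)
  case 0
  show ?case using localized_bspline_0 bspline_0_moment isCont_bspline_0 by simp
next
  case (Suc q)
  note step = Suc[THEN conjunct1] Suc[THEN conjunct2, THEN conjunct1, rule_format]
    Suc[THEN conjunct2, THEN conjunct2, rule_format]
  have "isCont (bspline t (Suc q) i) x" if "x \<in> {0<..<1}" for x
    using continuous_on_interior[OF continuous_on_bspline_step[OF step]] that by simp
  then show ?case
    using localized_bspline_step[OF step] bspline_moment_step[OF step] by blast
qed

lemma localized_bspline: "localized (t i) (t (i + q + 1)) (bspline_bound q) (bspline t q i)"
  using bspline_regularity by blast

lemma integral_bspline: "integral {0..1} (bspline t q i) = (t (i + q + 1) - t i) / real (q + 1)"
  using bspline_regularity[of i q, THEN conjunct2, THEN conjunct1, rule_format, of 0]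
  by (simp add: knot_moment_0)

lemma unit_density_bspline_density:
  "unit_density (t i) (t (i + q + 1)) (bspline_bound q / ((t (i + q + 1) - t i) / real (q + 1)))
    (bspline_density t q i)"
  using bspline_regularity by (intro unit_density_bspline_density_step) blast+

end

section \<open>Open uniform knots\<close>

lemma knot_eq: "n > 0 \<Longrightarrow> knot n p k = real (min (k - p - 1) n) / real n"
  by (auto simp: knot_def min_def)

lemma open_knots_knot:
  assumes "n > 0" shows "open_knots (knot n p)"
proof
  fix i j
  show "knot n p i \<le> knot n p j" if "i \<le> j"
    using assms that by (auto simp: knot_eq intro!: divide_right_mono)
  show "0 \<le> knot n p i" "knot n p i \<le> 1" using assms by (auto simp: knot_eq)
  assume "i < j" "knot n p i = knot n p j"
  then have "min (i - p - 1) n = min (j - p - 1) n" using assms by (simp add: knot_eq)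
  then have "i - p - 1 = 0 \<or> n \<le> i - p - 1" using \<open>i < j\<close> by linarith
  then show "knot n p i = 0 \<or> knot n p i = 1" using assms by (auto simp: knot_eq)
qed

lemma knot_diff_le: "n > 0 \<Longrightarrow> knot n p (k + m) - knot n p k \<le> real m / real n"
  by (auto simp: knot_eq diff_divide_distrib[symmetric] intro!: divide_right_mono)

lemma knot_gap: "n > 0 \<Longrightarrow> knot n p k < knot n p l \<Longrightarrow> 1 / real n \<le> knot n p l - knot n p k"
  by (auto simp: knot_eq diff_divide_distrib[symmetric] divide_less_cancel intro!: divide_right_mono)

lemma mult_knot_Ints: "n > 0 \<Longrightarrow> real n * knot n p k \<in> \<int>"
  by (simp add: knot_eq)

lemma knot_interior:
  "p + 1 \<le> k \<Longrightarrow> k \<le> n + p + 1 \<Longrightarrow> knot n p k = (real k - real p - 1) / real n"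
  by (auto simp: knot_def of_nat_diff)

lemma knot_diff_interior:
  assumes "p + 1 \<le> k" "k + m \<le> n + p + 1"
  shows "knot n p (k + m) - knot n p k = real m / real n"
  using assms by (simp add: knot_interior diff_divide_distrib[symmetric])

lemma knot_less_interior:
  assumes "n > 0" "m > 0" "p + 1 \<le> k" "k + m \<le> n + p + 1"
  shows "knot n p k < knot n p (k + m)"
proof -
  have "0 < real m / real n" using assms(1,2) by simp
  then show ?thesis using knot_diff_interior[OF assms(3,4)] by linarith
qed

lemma bspline_density_interior:
  assumes "n > 0" "p + 1 \<le> i" "i + q \<le> n + p"
  shows "bspline_density (knot n p) q i x = real n * bspline (knot n p) q i x"
proof -
  interpret open_knots "knot n p" by (rule open_knots_knot) fact
  have "knot n p (i + q + 1) - knot n p i = real (q + 1) / real n"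
    using knot_diff_interior[of p i "q + 1" n] assms by (simp add: add.assoc)
  moreover have "knot n p i < knot n p (i + q + 1)"
    using knot_less_interior[of n "q + 1" p i] assms by (simp add: add.assoc)
  ultimately show ?thesis
    unfolding bspline_density_def normalized_def integral_bspline by simp
qed

theorem bspline_interior:
  assumes n: "n > 0" and i: "p + 1 \<le> i" "i + q \<le> n + p" and x: "x \<in> {0..1}"
  shows "bspline (knot n p) q i x = cardB q (real n * x - (real i - real p - 1))"
  using i x
proof (induction q arbitrary: i x)
  case 0
  have "knot n p i = (real i - real p - 1) / real n" "knot n p (i + 1) = (real i - real p) / real n"
    using 0 by (simp_all add: knot_interior)
  then have "knot n p i \<le> x \<longleftrightarrow> 0 \<le> real n * x - (real i - real p - 1)"
    "x < knot n p (i + 1) \<longleftrightarrow> real n * x - (real i - real p - 1) < 1"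
    using n by (simp_all add: pos_divide_le_eq pos_less_divide_eq algebra_simps)
  then show ?case by (simp add: bspline_0 indicator_def)
next
  case (Suc q)
  interpret open_knots "knot n p" by (rule open_knots_knot[OF n])
  let ?c = "real i - real p - 1"
  let ?d = "bspline_density (knot n p) q"
  have density: "?d j y = real n * cardB q (real n * y - (real j - real p - 1))"
    if "p + 1 \<le> j" "j + q \<le> n + p" "y \<in> {0..1}" for j y
    using bspline_density_interior[OF n that(1,2)] Suc.IH[OF that] by simp
  have nondegenerate: "knot n p j < knot n p (j + q + 1)" if "p + 1 \<le> j" "j + q \<le> n + p" for j
    using knot_less_interior[of n "q + 1" p j] that n by (simp add: add.assoc)
  have difference: "?d i y - ?d (i + 1) y
      = real n * (cardB q (real n * y - ?c) - cardB q (real n * y - ?c - 1))"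
    if "y \<in> {0..1}" for y
  proof -
    have "real n * y - (real (i + 1) - real p - 1) = real n * y - ?c - 1" by simp
    then show ?thesis
      using density[of i y] density[of "i + 1" y] Suc.prems that by (simp only: right_diff_distrib)
  qed
  have "bspline (knot n p) (Suc q) i x = integral {0..x} (?d i) - integral {0..x} (?d (i + 1))"
    using nondegenerate[of i] nondegenerate[of "i + 1"] Suc.prems by (simp add: bspline_Suc cdf_on_def)
  also have "\<dots> = integral {0..x} (\<lambda>y. ?d i y - ?d (i + 1) y)"
    using Suc.prems
    by (intro Henstock_Kurzweil_Integration.integral_diff[symmetric]
        localized_integrable_on[OF unit_densityD(4)[OF unit_density_bspline_density]]) auto
  also have "\<dots> = integral {0..x} (\<lambda>y. real n * (cardB q (real n * y - ?c) - cardB q (real n * y - ?c - 1)))"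
    using Suc.prems by (intro integral_cong difference) auto
  also have "\<dots> = cardB (Suc q) (real n * x - ?c) - cardB (Suc q) (real n * 0 - ?c)"
    using Suc.prems n by (intro integral_unique cardB_difference_has_integral) auto
  also have "cardB (Suc q) (real n * 0 - ?c) = 0"
    using Suc.prems(1) by (intro cardB_Suc_nonpos) simp
  finally show ?case by simp
qed

section \<open>GB-splines as perturbations of polynomial B-splines\<close>

declare gbspl.simps [simp del]

definition gbC :: "gbkind \<Rightarrow> real \<Rightarrow> real \<Rightarrow> real" where
  "gbC Q mu x = (case Q of Trig \<Rightarrow> mu * cos (mu * x) | Hyp \<Rightarrow> mu * cosh (mu * x))"

lemma DERIV_gbS: "(gbS Q mu has_real_derivative gbC Q mu x) (at x)"
  unfolding gbS_def[abs_def] gbC_def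
  by (cases Q) (auto intro!: derivative_eq_intros)

lemma gbS_0 [simp]: "gbS Q mu 0 = 0"
  by (cases Q) (auto simp: gbS_def)

lemma gbC_0: "gbC Q mu 0 = mu"
  by (cases Q) (auto simp: gbC_def)

lemma isCont_gbC: "isCont (gbC Q mu) x"
  unfolding gbC_def[abs_def] by (cases Q) (auto intro!: continuous_intros)

lemma eventually_gbC_near:
  assumes "mu > 0" "e > 0"
  shows "\<forall>\<^sub>F n in sequentially. \<forall>y\<in>{0..1 / real n}. \<bar>gbC Q mu y - mu\<bar> \<le> e * mu"
proof -
  obtain \<delta> where \<delta>: "\<delta> > 0" "\<And>y. \<bar>y\<bar> < \<delta> \<Longrightarrow> \<bar>gbC Q mu y - mu\<bar> < e * mu"
    using isCont_gbC[of 0 Q mu] mult_pos_pos[OF assms(2,1)] unfolding continuous_at_eps_delta gbC_0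
    by (metis diff_zero real_norm_def dist_norm)
  have "\<forall>\<^sub>F n in sequentially. 1 / real n < \<delta>"
    using \<delta>(1) lim_1_over_n[where 'a = real] by (intro order_tendstoD(2)) auto
  then show ?thesis
  proof eventually_elim
    case (elim n)
    then show ?case using \<delta>(2) by (force intro: less_imp_le)
  qed
qed

lemma eventually_gb_profile:
  assumes mu: "mu > 0" and e: "e > 0"
  shows "\<forall>\<^sub>F n in sequentially. n > 0 \<and> gbS Q mu (1 / real n) > 0 \<and>
    (\<forall>y\<in>{0..1 / real n}. \<bar>gbC Q mu y / gbS Q mu (1 / real n) - real n\<bar> \<le> e * real n)"
proof -
  define \<eta> where "\<eta> = min (e / 4) (1 / 2)"
  have \<eta>: "0 < \<eta>" "\<eta> \<le> e / 4" "\<eta> \<le> 1 / 2" using e by (auto simp: \<eta>_def)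
  from eventually_gt_at_top[of 0] eventually_gbC_near[OF mu \<eta>(1), of Q] show ?thesis
  proof eventually_elim
    case (elim n)
    let ?h = "1 / real n"
    have h: "0 < ?h" using elim by simp
    obtain z where z: "0 < z" "z < ?h" "gbS Q mu ?h - gbS Q mu 0 = (?h - 0) * gbC Q mu z"
      using MVT2[OF h, of "gbS Q mu" "gbC Q mu"] DERIV_gbS by blast
    have mean_value: "gbS Q mu ?h = ?h * gbC Q mu z" using z(3) by simp
    have close: "\<bar>gbC Q mu z - mu\<bar> \<le> \<eta> * mu" using z elim by simp
    moreover have "\<eta> * mu \<le> mu / 2" using \<eta>(3) mu by (simp add: field_simps)
    ultimately have lower: "gbC Q mu z \<ge> mu / 2" by linarith
    then have pos: "gbS Q mu ?h > 0" unfolding mean_value using h mu by (intro mult_pos_pos) auto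
    have "\<bar>gbC Q mu y / gbS Q mu ?h - real n\<bar> \<le> e * real n" if y: "y \<in> {0..?h}" for y
    proof -
      have "gbC Q mu y / gbS Q mu ?h - real n = (gbC Q mu y - gbC Q mu z) / gbS Q mu ?h"
        using elim pos lower mu unfolding mean_value by (simp add: field_simps)
      also have "\<bar>\<dots>\<bar> = \<bar>gbC Q mu y - gbC Q mu z\<bar> / gbS Q mu ?h" using pos by simp
      also have "\<dots> \<le> (2 * \<eta> * mu) / (?h * (mu / 2))"
      proof (intro frac_le)
        show "\<bar>gbC Q mu y - gbC Q mu z\<bar> \<le> 2 * \<eta> * mu" using elim(2) y close by force
        show "?h * (mu / 2) \<le> gbS Q mu ?h" unfolding mean_value using lower h by (intro mult_left_mono) auto
      qed (use h mu \<eta>(1) in auto)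
      also have "\<dots> = 4 * \<eta> * real n" using mu elim by (simp add: field_simps)
      also have "\<dots> \<le> e * real n" using \<eta>(2) by (intro mult_right_mono) auto
      finally show ?thesis .
    qed
    then show ?case using elim pos by blast
  qed
qed

definition gb_density_left :: "gbkind \<Rightarrow> real \<Rightarrow> nat \<Rightarrow> nat \<Rightarrow> nat \<Rightarrow> nat \<Rightarrow> real \<Rightarrow> real" where
  "gb_density_left Q mu n p q i = (if q = 0
    then (\<lambda>x. indicator {knot n p i..<knot n p (i + 1)} x
      * (gbC Q mu (x - knot n p i) / gbS Q mu (knot n p (i + 1) - knot n p i)))
    else normalized (knot n p i) (knot n p (i + q + 1)) (gbspl Q mu n p q i))"

definition gb_density_right :: "gbkind \<Rightarrow> real \<Rightarrow> nat \<Rightarrow> nat \<Rightarrow> nat \<Rightarrow> nat \<Rightarrow> real \<Rightarrow> real" where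
  "gb_density_right Q mu n p q i = (if q = 0
    then (\<lambda>x. indicator {knot n p i..<knot n p (i + 1)} x
      * (gbC Q mu (knot n p (i + 1) - x) / gbS Q mu (knot n p (i + 1) - knot n p i)))
    else normalized (knot n p i) (knot n p (i + q + 1)) (gbspl Q mu n p q i))"

lemma gb_density_Suc:
  "gb_density_left Q mu n p (Suc q) i
    = normalized (knot n p i) (knot n p (i + q + 2)) (gbspl Q mu n p (Suc q) i)"
  "gb_density_right Q mu n p (Suc q) i
    = normalized (knot n p i) (knot n p (i + q + 2)) (gbspl Q mu n p (Suc q) i)"
  by (simp_all add: gb_density_left_def gb_density_right_def)

text \<open>A GB-spline of degree \<open>q + 1\<close> is the difference of the distribution functions of a left and a
  right density of degree \<open>q\<close>; these differ only for \<open>q = 0\<close>, where the two halves of a generalized hat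
  function are mirror images.\<close>
locale gb_approximation =
  fixes Q :: gbkind and mu :: real and n p q :: nat and e :: real
  assumes n_pos: "n > 0"
    and left_density: "\<exists>C. unit_density (knot n p i) (knot n p (i + q + 1)) C (gb_density_left Q mu n p q i)"
    and right_density: "\<exists>C. unit_density (knot n p i) (knot n p (i + q + 1)) C
      (gb_density_right Q mu n p q i)"
    and left_close: "localized (knot n p i) (knot n p (i + q + 1)) (e * real n)
      (\<lambda>x. gb_density_left Q mu n p q i x - bspline_density (knot n p) q i x)"
    and right_close: "localized (knot n p i) (knot n p (i + q + 1)) (e * real n)
      (\<lambda>x. gb_density_right Q mu n p q i x - bspline_density (knot n p) q i x)"
    and isCont_left: "x \<in> {0<..<1} \<Longrightarrow> real n * x \<notin> \<int> \<Longrightarrow> isCont (gb_density_left Q mu n p q i) x"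
    and isCont_right: "x \<in> {0<..<1} \<Longrightarrow> real n * x \<notin> \<int> \<Longrightarrow> isCont (gb_density_right Q mu n p q i) x"
    and gbspl_eq_cdf_diff: "x \<in> {0..1} \<Longrightarrow> gbspl Q mu n p (Suc q) i x
      = cdf_on (knot n p i) (knot n p (i + q + 1)) (gb_density_left Q mu n p q i) x
      - cdf_on (knot n p (i + 1)) (knot n p (i + q + 2)) (gb_density_right Q mu n p q (i + 1)) x"

subsection \<open>Generalized hat functions\<close>

lemma has_integral_restrict_FTC:
  fixes f :: "real \<Rightarrow> real"
  assumes ab: "0 \<le> a" "a \<le> b" and f: "\<And>y. (f has_real_derivative f' y) (at y)"
  shows "((\<lambda>y. indicator {a..<b} y * f' y) has_integral f (max a (min b x)) - f a) {0..x}"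
proof (cases "a \<le> x")
  case True
  have "(f' has_integral f (min b x) - f a) {a..min b x}"
    using f True ab by (intro fundamental_theorem_of_calculus)
      (auto simp: has_real_derivative_iff_has_vector_derivative[symmetric]
        intro: has_field_derivative_at_within)
  then have "((\<lambda>y. if y \<in> {a..min b x} then f' y else 0) has_integral f (min b x) - f a) {0..x}"
    using ab by (subst has_integral_restrict) auto
  then have "((\<lambda>y. indicator {a..<b} y * f' y) has_integral f (min b x) - f a) {0..x}"
    by (rule has_integral_spike_finite[of "{b}", rotated 2]) (auto simp: indicator_def)
  then show ?thesis using True ab by (simp add: max_absorb2)
next
  case False
  then have "((\<lambda>y. indicator {a..<b} y * f' y) has_integral 0) {0..x}"
    by (intro has_integral_is_0) auto
  then show ?thesis using False by (simp add: max_absorb1 min.coboundedI2)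
qed

lemma gb_density_0_cdf:
  assumes n: "n > 0" and x: "x \<in> {0..1}" and ab: "knot n p i < knot n p (i + 1)"
  defines "a \<equiv> knot n p i" and "b \<equiv> knot n p (i + 1)"
  assumes gbS_pos: "gbS Q mu (b - a) > 0"
  shows "cdf_on a b (gb_density_left Q mu n p 0 i) x = gbS Q mu (max a (min b x) - a) / gbS Q mu (b - a)"
    and "cdf_on a b (gb_density_right Q mu n p 0 i) x = 1 - gbS Q mu (b - max a (min b x)) / gbS Q mu (b - a)"
proof -
  let ?s = "\<lambda>y. gbS Q mu y / gbS Q mu (b - a)"
  interpret open_knots "knot n p" by (rule open_knots_knot[OF n])
  have bounds: "0 \<le> a" "a \<le> b" using nonneg[of i] ab by (simp_all add: a_def b_def)
  have "((\<lambda>y. gbS Q mu (y - a)) has_real_derivative gbC Q mu (y - a) * 1) (at y)" for y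
    by (rule DERIV_chain2[OF DERIV_gbS]) (auto intro!: derivative_eq_intros)
  then have left: "((\<lambda>y. ?s (y - a)) has_real_derivative gbC Q mu (y - a) / gbS Q mu (b - a)) (at y)" for y
    using DERIV_cdivide by fastforce
  have "((\<lambda>y. - gbS Q mu (b - y)) has_real_derivative - (gbC Q mu (b - y) * -1)) (at y)" for y
    by (rule DERIV_minus, rule DERIV_chain2[OF DERIV_gbS]) (auto intro!: derivative_eq_intros)
  then have right: "((\<lambda>y. - gbS Q mu (b - y) / gbS Q mu (b - a))
      has_real_derivative gbC Q mu (b - y) / gbS Q mu (b - a)) (at y)" for y
    using DERIV_cdivide by fastforce
  have "a < b" using ab by (simp add: a_def b_def)
  have "gb_density_left Q mu n p 0 i = (\<lambda>x. indicator {a..<b} x * (gbC Q mu (x - a) / gbS Q mu (b - a)))"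
    by (simp add: gb_density_left_def a_def b_def)
  then show "cdf_on a b (gb_density_left Q mu n p 0 i) x = ?s (max a (min b x) - a)"
    using integral_unique[OF has_integral_restrict_FTC[OF bounds left, of x]] \<open>a < b\<close>
    by (simp add: cdf_on_def)
  have "gb_density_right Q mu n p 0 i = (\<lambda>x. indicator {a..<b} x * (gbC Q mu (b - x) / gbS Q mu (b - a)))"
    by (simp add: gb_density_right_def a_def b_def)
  then show "cdf_on a b (gb_density_right Q mu n p 0 i) x = 1 - ?s (b - max a (min b x))"
    using integral_unique[OF has_integral_restrict_FTC[OF bounds right, of x]] \<open>a < b\<close> gbS_pos
    by (simp add: cdf_on_def)
qed

context
  fixes Q :: gbkind and mu :: real and n :: nat and e :: real
  assumes n: "n > 0" and e: "e \<ge> 0" and gbS_pos: "gbS Q mu (1 / real n) > 0"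
    and profile: "\<And>y. y \<in> {0..1 / real n} \<Longrightarrow> \<bar>gbC Q mu y / gbS Q mu (1 / real n) - real n\<bar> \<le> e * real n"
begin

lemma knot_step: "knot n p i < knot n p (i + 1) \<Longrightarrow> knot n p (i + 1) - knot n p i = 1 / real n"
  using knot_gap[OF n, of p i "i + 1"] knot_diff_le[OF n, of p i 1] by simp

lemma bspline_density_0:
  "bspline_density (knot n p) 0 i x = indicator {knot n p i..<knot n p (i + 1)} x * real n"
proof -
  interpret open_knots "knot n p" by (rule open_knots_knot[OF n])
  show ?thesis
    using knot_step[of p i] integral_bspline[of 0 i]
    by (auto simp: bspline_density_def normalized_def bspline_0 indicator_def)
qed

lemma gb_density_0_close:
  "localized (knot n p i) (knot n p (i + 1)) (e * real n)
    (\<lambda>x. gb_density_left Q mu n p 0 i x - bspline_density (knot n p) 0 i x)"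
  "localized (knot n p i) (knot n p (i + 1)) (e * real n)
    (\<lambda>x. gb_density_right Q mu n p 0 i x - bspline_density (knot n p) 0 i x)"
proof -
  let ?a = "knot n p i" and ?b = "knot n p (i + 1)"
  have close: "localized ?a ?b (e * real n) (\<lambda>x. indicator {?a..<?b} x * (gbC Q mu (\<phi> x) / gbS Q mu (?b - ?a))
      - bspline_density (knot n p) 0 i x)"
    if \<phi>: "continuous_on UNIV \<phi>" "\<And>x. ?a \<le> x \<Longrightarrow> x < ?b \<Longrightarrow> \<phi> x \<in> {0..?b - ?a}" for \<phi>
    unfolding localized_def
  proof (intro conjI ballI impI)
    have "continuous_on UNIV (\<lambda>x. gbC Q mu (\<phi> x))"
      by (intro continuous_on_compose2[OF _ \<phi>(1), of UNIV "gbC Q mu"] continuous_at_imp_continuous_on ballI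
        isCont_gbC) auto
    then have [measurable]: "(\<lambda>x. gbC Q mu (\<phi> x)) \<in> borel_measurable borel"
      by (rule borel_measurable_continuous_onI)
    have "(\<lambda>x. indicator {?a..<?b} x * (gbC Q mu (\<phi> x) / gbS Q mu (?b - ?a))
        - bspline_density (knot n p) 0 i x) \<in> borel_measurable borel"
      unfolding bspline_density_0 by measurable
    then show "(\<lambda>x. indicator {?a..<?b} x * (gbC Q mu (\<phi> x) / gbS Q mu (?b - ?a))
        - bspline_density (knot n p) 0 i x) \<in> borel_measurable (lebesgue_on {0..1})"
      by (intro measurable_restrict_space1 measurable_completion) simp
  qed (use \<phi>(2) profile knot_step[of p i] e in \<open>auto simp: bspline_density_0 indicator_def\<close>)
  show "localized ?a ?b (e * real n) (\<lambda>x. gb_density_left Q mu n p 0 i x - bspline_density (knot n p) 0 i x)"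
    using close[of "\<lambda>x. x - ?a"] by (simp add: gb_density_left_def continuous_intros)
  show "localized ?a ?b (e * real n) (\<lambda>x. gb_density_right Q mu n p 0 i x - bspline_density (knot n p) 0 i x)"
    using close[of "\<lambda>x. ?b - x"] by (simp add: gb_density_right_def continuous_intros)
qed

lemma unit_density_gb_density_0:
  "\<exists>C. unit_density (knot n p i) (knot n p (i + 1)) C (gb_density_left Q mu n p 0 i)"
  "\<exists>C. unit_density (knot n p i) (knot n p (i + 1)) C (gb_density_right Q mu n p 0 i)"
proof -
  interpret open_knots "knot n p" by (rule open_knots_knot[OF n])
  let ?a = "knot n p i" and ?b = "knot n p (i + 1)"
  note base = unit_densityD(4)[OF unit_density_bspline_density[of i 0], unfolded add_0_right]
  note bounds = nonneg[of i] mono[of i "i + 1"] le_1[of "i + 1"] less_or_degenerate[of i "i + 1"]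
  have "integral {0..1} (gb_density_left Q mu n p 0 i) = 1"
      "integral {0..1} (gb_density_right Q mu n p 0 i) = 1"
    if "?a < ?b"
    using gb_density_0_cdf[OF n, of 1 p i Q mu] that gbS_pos knot_step[OF that] le_1[of "i + 1"]
    by (simp_all add: cdf_on_def)
  moreover have "gb_density_left Q mu n p 0 i = (\<lambda>_. 0)" "gb_density_right Q mu n p 0 i = (\<lambda>_. 0)"
      if "\<not> ?a < ?b"
    using that by (auto simp: gb_density_left_def gb_density_right_def fun_eq_iff)
  ultimately show "\<exists>C. unit_density ?a ?b C (gb_density_left Q mu n p 0 i)"
      "\<exists>C. unit_density ?a ?b C (gb_density_right Q mu n p 0 i)"
    using localized_add[OF gb_density_0_close(1)[of p i] base]
      localized_add[OF gb_density_0_close(2)[of p i] base] bounds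
    unfolding unit_density_def by auto
qed

lemma gbspl_1_eq_cdf_diff:
  assumes x: "x \<in> {0..1}"
  shows "gbspl Q mu n p (Suc 0) i x
      = cdf_on (knot n p i) (knot n p (i + 1)) (gb_density_left Q mu n p 0 i) x
      - cdf_on (knot n p (i + 1)) (knot n p (i + 2)) (gb_density_right Q mu n p 0 (i + 1)) x"
proof -
  interpret open_knots "knot n p" by (rule open_knots_knot[OF n])
  define a b c where "a = knot n p i" and "b = knot n p (i + 1)" and "c = knot n p (i + 2)"
  have ab: "0 \<le> a" "a \<le> b" "a = b \<Longrightarrow> a = 0 \<or> a = 1" and bc: "b \<le> c" "c \<le> 1" "b = c \<Longrightarrow> b = 0 \<or> b = 1"
    using mono[of i "i + 1"] mono[of "i + 1" "i + 2"] nonneg[of i] le_1[of "i + 2"]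
      degenerate[of i "i + 1"] degenerate[of "i + 1" "i + 2"] by (auto simp: a_def b_def c_def)
  have gbS_ab_pos: "gbS Q mu (b - a) > 0" if "a < b"
    using knot_step[of p i] that gbS_pos by (simp add: a_def b_def)
  have gbS_bc_pos: "gbS Q mu (c - b) > 0" if "b < c"
    using knot_step[of p "i + 1"] that gbS_pos by (simp add: b_def c_def)
  have left_cdf: "cdf_on a b (gb_density_left Q mu n p 0 i) x
      = (if a < b then gbS Q mu (max a (min b x) - a) / gbS Q mu (b - a) else if a < 1 then 1 else 0)"
    using gb_density_0_cdf(1)[OF n x, of p i Q mu] gbS_ab_pos by (auto simp: a_def b_def cdf_on_def)
  have right_cdf: "cdf_on b c (gb_density_right Q mu n p 0 (i + 1)) x
      = (if b < c then 1 - gbS Q mu (c - max b (min c x)) / gbS Q mu (c - b) else if b < 1 then 1 else 0)"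
    using gb_density_0_cdf(2)[OF n x, of p "i + 1" Q mu] gbS_bc_pos by (auto simp: b_def c_def cdf_on_def)
  have "gbspl Q mu n p (Suc 0) i x = (if a < b \<and> a \<le> x \<and> (x < b \<or> (x = b \<and> b = 1 \<and> c = 1))
        then gbS Q mu (x - a) / gbS Q mu (b - a)
      else if b < c \<and> b \<le> x \<and> (x < c \<or> (x = c \<and> c = 1))
        then gbS Q mu (c - x) / gbS Q mu (c - b) else 0)"
    by (simp only: gbspl.simps Let_def a_def b_def c_def)
  also have "\<dots> = cdf_on a b (gb_density_left Q mu n p 0 i) x
      - cdf_on b c (gb_density_right Q mu n p 0 (i + 1)) x"
    unfolding left_cdf right_cdf using x ab bc gbS_ab_pos gbS_bc_pos
    by (cases "a < b"; cases "b < c") (auto simp: max_def min_def)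
  finally show ?thesis by (simp add: a_def b_def c_def)
qed

lemma isCont_gb_density_0:
  assumes x: "real n * x \<notin> \<int>"
  shows "isCont (gb_density_left Q mu n p 0 i) x" "isCont (gb_density_right Q mu n p 0 i) x"
proof -
  let ?a = "knot n p i" and ?b = "knot n p (i + 1)"
  have off: "x \<noteq> ?a" "x \<noteq> ?b" using x mult_knot_Ints[OF n] by metis+
  have cont: "isCont (\<lambda>x. indicator {?a..<?b} x * (gbC Q mu (\<phi> x) / gbS Q mu (?b - ?a))) x"
    if "isCont \<phi> x" for \<phi>
    unfolding divide_inverse
    by (intro continuous_mult isCont_indicator_atLeastLessThan[OF off] continuous_const
      isCont_o2[OF that isCont_gbC])
  show "isCont (gb_density_left Q mu n p 0 i) x" "isCont (gb_density_right Q mu n p 0 i) x"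
    using cont[of "\<lambda>x. x - ?a"] cont[of "\<lambda>x. ?b - x"]
    by (simp_all add: gb_density_left_def gb_density_right_def continuous_intros)
qed

end

lemma eventually_gb_approximation_0:
  assumes "mu > 0" "e > 0"
  shows "\<forall>\<^sub>F n in sequentially. gb_approximation Q mu n p 0 e"
  using eventually_gb_profile[OF assms, of Q]
proof eventually_elim
  case (elim n)
  then have profile: "n > 0" "0 \<le> e" "gbS Q mu (1 / real n) > 0"
    "\<And>y. y \<in> {0..1 / real n} \<Longrightarrow> \<bar>gbC Q mu y / gbS Q mu (1 / real n) - real n\<bar> \<le> e * real n"
    using assms(2) by auto
  show ?case
  proof
    fix i x
    show "gbspl Q mu n p (Suc 0) i x
        = cdf_on (knot n p i) (knot n p (i + 0 + 1)) (gb_density_left Q mu n p 0 i) x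
        - cdf_on (knot n p (i + 1)) (knot n p (i + 0 + 2)) (gb_density_right Q mu n p 0 (i + 1)) x"
      if "x \<in> {0..1}"
      using gbspl_1_eq_cdf_diff[OF profile that, of p i] by simp
  qed (use profile(1) unit_density_gb_density_0[OF profile] gb_density_0_close[OF profile]
      isCont_gb_density_0[OF profile]
      in auto)
qed

subsection \<open>Raising the degree\<close>

definition gb_const :: "nat \<Rightarrow> real" where
  "gb_const q = 4 * real (q + 1) * real (q + 2) * (1 + bspline_bound (Suc q) * real (q + 2))"

lemma gb_const_pos: "gb_const q > 0"
  using bspline_bound_ge_1[of "Suc q"] unfolding gb_const_def by (intro mult_pos_pos add_pos_nonneg) auto

context gb_approximation
begin

sublocale open_knots "knot n p"
  by (rule open_knots_knot[OF n_pos])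

lemma e_nonneg: "0 \<le> e"
  using localized_bound_nonneg[OF left_close] n_pos by (simp add: zero_le_mult_iff)

lemma support_length_le: "e * real n * (knot n p (i + q + 1) - knot n p i) \<le> real (q + 1) * e"
proof -
  have "real n * (knot n p (i + q + 1) - knot n p i) \<le> real (q + 1)"
    using knot_diff_le[OF n_pos, of p i "q + 1"] n_pos by (simp add: add.assoc pos_le_divide_eq mult.commute)
  from mult_right_mono[OF this e_nonneg] show ?thesis by (simp only: mult_ac)
qed

lemma gbspl_close:
  "localized (knot n p i) (knot n p (i + q + 2)) (2 * real (q + 1) * e)
    (\<lambda>x. gbspl Q mu n p (Suc q) i x - bspline (knot n p) (Suc q) i x)"
proof -
  obtain C where C: "unit_density (knot n p i) (knot n p (i + q + 1)) C (gb_density_left Q mu n p q i)"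
    using left_density by blast
  obtain C' where C': "unit_density (knot n p (i + 1)) (knot n p (i + q + 2)) C'
      (gb_density_right Q mu n p q (i + 1))"
    using right_density[of "i + 1"] by auto
  let ?\<Phi> = "\<lambda>i. cdf_on (knot n p i) (knot n p (i + q + 1))"
  let ?L = "gb_density_left Q mu n p q i" and ?R = "gb_density_right Q mu n p q (i + 1)"
  let ?D = "\<lambda>i. bspline_density (knot n p) q i"
  have diff: "gbspl Q mu n p (Suc q) i x - bspline (knot n p) (Suc q) i x
      = (?\<Phi> i ?L x - ?\<Phi> i (?D i) x) - (?\<Phi> (i + 1) ?R x - ?\<Phi> (i + 1) (?D (i + 1)) x)" if "x \<in> {0..1}" for x
    using gbspl_eq_cdf_diff[OF that] by (simp add: bspline_Suc)
  have bound: "\<bar>gbspl Q mu n p (Suc q) i x - bspline (knot n p) (Suc q) i x\<bar> \<le> 2 * real (q + 1) * e"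
    if x: "x \<in> {0..1}" for x
  proof -
    have "\<bar>?\<Phi> i ?L x - ?\<Phi> i (?D i) x\<bar> \<le> real (q + 1) * e"
      using abs_cdf_on_diff_le[OF C unit_density_bspline_density left_close] support_length_le[of i] x
      by fastforce
    moreover have "\<bar>?\<Phi> (i + 1) ?R x - ?\<Phi> (i + 1) (?D (i + 1)) x\<bar> \<le> real (q + 1) * e"
      using abs_cdf_on_diff_le[of "knot n p (i + 1)" "knot n p (i + 1 + q + 1)",
          OF _ unit_density_bspline_density right_close]
        C' support_length_le[of "i + 1"] x by fastforce
    ultimately show ?thesis unfolding diff[OF x] by linarith
  qed
  have "localized (knot n p i) (knot n p (i + q + 2)) B (gbspl Q mu n p (Suc q) i) \<longleftrightarrow>
      localized (knot n p i) (knot n p (i + q + 2)) B (\<lambda>x. ?\<Phi> i ?L x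
        - cdf_on (knot n p (i + 1)) (knot n p (i + q + 2)) ?R x)" for B
    by (rule localized_cong) (rule gbspl_eq_cdf_diff)
  moreover have "knot n p i \<le> knot n p (i + 1)" "knot n p (i + q + 1) \<le> knot n p (i + q + 2)"
    by (rule mono, simp)+
  ultimately obtain B where "localized (knot n p i) (knot n p (i + q + 2)) B (gbspl Q mu n p (Suc q) i)"
    using localized_cdf_on_diff[OF C C'] by blast
  moreover have "localized (knot n p i) (knot n p (i + q + 2)) (bspline_bound (Suc q))
      (bspline (knot n p) (Suc q) i)"
    using localized_bspline[of i "Suc q"] by (simp del: bspline_bound.simps)
  ultimately show ?thesis by (rule localized_sharpen[OF localized_diff bound])
qed

lemma continuous_on_gbspl: "continuous_on {0..1} (gbspl Q mu n p (Suc q) i)"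
proof -
  obtain C where C: "unit_density (knot n p i) (knot n p (i + q + 1)) C (gb_density_left Q mu n p q i)"
    using left_density by blast
  obtain C' where C': "unit_density (knot n p (i + 1)) (knot n p (i + q + 2)) C'
      (gb_density_right Q mu n p q (i + 1))"
    using right_density[of "i + 1"] by auto
  show ?thesis
    by (rule continuous_on_eq[OF
      continuous_on_diff[OF continuous_on_cdf_on[OF C] continuous_on_cdf_on[OF C']]])
      (rule gbspl_eq_cdf_diff[symmetric])
qed

lemma deriv_gbspl:
  assumes x: "x \<in> {0<..<1}" "real n * x \<notin> \<int>"
  shows "deriv (gbspl Q mu n p (Suc q) i) x
    = gb_density_left Q mu n p q i x - gb_density_right Q mu n p q (i + 1) x"
proof (rule DERIV_imp_deriv, rule has_field_derivative_transform_within_open)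
  obtain C where C: "unit_density (knot n p i) (knot n p (i + q + 1)) C (gb_density_left Q mu n p q i)"
    using left_density by blast
  obtain C' where C': "unit_density (knot n p (i + 1)) (knot n p (i + q + 2)) C'
      (gb_density_right Q mu n p q (i + 1))"
    using right_density[of "i + 1"] by auto
  show "((\<lambda>x. cdf_on (knot n p i) (knot n p (i + q + 1)) (gb_density_left Q mu n p q i) x
      - cdf_on (knot n p (i + 1)) (knot n p (i + q + 2)) (gb_density_right Q mu n p q (i + 1)) x)
    has_real_derivative gb_density_left Q mu n p q i x - gb_density_right Q mu n p q (i + 1) x) (at x)"
    using x by (intro DERIV_diff DERIV_cdf_on[OF C] DERIV_cdf_on[OF C'] isCont_left isCont_right)
  show "x \<in> {0<..<1}" by (rule x)
qed (auto intro!: gbspl_eq_cdf_diff[symmetric] simp del: One_nat_def add_2_eq_Suc add_2_eq_Suc')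

lemma gb_density_diff_close:
  "localized (knot n p i) (knot n p (i + q + 2)) (2 * e * real n)
    (\<lambda>x. (gb_density_left Q mu n p q i x - gb_density_right Q mu n p q (i + 1) x)
      - (bspline_density (knot n p) q i x - bspline_density (knot n p) q (i + 1) x))"
proof -
  let ?D = "\<lambda>i. bspline_density (knot n p) q i"
  have "localized (knot n p i) (knot n p (i + q + 2)) (e * real n)
      (\<lambda>x. gb_density_left Q mu n p q i x - ?D i x)"
    by (rule localized_mono[OF left_close]) (auto intro!: mono)
  moreover have "localized (knot n p i) (knot n p (i + q + 2)) (e * real n)
      (\<lambda>x. gb_density_right Q mu n p q (i + 1) x - ?D (i + 1) x)"
    by (rule localized_mono[OF right_close]) (auto intro!: mono)
  ultimately show ?thesis
    using localized_diff by (fastforce simp: algebra_simps)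
qed

lemma normalized_gbspl_close:
  assumes e: "gb_const q * e \<le> 1"
  shows "localized (knot n p i) (knot n p (i + q + 2)) (gb_const q * e * real n)
      (\<lambda>x. normalized (knot n p i) (knot n p (i + q + 2)) (gbspl Q mu n p (Suc q) i) x
        - normalized (knot n p i) (knot n p (i + q + 2)) (bspline (knot n p) (Suc q) i) x)"
    and "knot n p i < knot n p (i + q + 2) \<Longrightarrow>
      (knot n p (i + q + 2) - knot n p i) / (2 * real (q + 2)) \<le> integral {0..1} (gbspl Q mu n p (Suc q) i)"
proof -
  let ?B = "bspline_bound (Suc q)"
  have spline: "localized (knot n p i) (knot n p (i + q + 2)) ?B (bspline (knot n p) (Suc q) i)"
    using localized_bspline[of i "Suc q"] by simp
  have mass: "integral {0..1} (bspline (knot n p) (Suc q) i)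
      = (knot n p (i + q + 2) - knot n p i) / real (q + 2)"
    using integral_bspline[of "Suc q" i] by simp
  have small: "2 * real (q + 2) * (2 * real (q + 1) * e) \<le> 1"
  proof -
    have "2 * real (q + 2) * (2 * real (q + 1) * e) * 1
        \<le> 2 * real (q + 2) * (2 * real (q + 1) * e) * (1 + ?B * real (q + 2))"
      using e_nonneg bspline_bound_ge_1[of "Suc q"] by (intro mult_left_mono) auto
    also have "\<dots> = gb_const q * e" unfolding gb_const_def
      by (simp add: algebra_simps del: bspline_bound.simps)
    finally show ?thesis using e by linarith
  qed
  have "i \<le> i + q + 2" by simp
  note diff = localized_normalized_diff[OF spline gbspl_close nonneg mono[OF this] le_1 mass _ small
    knot_gap[OF n_pos]]
  have const: "gb_const q * e * real n
      = 2 * real (q + 2) * (1 + ?B * real (q + 2)) * (2 * real (q + 1) * e) / (1 / real n)"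
    unfolding gb_const_def by (simp add: algebra_simps del: bspline_bound.simps)
  show "localized (knot n p i) (knot n p (i + q + 2)) (gb_const q * e * real n)
      (\<lambda>x. normalized (knot n p i) (knot n p (i + q + 2)) (gbspl Q mu n p (Suc q) i) x
        - normalized (knot n p i) (knot n p (i + q + 2)) (bspline (knot n p) (Suc q) i) x)"
    unfolding const by (rule diff(1)) (use n_pos in auto)
  show "(knot n p (i + q + 2) - knot n p i) / (2 * real (q + 2)) \<le> integral {0..1} (gbspl Q mu n p (Suc q) i)"
    if "knot n p i < knot n p (i + q + 2)"
    using that n_pos by (intro diff(2)) auto
qed

theorem gb_approximation_Suc:
  assumes e: "gb_const q * e \<le> 1"
  shows "gb_approximation Q mu n p (Suc q) (gb_const q * e)"
proof -
  let ?G = "gbspl Q mu n p (Suc q)" and ?a = "\<lambda>i. knot n p i" and ?b = "\<lambda>i. knot n p (i + q + 2)"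
  note close = normalized_gbspl_close(1)[OF e] and lower = normalized_gbspl_close(2)[OF e]
  have spline: "localized (?a i) (?b i) (bspline_bound (Suc q)) (bspline (knot n p) (Suc q) i)" for i
    using localized_bspline[of i "Suc q"] by simp
  have localized_gbspl: "localized (?a i) (?b i) (2 * real (q + 1) * e + bspline_bound (Suc q)) (?G i)" for i
    using localized_add[OF gbspl_close spline] by simp
  have density: "\<exists>C. unit_density (?a i) (?b i) C (normalized (?a i) (?b i) (?G i))" for i
    by (rule exI, rule unit_density_normalized[OF localized_gbspl nonneg mono le_1,
      where K = "(?b i - ?a i) / (2 * real (q + 2))"])
      (use less_or_degenerate[of i "i + q + 2"] mono[of i "i + q + 2"] lower[of i] in auto)
  have mass_pos: "integral {0..1} (?G i) > 0" if "?a i < ?b i" for i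
    by (rule less_le_trans[OF _ lower[OF that]]) (use that in auto)
  have isCont: "isCont (normalized (?a i) (?b i) (?G i)) x" if "x \<in> {0<..<1}" for i x
    using continuous_on_interior[OF continuous_on_gbspl, of x i] that mass_pos[of i]
    by (cases "?a i < ?b i") (auto simp: normalized_def[abs_def] intro!: continuous_intros)
  have cdf: "(let a = ?a k; b = ?b k in if a < b then integral {a..x} (?G k) / integral {a..b} (?G k)
      else if a < 1 \<and> a \<le> x then 1 else 0) = cdf_on (?a k) (?b k) (normalized (?a k) (?b k) (?G k)) x"
    if "x \<in> {0..1}" for k x
    using cdf_on_normalized[OF localized_gbspl nonneg le_1 less_or_degenerate that] by (simp add: Let_def)
  show ?thesis
  proof
    fix i x assume x: "x \<in> {0..1::real}"
    show "gbspl Q mu n p (Suc (Suc q)) i x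
      = cdf_on (?a i) (knot n p (i + Suc q + 1)) (gb_density_left Q mu n p (Suc q) i) x
      - cdf_on (?a (i + 1)) (knot n p (i + Suc q + 2)) (gb_density_right Q mu n p (Suc q) (i + 1)) x"
      using cdf[OF x, of i] cdf[OF x, of "Suc i"]
      by (simp add: gbspl.simps(3) gb_density_Suc Let_def cong: if_cong split del: if_split)
  qed (use n_pos density close isCont in \<open>auto simp: gb_density_Suc bspline_density_def\<close>)
qed

end

lemma gb_approximation_mono:
  assumes "gb_approximation Q mu n p q e" "e \<le> e'"
  shows "gb_approximation Q mu n p q e'"
proof -
  interpret gb_approximation Q mu n p q e by fact
  have "e * real n \<le> e' * real n" using assms(2) by (intro mult_right_mono) auto
  then show ?thesis
    using n_pos left_density right_density isCont_left isCont_right gbspl_eq_cdf_diff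
      localized_mono[OF left_close order.refl order.refl] localized_mono[OF right_close order.refl order.refl]
    by unfold_locales blast+
qed

theorem eventually_gb_approximation:
  assumes "mu > 0" "e > 0"
  shows "\<forall>\<^sub>F n in sequentially. gb_approximation Q mu n p q e"
  using assms(2)
proof (induction q arbitrary: e)
  case 0
  then show ?case by (rule eventually_gb_approximation_0[OF assms(1)])
next
  case (Suc q)
  define e' where "e' = min e 1 / gb_const q"
  have "e' > 0" using Suc.prems gb_const_pos[of q] by (simp add: e'_def)
  from Suc.IH[OF this] show ?case
  proof eventually_elim
    case (elim n)
    have e': "gb_const q * e' = min e 1" using gb_const_pos[of q] by (simp add: e'_def)
    then have "gb_approximation Q mu n p (Suc q) (min e 1)"
      using gb_approximation.gb_approximation_Suc[OF elim] by simp
    then show ?case by (rule gb_approximation_mono) simp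
  qed
qed

section \<open>Matrix families with lattice indices\<close>

text \<open>Convergence along \<open>entries d\<close> is convergence of the entries of a sequence of matrices of sizes
  \<open>d n\<close>, uniformly in the row and column index.\<close>
definition entries :: "(nat \<Rightarrow> nat) \<Rightarrow> (nat \<times> nat \<times> nat) filter" where
  "entries d = inf (filtercomap fst sequentially) (principal {(n, r, s). r < d n \<and> s < d n})"

lemma eventually_entries:
  "eventually P (entries d) \<longleftrightarrow> (\<forall>\<^sub>F n in sequentially. \<forall>r<d n. \<forall>s<d n. P (n, r, s))"
  unfolding entries_def eventually_inf_principal eventually_filtercomap
  by (auto elim!: eventually_mono)

lemma filterlim_fst_entries: "filterlim fst sequentially (entries d)"
  by (auto simp: filterlim_iff eventually_entries elim: eventually_mono)

definition erosion :: "'g::ab_group_add set \<Rightarrow> 'g set \<Rightarrow> 'g set" where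
  "erosion W S = {x \<in> S. \<forall>w\<in>W. x + w \<in> S}"

lemma erosion_subset: "erosion W S \<subseteq> S"
  by (auto simp: erosion_def)

lemma erosion_mono: "S \<subseteq> T \<Longrightarrow> erosion W S \<subseteq> erosion W T"
  by (auto simp: erosion_def)

lemma erosion_power_subset: "(erosion W ^^ k) S \<subseteq> S"
proof (induction k)
  case (Suc k)
  have "(erosion W ^^ Suc k) S \<subseteq> (erosion W ^^ k) S" by (simp add: erosion_subset)
  then show ?case using Suc by blast
qed simp

lemma erosion_power_Suc_subset: "(erosion W ^^ Suc k) S \<subseteq> erosion W S"
  by (simp add: erosion_mono erosion_power_subset)

lemma card_minus_erosion_power:
  assumes "finite W" "finite S"
  shows "card (S - (erosion W ^^ Suc k) S)
    \<le> card (S - erosion W S) + (1 + card W) * card (S - (erosion W ^^ k) S)"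
proof -
  let ?D = "S - (erosion W ^^ k) S"
  let ?shifted = "\<Union>w\<in>W. (\<lambda>x. x - w) ` ?D"
  have "S - (erosion W ^^ Suc k) S \<subseteq> (S - erosion W S) \<union> (?D \<union> ?shifted)"
    by (force simp: erosion_def image_iff algebra_simps)
  then have "card (S - (erosion W ^^ Suc k) S) \<le> card ((S - erosion W S) \<union> (?D \<union> ?shifted))"
    using assms by (intro card_mono) auto
  also have "\<dots> \<le> card (S - erosion W S) + (card ?D + card ?shifted)"
    by (intro order.trans[OF card_Un_le] add_left_mono card_Un_le)
  also have "card ?shifted \<le> card W * card ?D"
  proof (rule order.trans[OF card_UN_le[OF assms(1)]])
    show "(\<Sum>w\<in>W. card ((\<lambda>x. x - w) ` ?D)) \<le> card W * card ?D"
      using sum_bounded_above[of W "\<lambda>w. card ((\<lambda>x. x - w) ` ?D)" "card ?D"] assms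
      by (simp add: card_image_le)
  qed
  finally show ?thesis by simp
qed

definition eroded_entries ::
    "'g::ab_group_add set \<Rightarrow> (nat \<Rightarrow> nat \<Rightarrow> 'g) \<Rightarrow> (nat \<Rightarrow> nat) \<Rightarrow> nat \<Rightarrow> (nat \<times> nat \<times> nat) filter" where
  "eroded_entries W pos d k =
    inf (entries d) (principal {(n, r, s). pos n s \<in> (erosion W ^^ k) (pos n ` {..<d n})})"

lemma eroded_entries_le: "eroded_entries W pos d k \<le> entries d"
  by (simp add: eroded_entries_def)

lemma eventually_eroded_entries:
  "eventually P (eroded_entries W pos d k) \<longleftrightarrow> (\<forall>\<^sub>F n in sequentially. \<forall>r<d n. \<forall>s<d n.
    pos n s \<in> (erosion W ^^ k) (pos n ` {..<d n}) \<longrightarrow> P (n, r, s))"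
  unfolding eroded_entries_def eventually_inf_principal eventually_entries by simp

lemma eroded_entries_0: "eroded_entries W pos d 0 = entries d"
  by (rule filter_eqI) (simp add: eventually_eroded_entries eventually_entries)

lemma filterlim_eroded_entries:
  assumes "filterlim \<phi> sequentially sequentially"
    and "\<forall>\<^sub>F n in sequentially. \<forall>r<d n. \<forall>s<d n. pos n s \<in> (erosion W ^^ k) (pos n ` {..<d n}) \<longrightarrow>
      g n r s < d' (\<phi> n) \<and> h n r s < d' (\<phi> n)
      \<and> pos' (\<phi> n) (h n r s) \<in> (erosion W' ^^ k') (pos' (\<phi> n) ` {..<d' (\<phi> n)})"
  shows "filterlim (\<lambda>(n, r, s). (\<phi> n, g n r s, h n r s)) (eroded_entries W' pos' d' k')
    (eroded_entries W pos d k)"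
  unfolding filterlim_iff eventually_eroded_entries
proof (intro allI impI)
  fix P assume "\<forall>\<^sub>F n in sequentially. \<forall>r<d' n. \<forall>s<d' n.
    pos' n s \<in> (erosion W' ^^ k') (pos' n ` {..<d' n}) \<longrightarrow> P (n, r, s)"
  from eventually_compose_filterlim[OF this assms(1)] assms(2)
  show "\<forall>\<^sub>F n in sequentially. \<forall>r<d n. \<forall>s<d n. pos n s \<in> (erosion W ^^ k) (pos n ` {..<d n}) \<longrightarrow>
      P (case (n, r, s) of (n, r, s) \<Rightarrow> (\<phi> n, g n r s, h n r s))"
    by eventually_elim auto
qed

lemma Bfun_entries_iff:
  fixes f :: "nat \<Rightarrow> nat \<Rightarrow> nat \<Rightarrow> real"
  shows "Bfun (\<lambda>(n, r, s). f n r s) (entries d)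
    \<longleftrightarrow> (\<exists>K. \<forall>\<^sub>F n in sequentially. \<forall>r<d n. \<forall>s<d n. \<bar>f n r s\<bar> \<le> K)"
proof
  assume "Bfun (\<lambda>(n, r, s). f n r s) (entries d)"
  then show "\<exists>K. \<forall>\<^sub>F n in sequentially. \<forall>r<d n. \<forall>s<d n. \<bar>f n r s\<bar> \<le> K"
    by (auto elim!: BfunE simp: eventually_entries)
next
  assume "\<exists>K. \<forall>\<^sub>F n in sequentially. \<forall>r<d n. \<forall>s<d n. \<bar>f n r s\<bar> \<le> K"
  then obtain K where "\<forall>\<^sub>F n in sequentially. \<forall>r<d n. \<forall>s<d n. \<bar>f n r s\<bar> \<le> K" by blast
  then show "Bfun (\<lambda>(n, r, s). f n r s) (entries d)"
    by (intro BfunI[of _ K]) (simp add: eventually_entries)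
qed

lemma tendsto_eroded_entries_iff:
  fixes f :: "nat \<Rightarrow> nat \<Rightarrow> nat \<Rightarrow> real"
  shows "((\<lambda>(n, r, s). f n r s) \<longlongrightarrow> 0) (eroded_entries W pos d k)
    \<longleftrightarrow> (\<forall>e>0. \<forall>\<^sub>F n in sequentially. \<forall>r<d n. \<forall>s<d n.
      pos n s \<in> (erosion W ^^ k) (pos n ` {..<d n}) \<longrightarrow> \<bar>f n r s\<bar> < e)"
  by (simp add: tendsto_iff eventually_eroded_entries)

definition entry :: "(nat \<Rightarrow> 'a mat) \<Rightarrow> nat \<times> nat \<times> nat \<Rightarrow> 'a" where
  "entry A = (\<lambda>(n, r, s). A n $$ (r, s))"

definition offset :: "(nat \<Rightarrow> nat \<Rightarrow> 'g::ab_group_add) \<Rightarrow> nat \<times> nat \<times> nat \<Rightarrow> 'g" where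
  "offset pos = (\<lambda>(n, r, s). pos n r - pos n s)"

definition transpose_index :: "nat \<times> nat \<times> nat \<Rightarrow> nat \<times> nat \<times> nat" where
  "transpose_index = (\<lambda>(n, r, s). (n, s, r))"

definition banded_bounded ::
    "'g::ab_group_add set \<Rightarrow> (nat \<Rightarrow> nat \<Rightarrow> 'g) \<Rightarrow> (nat \<Rightarrow> nat) \<Rightarrow> (nat \<Rightarrow> real mat) \<Rightarrow> bool" where
  "banded_bounded W pos d A \<longleftrightarrow> (\<forall>n. A n \<in> carrier_mat (d n) (d n))
    \<and> (\<forall>\<^sub>F x in entries d. offset pos x \<notin> W \<longrightarrow> entry A x = 0)
    \<and> Bfun (entry A) (entries d)"

definition asymp_toeplitz ::
    "'g::ab_group_add set \<Rightarrow> (nat \<Rightarrow> nat \<Rightarrow> 'g) \<Rightarrow> (nat \<Rightarrow> nat) \<Rightarrow> (nat \<Rightarrow> real mat) \<Rightarrow> ('g \<Rightarrow> real) \<Rightarrow> bool" where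
  "asymp_toeplitz W pos d A a \<longleftrightarrow>
    ((\<lambda>x. entry A x - a (offset pos x)) \<longlongrightarrow> 0) (eroded_entries W pos d 1)"

definition asymp_symmetric :: "(nat \<Rightarrow> nat) \<Rightarrow> (nat \<Rightarrow> real mat) \<Rightarrow> bool" where
  "asymp_symmetric d A \<longleftrightarrow> ((\<lambda>x. entry A x - entry A (transpose_index x)) \<longlongrightarrow> 0) (entries d)"

lemma banded_boundedD:
  assumes "banded_bounded W pos d A"
  shows "A n \<in> carrier_mat (d n) (d n)"
    and "\<forall>\<^sub>F x in entries d. offset pos x \<notin> W \<longrightarrow> entry A x = 0"
    and "Bfun (entry A) (entries d)"
  using assms by (simp_all add: banded_bounded_def)

lemma tendsto_mult_diff_0:
  fixes X X' Y Y' :: "'a \<Rightarrow> real"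
  assumes X: "((\<lambda>x. X x - X' x) \<longlongrightarrow> 0) F" and Y: "((\<lambda>x. Y x - Y' x) \<longlongrightarrow> 0) F"
    and "Bfun X F" "Bfun Y F"
  shows "((\<lambda>x. X x * Y x - X' x * Y' x) \<longlongrightarrow> 0) F"
proof -
  have "((\<lambda>x. (X x - X' x) * Y x) \<longlongrightarrow> 0) F" "((\<lambda>x. X x * (Y x - Y' x)) \<longlongrightarrow> 0) F"
    using assms bounded_bilinear.Zfun_prod_Bfun[OF bounded_bilinear_mult]
      bounded_bilinear.Bfun_prod_Zfun[OF bounded_bilinear_mult]
    unfolding tendsto_Zfun_iff diff_zero by metis+
  from tendsto_diff[OF tendsto_add[OF this] tendsto_mult_zero[OF X Y]]
  show ?thesis by (simp add: algebra_simps)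
qed

lemma Bfun_filterlim_compose:
  fixes f :: "'a \<Rightarrow> 'b::real_normed_vector"
  assumes "Bfun f G" "filterlim h G F"
  shows "Bfun (\<lambda>x. f (h x)) F"
proof -
  obtain K where "K > 0" "\<forall>\<^sub>F x in G. norm (f x) \<le> K" using assms(1) by (rule BfunE)
  then show ?thesis using assms(2) by (intro BfunI) (rule eventually_compose_filterlim)
qed

lemma Bfun_mono:
  fixes f :: "'a \<Rightarrow> 'b::real_normed_vector"
  shows "Bfun f G \<Longrightarrow> F \<le> G \<Longrightarrow> Bfun f F"
  by (metis BfunE BfunI filter_leD)

subsection \<open>Powers and traces\<close>

fun conv_pow :: "('g::ab_group_add \<Rightarrow> 'a::comm_semiring_1) \<Rightarrow> 'g set \<Rightarrow> nat \<Rightarrow> 'g \<Rightarrow> 'a" where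
  "conv_pow a W 0 z = (if z = 0 then 1 else 0)"
| "conv_pow a W (Suc k) z = (\<Sum>w\<in>W. conv_pow a W k (z - w) * a w)"

lemma index_mult_mat_sum:
  "A \<in> carrier_mat d d \<Longrightarrow> B \<in> carrier_mat d d \<Longrightarrow> i < d \<Longrightarrow> j < d \<Longrightarrow>
    (A * B) $$ (i, j) = (\<Sum>l<d. A $$ (i, l) * B $$ (l, j))"
  by (auto simp: scalar_prod_def lessThan_atLeast0)

definition mat_trace :: "'a::comm_monoid_add mat \<Rightarrow> 'a" where
  "mat_trace A = (\<Sum>i<dim_row A. A $$ (i, i))"

lemma average_tendsto:
  fixes x :: "nat \<Rightarrow> nat \<Rightarrow> real"
  assumes bounded: "\<forall>\<^sub>F n in sequentially. \<forall>i<d n. \<bar>x n i - c\<bar> \<le> B"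
    and close: "\<And>e. e > 0 \<Longrightarrow> \<forall>\<^sub>F n in sequentially. \<forall>i<d n. i \<notin> Z n \<longrightarrow> \<bar>x n i - c\<bar> \<le> e"
    and negligible: "(\<lambda>n. card ({..<d n} \<inter> Z n) / d n) \<longlonglongrightarrow> 0"
    and d: "\<forall>\<^sub>F n in sequentially. d n > 0"
  shows "(\<lambda>n. (\<Sum>i<d n. x n i) / d n) \<longlonglongrightarrow> c"
proof (rule tendstoI)
  fix e :: real assume e: "e > 0"
  have "(\<lambda>n. B * (card ({..<d n} \<inter> Z n) / d n)) \<longlonglongrightarrow> B * 0"
    by (intro tendsto_mult tendsto_const negligible)
  then have "\<forall>\<^sub>F n in sequentially. B * (card ({..<d n} \<inter> Z n) / d n) < e / 2"
    using e by (intro order_tendstoD(2)) auto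
  moreover have "\<forall>\<^sub>F n in sequentially. \<forall>i<d n. i \<notin> Z n \<longrightarrow> \<bar>x n i - c\<bar> \<le> e / 2"
    using e by (intro close) simp
  ultimately show "\<forall>\<^sub>F n in sequentially. dist ((\<Sum>i<d n. x n i) / d n) c < e"
    using bounded d
  proof eventually_elim
    case (elim n)
    have "\<bar>\<Sum>i<d n. x n i - c\<bar> \<le> (\<Sum>i<d n. e / 2 + (if i \<in> Z n then B else 0))"
      using elim e by (intro order.trans[OF sum_abs] sum_mono) (auto intro: add_increasing)
    also have "\<dots> = d n * (e / 2) + B * card ({..<d n} \<inter> Z n)"
      unfolding sum.distrib by (simp add: sum.If_cases)
    also have "\<dots> = d n * (e / 2 + B * (card ({..<d n} \<inter> Z n) / d n))"
      using elim(4) by (simp add: distrib_left)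
    also have "\<dots> < d n * e"
      using elim(1,4) by (intro mult_strict_left_mono) (linarith, simp)
    finally have "\<bar>\<Sum>i<d n. x n i - c\<bar> / d n < e"
      using elim(4) by (simp add: pos_divide_less_eq mult.commute)
    moreover have "(\<Sum>i<d n. x n i) / d n - c = (\<Sum>i<d n. x n i - c) / d n"
      using elim(4) by (simp add: sum_subtractf diff_divide_distrib)
    ultimately show ?case by (simp add: dist_real_def)
  qed
qed

lemma sum_le_card_mult:
  fixes f :: "nat \<Rightarrow> real"
  assumes "finite S" "card {t \<in> S. P t} \<le> m" "\<And>t. t \<in> S \<Longrightarrow> f t \<le> B" "B \<ge> 0"
    "\<And>t. t \<in> S \<Longrightarrow> \<not> P t \<Longrightarrow> f t = 0"
  shows "(\<Sum>t\<in>S. f t) \<le> real m * B"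
proof -
  have "(\<Sum>t\<in>S. f t) = (\<Sum>t\<in>{t \<in> S. P t}. f t)"
    using assms by (intro sum.mono_neutral_right) auto
  also have "\<dots> \<le> real (card {t \<in> S. P t}) * B"
    using assms by (intro sum_bounded_above) auto
  also have "\<dots> \<le> real m * B" using assms by (intro mult_right_mono) auto
  finally show ?thesis .
qed

locale toeplitz_sequence =
  fixes W :: "'g::ab_group_add set" and pos :: "nat \<Rightarrow> nat \<Rightarrow> 'g" and d :: "nat \<Rightarrow> nat"
    and A :: "nat \<Rightarrow> real mat" and a :: "'g \<Rightarrow> real"
  assumes finite_W: "finite W"
    and inj_pos: "inj_on (pos n) {..<d n}"
    and d_pos: "\<forall>\<^sub>F n in sequentially. d n > 0"
    and negligible_boundary:
      "(\<lambda>n. card (pos n ` {..<d n} - erosion W (pos n ` {..<d n})) / d n) \<longlonglongrightarrow> 0"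
    and banded_bounded: "banded_bounded W pos d A"
    and asymp_toeplitz: "asymp_toeplitz W pos d A a"
begin

abbreviation positions :: "nat \<Rightarrow> 'g set" where
  "positions n \<equiv> pos n ` {..<d n}"

lemmas carrier = banded_boundedD(1)[OF banded_bounded]

lemma eventually_banded: "\<forall>\<^sub>F n in sequentially. \<forall>r<d n. \<forall>s<d n. pos n r - pos n s \<notin> W \<longrightarrow> A n $$ (r, s) = 0"
  using banded_boundedD(2)[OF banded_bounded] by (simp add: eventually_entries entry_def offset_def)

lemma Bfun_entries: "Bfun (\<lambda>(n, r, s). A n $$ (r, s)) (entries d)"
  using banded_boundedD(3)[OF banded_bounded] by (simp add: entry_def)

lemma tendsto_symbol: "((\<lambda>(n, r, s). A n $$ (r, s) - a (pos n r - pos n s)) \<longlongrightarrow> 0) (eroded_entries W pos d 1)"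
  using asymp_toeplitz by (simp add: asymp_toeplitz_def entry_def offset_def case_prod_unfold)

lemma card_band_le:
  "card {t \<in> {..<d n}. pos n r - pos n t \<in> W} \<le> card W"
  "card {t \<in> {..<d n}. pos n t - pos n s \<in> W} \<le> card W"
proof -
  show "card {t \<in> {..<d n}. pos n r - pos n t \<in> W} \<le> card W"
    by (rule card_inj_on_le[of "\<lambda>t. pos n r - pos n t"])
      (use inj_pos[of n] finite_W in \<open>auto simp: inj_on_def\<close>)
  show "card {t \<in> {..<d n}. pos n t - pos n s \<in> W} \<le> card W"
    by (rule card_inj_on_le[of "\<lambda>t. pos n t - pos n s"])
      (use inj_pos[of n] finite_W in \<open>auto simp: inj_on_def\<close>)
qed

lemma row_column_sums_bounded:
  obtains D where "D \<ge> 0" "\<forall>\<^sub>F n in sequentially. \<forall>r<d n. (\<Sum>s<d n. \<bar>A n $$ (r, s)\<bar>) \<le> D"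
    "\<forall>\<^sub>F n in sequentially. \<forall>s<d n. (\<Sum>r<d n. \<bar>A n $$ (r, s)\<bar>) \<le> D"
proof -
  obtain K where K: "\<forall>\<^sub>F n in sequentially. \<forall>r<d n. \<forall>s<d n. \<bar>A n $$ (r, s)\<bar> \<le> K"
    using Bfun_entries unfolding Bfun_entries_iff by blast
  let ?D = "card W * \<bar>K\<bar>"
  have "\<forall>\<^sub>F n in sequentially. (\<forall>r<d n. (\<Sum>s<d n. \<bar>A n $$ (r, s)\<bar>) \<le> ?D)
      \<and> (\<forall>s<d n. (\<Sum>r<d n. \<bar>A n $$ (r, s)\<bar>) \<le> ?D)"
    using K eventually_banded
  proof eventually_elim
    case (elim n)
    then have entry_le: "\<bar>A n $$ (r, s)\<bar> \<le> \<bar>K\<bar>" if "r < d n" "s < d n" for r s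
      using that by (meson abs_ge_self order.trans)
    show ?case
    proof (intro conjI allI impI)
      fix r assume "r < d n"
      then show "(\<Sum>s<d n. \<bar>A n $$ (r, s)\<bar>) \<le> ?D"
        using entry_le elim(2) by (intro sum_le_card_mult[OF _ card_band_le(1)[of n r]]) auto
    next
      fix s assume "s < d n"
      then show "(\<Sum>r<d n. \<bar>A n $$ (r, s)\<bar>) \<le> ?D"
        using entry_le elim(2) by (intro sum_le_card_mult[OF _ card_band_le(2)[of n s]]) auto
    qed
  qed
  then show thesis
    by (intro that[of ?D]) (auto elim: eventually_mono)
qed

lemma power_bounded: "Bfun (\<lambda>(n, r, s). (A n ^\<^sub>m k) $$ (r, s)) (entries d)"
proof (induction k)
  case 0
  show ?case
    using carrier_matD(1)[OF carrier] by (intro BfunI[of _ 1]) (auto simp: eventually_entries)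
next
  case (Suc k)
  obtain K where K: "\<forall>\<^sub>F n in sequentially. \<forall>r<d n. \<forall>s<d n. \<bar>(A n ^\<^sub>m k) $$ (r, s)\<bar> \<le> K"
    using Suc unfolding Bfun_entries_iff by blast
  obtain D where D: "D \<ge> 0" "\<forall>\<^sub>F n in sequentially. \<forall>s<d n. (\<Sum>r<d n. \<bar>A n $$ (r, s)\<bar>) \<le> D"
    using row_column_sums_bounded by blast
  have "\<forall>\<^sub>F n in sequentially. \<forall>r<d n. \<forall>s<d n. \<bar>(A n ^\<^sub>m Suc k) $$ (r, s)\<bar> \<le> K * D"
    using K D(2)
  proof eventually_elim
    case (elim n)
    show ?case
    proof (intro allI impI)
      fix r s assume rs: "r < d n" "s < d n"
      have "\<bar>(A n ^\<^sub>m Suc k) $$ (r, s)\<bar> = \<bar>\<Sum>t<d n. (A n ^\<^sub>m k) $$ (r, t) * A n $$ (t, s)\<bar>"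
        using index_mult_mat_sum[OF pow_carrier_mat[OF carrier] carrier rs] by simp
      also have "\<dots> \<le> (\<Sum>t<d n. K * \<bar>A n $$ (t, s)\<bar>)"
        using elim(1) rs by (intro order.trans[OF sum_abs] sum_mono)
          (auto simp: abs_mult intro!: mult_right_mono)
      also have "\<dots> = K * (\<Sum>t<d n. \<bar>A n $$ (t, s)\<bar>)" by (simp add: sum_distrib_left)
      also have "\<dots> \<le> K * D"
        using elim rs by (intro mult_left_mono) (auto intro: order.trans[OF abs_ge_zero])
      finally show "\<bar>(A n ^\<^sub>m Suc k) $$ (r, s)\<bar> \<le> K * D" .
    qed
  qed
  then show ?case unfolding Bfun_entries_iff by blast
qed

definition translate :: "nat \<Rightarrow> nat \<Rightarrow> 'g \<Rightarrow> nat" where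
  "translate n s w = inv_into {..<d n} (pos n) (pos n s + w)"

lemma translate:
  assumes "pos n s + w \<in> positions n"
  shows "translate n s w < d n" "pos n (translate n s w) = pos n s + w"
  using inv_into_into[OF assms] f_inv_into_f[OF assms] by (auto simp: translate_def)

lemma power_Suc_eq_sum_window:
  assumes rs: "r < d n" "s < d n" and s: "pos n s \<in> erosion W (positions n)"
    and band: "\<And>t. t < d n \<Longrightarrow> pos n t - pos n s \<notin> W \<Longrightarrow> A n $$ (t, s) = 0"
  shows "(A n ^\<^sub>m Suc k) $$ (r, s)
    = (\<Sum>w\<in>W. (A n ^\<^sub>m k) $$ (r, translate n s w) * A n $$ (translate n s w, s))"
proof -
  note translate_mem = translate[of n s]
  have "(A n ^\<^sub>m Suc k) $$ (r, s) = (\<Sum>t<d n. (A n ^\<^sub>m k) $$ (r, t) * A n $$ (t, s))"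
    using index_mult_mat_sum[OF pow_carrier_mat[OF carrier] carrier rs] by simp
  also have "\<dots> = (\<Sum>t\<in>{t. t < d n \<and> pos n t - pos n s \<in> W}. (A n ^\<^sub>m k) $$ (r, t) * A n $$ (t, s))"
    using band by (intro sum.mono_neutral_right) auto
  also have "\<dots> = (\<Sum>w\<in>W. (A n ^\<^sub>m k) $$ (r, translate n s w) * A n $$ (translate n s w, s))"
  proof (rule sum.reindex_bij_witness[of _ "translate n s" "\<lambda>t. pos n t - pos n s"])
    fix t assume "t \<in> {t. t < d n \<and> pos n t - pos n s \<in> W}"
    then show "translate n s (pos n t - pos n s) = t"
      using inv_into_f_f[OF inj_pos] by (simp add: translate_def)
    then show "(A n ^\<^sub>m k) $$ (r, translate n s (pos n t - pos n s))
        * A n $$ (translate n s (pos n t - pos n s), s)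
      = (A n ^\<^sub>m k) $$ (r, t) * A n $$ (t, s)" by simp
  qed (use s translate_mem in \<open>auto simp: erosion_def\<close>)
  finally show ?thesis .
qed

lemma translate_erosion:
  assumes "pos n s \<in> (erosion W ^^ Suc k) (positions n)" "w \<in> W"
  shows "translate n s w < d n" "pos n (translate n s w) = pos n s + w"
    "pos n s + w \<in> (erosion W ^^ k) (positions n)"
proof -
  show w: "pos n s + w \<in> (erosion W ^^ k) (positions n)"
    using assms by (simp add: erosion_def)
  then have "pos n s + w \<in> positions n" using erosion_power_subset by blast
  then show "translate n s w < d n" "pos n (translate n s w) = pos n s + w"
    by (rule translate)+
qed

lemma tendsto_power_times_entry:
  assumes power: "((\<lambda>(n, r, s). (A n ^\<^sub>m k) $$ (r, s) - conv_pow a W k (pos n r - pos n s)) \<longlongrightarrow> 0)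
      (eroded_entries W pos d k)"
    and w: "w \<in> W"
  shows "((\<lambda>(n, r, s). (A n ^\<^sub>m k) $$ (r, translate n s w) * A n $$ (translate n s w, s)
      - conv_pow a W k (pos n r - pos n (translate n s w)) * a (pos n (translate n s w) - pos n s)) \<longlongrightarrow> 0)
    (eroded_entries W pos d (Suc k))"
proof -
  let ?F = "eroded_entries W pos d (Suc k)"
  have translate_mem: "translate n s w < d n" "pos n (translate n s w) \<in> (erosion W ^^ k) (positions n)"
    if "pos n s \<in> (erosion W ^^ Suc k) (positions n)" for n s
    using translate_erosion[OF that w] by (simp_all only:)
  have left: "filterlim (\<lambda>(n, r, s). (n, r, translate n s w)) (eroded_entries W pos d k) ?F"
    using translate_mem by (intro filterlim_eroded_entries filterlim_ident always_eventually allI impI conjI)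
  have right: "filterlim (\<lambda>(n, r, s). (n, translate n s w, s)) (eroded_entries W pos d 1) ?F"
  proof (intro filterlim_eroded_entries filterlim_ident always_eventually allI impI)
    fix n r s assume "r < d n" "s < d n" and s: "pos n s \<in> (erosion W ^^ Suc k) (positions n)"
    then show "translate n s w < d n \<and> s < d n \<and> pos n s \<in> (erosion W ^^ 1) (positions n)"
      using translate_mem(1)[OF s] subsetD[OF erosion_power_Suc_subset s] by simp
  qed
  have "Bfun (\<lambda>(n, r, s). (A n ^\<^sub>m k) $$ (r, translate n s w)) ?F"
    using Bfun_filterlim_compose[OF Bfun_mono[OF power_bounded eroded_entries_le] left]
    by (simp add: case_prod_unfold)
  moreover have "Bfun (\<lambda>(n, r, s). A n $$ (translate n s w, s)) ?F"
    using Bfun_filterlim_compose[OF Bfun_mono[OF Bfun_entries eroded_entries_le] right]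
    by (simp add: case_prod_unfold)
  moreover have "((\<lambda>x. (case x of (n, r, s) \<Rightarrow> (A n ^\<^sub>m k) $$ (r, translate n s w))
      - (case x of (n, r, s) \<Rightarrow> conv_pow a W k (pos n r - pos n (translate n s w)))) \<longlongrightarrow> 0) ?F"
    using filterlim_compose[OF power left] by (simp add: case_prod_unfold)
  moreover have "((\<lambda>x. (case x of (n, r, s) \<Rightarrow> A n $$ (translate n s w, s))
      - (case x of (n, r, s) \<Rightarrow> a (pos n (translate n s w) - pos n s))) \<longlongrightarrow> 0) ?F"
    using filterlim_compose[OF tendsto_symbol right] by (simp add: case_prod_unfold)
  ultimately have "((\<lambda>x. (case x of (n, r, s) \<Rightarrow> (A n ^\<^sub>m k) $$ (r, translate n s w))
        * (case x of (n, r, s) \<Rightarrow> A n $$ (translate n s w, s))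
      - (case x of (n, r, s) \<Rightarrow> conv_pow a W k (pos n r - pos n (translate n s w)))
        * (case x of (n, r, s) \<Rightarrow> a (pos n (translate n s w) - pos n s))) \<longlongrightarrow> 0) ?F"
    by (intro tendsto_mult_diff_0)
  then show ?thesis by (simp add: case_prod_unfold)
qed

lemma power_Suc_diff_conv_pow:
  assumes band: "\<forall>r<d n. \<forall>s<d n. pos n r - pos n s \<notin> W \<longrightarrow> A n $$ (r, s) = 0"
    and rs: "r < d n" "s < d n" and s: "pos n s \<in> (erosion W ^^ Suc k) (positions n)"
  shows "(A n ^\<^sub>m Suc k) $$ (r, s) - conv_pow a W (Suc k) (pos n r - pos n s)
    = (\<Sum>w\<in>W. (A n ^\<^sub>m k) $$ (r, translate n s w) * A n $$ (translate n s w, s)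
      - conv_pow a W k (pos n r - pos n (translate n s w)) * a (pos n (translate n s w) - pos n s))"
proof -
  have "(A n ^\<^sub>m Suc k) $$ (r, s) = (\<Sum>w\<in>W. (A n ^\<^sub>m k) $$ (r, translate n s w) * A n $$ (translate n s w, s))"
    using band rs subsetD[OF erosion_power_Suc_subset s] by (intro power_Suc_eq_sum_window) auto
  moreover have "conv_pow a W (Suc k) (pos n r - pos n s)
      = (\<Sum>w\<in>W. conv_pow a W k (pos n r - pos n (translate n s w)) * a (pos n (translate n s w) - pos n s))"
    unfolding conv_pow.simps by (intro sum.cong refl) (simp add: translate_erosion(2)[OF s] diff_diff_eq)
  ultimately show ?thesis by (simp only: sum_subtractf)
qed

lemma asymp_toeplitz_power:
  "((\<lambda>(n, r, s). (A n ^\<^sub>m k) $$ (r, s) - conv_pow a W k (pos n r - pos n s)) \<longlongrightarrow> 0)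
    (eroded_entries W pos d k)"
proof (induction k)
  case 0
  have "(A n ^\<^sub>m 0) $$ (r, s) = conv_pow a W 0 (pos n r - pos n s)" if "r < d n" "s < d n" for n r s
    using inj_pos[of n] carrier_matD(1)[OF carrier] that by (auto simp: inj_on_def)
  then show ?case unfolding tendsto_eroded_entries_iff by simp
next
  case (Suc k)
  note tendsto_null_sum[OF tendsto_power_times_entry[OF Suc]]
  moreover have "\<forall>\<^sub>F x in eroded_entries W pos d (Suc k).
      (\<Sum>w\<in>W. case x of (n, r, s) \<Rightarrow> (A n ^\<^sub>m k) $$ (r, translate n s w) * A n $$ (translate n s w, s)
        - conv_pow a W k (pos n r - pos n (translate n s w)) * a (pos n (translate n s w) - pos n s))
      = (case x of (n, r, s) \<Rightarrow> (A n ^\<^sub>m Suc k) $$ (r, s) - conv_pow a W (Suc k) (pos n r - pos n s))"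
    using eventually_banded unfolding eventually_eroded_entries prod.case
    by eventually_elim (blast intro: power_Suc_diff_conv_pow[symmetric])
  ultimately show ?case by (rule Lim_transform_eventually)
qed

lemma boundary_negligible:
  "(\<lambda>n. card (positions n - (erosion W ^^ k) (positions n)) / d n) \<longlonglongrightarrow> 0"
proof (induction k)
  case 0
  show ?case by simp
next
  case (Suc k)
  define \<rho> where "\<rho> k n = card (positions n - (erosion W ^^ k) (positions n)) / d n" for k n
  have "\<rho> (Suc k) n \<le> \<rho> 1 n + real (1 + card W) * \<rho> k n" for n
  proof -
    have "real (card (positions n - (erosion W ^^ Suc k) (positions n))) \<le>
        real (card (positions n - erosion W (positions n))
          + (1 + card W) * card (positions n - (erosion W ^^ k) (positions n)))"
      unfolding of_nat_le_iff by (rule card_minus_erosion_power) (auto simp: finite_W)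
    then have "\<rho> (Suc k) n \<le> real (card (positions n - erosion W (positions n))
        + (1 + card W) * card (positions n - (erosion W ^^ k) (positions n))) / d n"
      unfolding \<rho>_def by (rule divide_right_mono) simp
    then show ?thesis by (simp add: \<rho>_def add_divide_distrib distrib_right)
  qed
  then have "\<forall>\<^sub>F n in sequentially. norm (\<rho> (Suc k) n) \<le> \<rho> 1 n + real (1 + card W) * \<rho> k n"
    by (simp add: \<rho>_def)
  moreover have "(\<lambda>n. \<rho> 1 n + real (1 + card W) * \<rho> k n) \<longlonglongrightarrow> 0"
    using tendsto_add[OF negligible_boundary tendsto_mult_right_zero[OF Suc]] by (simp add: \<rho>_def)
  ultimately have "\<rho> (Suc k) \<longlonglongrightarrow> 0" by (rule Lim_null_comparison)
  then show ?case by (simp add: \<rho>_def[abs_def])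
qed

theorem trace_power_tendsto: "(\<lambda>n. mat_trace (A n ^\<^sub>m k) / d n) \<longlonglongrightarrow> conv_pow a W k 0"
proof -
  let ?Z = "\<lambda>n. {i. pos n i \<notin> (erosion W ^^ k) (positions n)}"
  obtain K where K: "\<forall>\<^sub>F n in sequentially. \<forall>r<d n. \<forall>s<d n. \<bar>(A n ^\<^sub>m k) $$ (r, s)\<bar> \<le> K"
    using power_bounded[of k] unfolding Bfun_entries_iff by blast
  have "(\<lambda>n. (\<Sum>i<d n. (A n ^\<^sub>m k) $$ (i, i)) / d n) \<longlonglongrightarrow> conv_pow a W k 0"
  proof (rule average_tendsto[OF _ _ _ d_pos])
    show "\<forall>\<^sub>F n in sequentially. \<forall>i<d n. \<bar>(A n ^\<^sub>m k) $$ (i, i) - conv_pow a W k 0\<bar> \<le> K + \<bar>conv_pow a W k 0\<bar>"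
      using K by (rule eventually_mono) (auto intro: order.trans[OF abs_triangle_ineq4])
    show "\<forall>\<^sub>F n in sequentially. \<forall>i<d n. i \<notin> ?Z n \<longrightarrow> \<bar>(A n ^\<^sub>m k) $$ (i, i) - conv_pow a W k 0\<bar> \<le> e"
      if "e > 0" for e
      using asymp_toeplitz_power[of k, unfolded tendsto_eroded_entries_iff, rule_format, OF that]
      by (rule eventually_mono) fastforce
    have "card ({..<d n} \<inter> ?Z n) = card (positions n - (erosion W ^^ k) (positions n))" for n
    proof -
      have "pos n ` ({..<d n} \<inter> ?Z n) = positions n - (erosion W ^^ k) (positions n)" by auto
      then show ?thesis using card_image[OF inj_on_subset[OF inj_pos]] by (metis inf_le1)
    qed
    then show "(\<lambda>n. card ({..<d n} \<inter> ?Z n) / d n) \<longlonglongrightarrow> 0"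
      using boundary_negligible[of k] by simp
  qed
  then show ?thesis using carrier_matD(1)[OF pow_carrier_mat[OF carrier]] by (simp add: mat_trace_def)
qed

end

section \<open>Eigenvalues and traces\<close>

lemma proots_linear_factors:
  fixes as :: "'a::idom list"
  shows "proots (\<Prod>a\<leftarrow>as. [:- a, 1:]) = mset as"
proof -
  have "0 \<notin> set (map (\<lambda>a. [:- a, 1:]) as)" by auto
  from proots_prod_list[OF this] have "proots (\<Prod>a\<leftarrow>as. [:- a, 1:]) = (\<Sum>a\<leftarrow>as. {#a#})"
    by (simp add: comp_def)
  also have "\<dots> = mset as" by (induction as) auto
  finally show ?thesis .
qed

lemma mat_trace_mult_commute:
  fixes A B :: "'a::comm_semiring_0 mat"
  assumes "A \<in> carrier_mat d d" "B \<in> carrier_mat d d"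
  shows "mat_trace (A * B) = mat_trace (B * A)"
proof -
  have "mat_trace (A * B) = (\<Sum>i<d. \<Sum>l<d. A $$ (i, l) * B $$ (l, i))"
    using assms unfolding mat_trace_def by (intro sum.cong index_mult_mat_sum) auto
  also have "\<dots> = (\<Sum>l<d. \<Sum>i<d. B $$ (l, i) * A $$ (i, l))"
    by (subst sum.swap) (simp add: mult.commute)
  also have "\<dots> = mat_trace (B * A)"
    using assms unfolding mat_trace_def by (intro sum.cong index_mult_mat_sum[symmetric]) auto
  finally show ?thesis .
qed

lemma upper_triangular_power:
  fixes B :: "'a::comm_semiring_1 mat"
  assumes B: "B \<in> carrier_mat d d" "upper_triangular B"
  shows "(\<forall>i<d. \<forall>j<i. (B ^\<^sub>m k) $$ (i, j) = 0) \<and> (\<forall>i<d. (B ^\<^sub>m k) $$ (i, i) = B $$ (i, i) ^ k)"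
proof (induction k)
  case (Suc k)
  have power_carrier: "B ^\<^sub>m k \<in> carrier_mat d d" using B by simp
  have below_diagonal: "B $$ (i, j) = 0" if "i < d" "j < i" for i j
    using B that by (auto simp: upper_triangular_def)
  have summand: "(B ^\<^sub>m k) $$ (i, l) * B $$ (l, j) = (if l = i \<and> j = i then B $$ (i, i) ^ Suc k else 0)"
    if "i < d" "j \<le> i" "l < d" for i j l
  proof (cases "l < i")
    case True
    then show ?thesis using Suc that by auto
  next
    case False
    then show ?thesis
      using Suc that below_diagonal[of l j] by (cases "l = i"; cases "j = i") (auto simp: mult.commute)
  qed
  have "(B ^\<^sub>m Suc k) $$ (i, j) = (\<Sum>l<d. if l = i \<and> j = i then B $$ (i, i) ^ Suc k else 0)"
    if "i < d" "j \<le> i" for i j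
    using that summand unfolding pow_mat.simps
    by (subst index_mult_mat_sum[OF power_carrier B(1)]) (auto intro!: sum.cong)
  then show ?case by (auto simp: sum.delta)
qed (use B in auto)

lemma sum_proots_char_poly_power:
  fixes A :: "complex mat"
  assumes A: "A \<in> carrier_mat d d"
  shows "(\<Sum>z\<in>#proots (char_poly A). z ^ k) = mat_trace (A ^\<^sub>m k)"
proof -
  obtain as where as: "char_poly A = (\<Prod>a\<leftarrow>as. [:- a, 1:])" "length as = d"
    using char_poly_factorized[OF A] by blast
  obtain B P Q where "schur_decomposition A as = (B, P, Q)"
    by (cases "schur_decomposition A as")
  from schur_decomposition[OF A as(1) this]
  have sim: "similar_mat_wit A B P Q" and B: "upper_triangular B" "diag_mat B = as" by auto
  note wit = similar_mat_witD2[OF A sim]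
  have power_carrier: "B ^\<^sub>m k \<in> carrier_mat d d" using wit by simp
  have "mat_trace (A ^\<^sub>m k) = mat_trace (P * B ^\<^sub>m k * Q)"
    by (simp only: similar_mat_wit_pow_id[OF sim])
  also have "\<dots> = mat_trace (Q * (P * B ^\<^sub>m k))"
    using wit power_carrier by (intro mat_trace_mult_commute) auto
  also have "Q * (P * B ^\<^sub>m k) = (Q * P) * B ^\<^sub>m k"
    using wit power_carrier by (intro assoc_mult_mat[symmetric]) auto
  also have "\<dots> = B ^\<^sub>m k" using wit power_carrier by simp
  also have "mat_trace (B ^\<^sub>m k) = (\<Sum>i<d. B $$ (i, i) ^ k)"
    using upper_triangular_power[OF wit(5) B(1), of k] power_carrier
    unfolding mat_trace_def by (intro sum.cong) auto
  also have "\<dots> = (\<Sum>i<d. (as ! i) ^ k)"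
    using B(2) wit(5) by (intro sum.cong) (auto simp: diag_mat_def)
  also have "\<dots> = sum_list (map (\<lambda>z. z ^ k) as)"
    using as(2) by (simp add: sum_list_sum_nth lessThan_atLeast0)
  also have "\<dots> = (\<Sum>z\<in>#proots (char_poly A). z ^ k)"
    unfolding as(1) proots_linear_factors by (metis mset_map sum_mset_sum_list)
  finally show ?thesis ..
qed

lemma proots_char_poly_eigenvector:
  fixes A :: "complex mat"
  assumes A: "A \<in> carrier_mat d d" and z: "z \<in># proots (char_poly A)"
  obtains v where "\<exists>i<d. v i \<noteq> 0" "\<And>i. i < d \<Longrightarrow> (\<Sum>j<d. A $$ (i, j) * v j) = z * v i"
proof -
  have "char_poly A \<noteq> 0" using degree_monic_char_poly[OF A] by auto
  then have "poly (char_poly A) z = 0" using z by simp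
  then have "eigenvalue A z" using eigenvalue_root_char_poly[OF A] by simp
  then obtain v where v: "v \<in> carrier_vec d" "v \<noteq> 0\<^sub>v d" "A *\<^sub>v v = z \<cdot>\<^sub>v v"
    using A by (auto simp: eigenvalue_def eigenvector_def)
  show thesis
  proof (rule that[of "\<lambda>i. v $ i"])
    show "\<exists>i<d. v $ i \<noteq> 0"
      using v(1,2) by (metis carrier_vecD eq_vecI index_zero_vec)
    fix i assume i: "i < d"
    have "(A *\<^sub>v v) $ i = z * v $ i" using v i by simp
    then show "(\<Sum>j<d. A $$ (i, j) * v $ j) = z * v $ i"
      using A v(1) i by (simp add: scalar_prod_def lessThan_atLeast0)
  qed
qed

lemma norm_eigenvalue_le_row_sum:
  fixes A :: "complex mat"
  assumes A: "A \<in> carrier_mat d d" and z: "z \<in># proots (char_poly A)"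
    and R: "\<And>i. i < d \<Longrightarrow> (\<Sum>j<d. norm (A $$ (i, j))) \<le> R"
  shows "norm z \<le> R"
proof -
  obtain v where v: "\<exists>i<d. v i \<noteq> 0" "\<And>i. i < d \<Longrightarrow> (\<Sum>j<d. A $$ (i, j) * v j) = z * v i"
    using proots_char_poly_eigenvector[OF A z] by blast
  define m where "m = Max ((\<lambda>i. norm (v i)) ` {..<d})"
  have nonempty: "(\<lambda>i. norm (v i)) ` {..<d} \<noteq> {}" using v(1) by auto
  have norm_le: "norm (v i) \<le> m" if "i < d" for i unfolding m_def using that by (intro Max_ge) auto
  obtain i where i: "i < d" "m = norm (v i)"
    using Max_in[OF _ nonempty] unfolding m_def by auto
  have pos: "m > 0" using v(1) norm_le by (meson less_le_trans zero_less_norm_iff)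
  have "norm z * m = norm (\<Sum>j<d. A $$ (i, j) * v j)" using v(2)[OF i(1)] i by (simp add: norm_mult)
  also have "\<dots> \<le> (\<Sum>j<d. norm (A $$ (i, j)) * norm (v j))"
    by (rule order.trans[OF norm_sum]) (simp add: norm_mult)
  also have "\<dots> \<le> (\<Sum>j<d. norm (A $$ (i, j)) * m)"
    by (intro sum_mono mult_left_mono norm_le) auto
  also have "\<dots> \<le> R * m" using R[OF i(1)] pos by (simp add: sum_distrib_right[symmetric])
  finally show ?thesis using pos by simp
qed

lemma quadratic_form_le_row_sum:
  fixes b :: "'a \<Rightarrow> 'a \<Rightarrow> real" and x :: "'a \<Rightarrow> real"
  assumes nonneg: "\<And>i j. i \<in> I \<Longrightarrow> j \<in> I \<Longrightarrow> 0 \<le> b i j" and sym: "\<And>i j. i \<in> I \<Longrightarrow> j \<in> I \<Longrightarrow> b i j = b j i"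
    and rows: "\<And>i. i \<in> I \<Longrightarrow> (\<Sum>j\<in>I. b i j) \<le> D"
  shows "(\<Sum>i\<in>I. \<Sum>j\<in>I. b i j * (x i * x j)) \<le> D * (\<Sum>i\<in>I. (x i)\<^sup>2)"
proof -
  have "(\<Sum>i\<in>I. \<Sum>j\<in>I. b i j * (x i * x j)) \<le> (\<Sum>i\<in>I. \<Sum>j\<in>I. b i j * (((x i)\<^sup>2 + (x j)\<^sup>2) / 2))"
  proof (intro sum_mono mult_left_mono)
    show "x i * x j \<le> ((x i)\<^sup>2 + (x j)\<^sup>2) / 2" for i j
      using sum_squares_bound[of "x i" "x j"] by simp
  qed (use nonneg in auto)
  also have "\<dots> = ((\<Sum>i\<in>I. \<Sum>j\<in>I. b i j * (x i)\<^sup>2) + (\<Sum>i\<in>I. \<Sum>j\<in>I. b i j * (x j)\<^sup>2)) / 2"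
    by (simp add: distrib_left add_divide_distrib sum.distrib sum_divide_distrib)
  also have "(\<Sum>i\<in>I. \<Sum>j\<in>I. b i j * (x j)\<^sup>2) = (\<Sum>i\<in>I. \<Sum>j\<in>I. b i j * (x i)\<^sup>2)"
    by (subst sum.swap) (intro sum.cong refl, simp add: sym)
  also have "((\<Sum>i\<in>I. \<Sum>j\<in>I. b i j * (x i)\<^sup>2) + (\<Sum>i\<in>I. \<Sum>j\<in>I. b i j * (x i)\<^sup>2)) / 2
      = (\<Sum>i\<in>I. (\<Sum>j\<in>I. b i j) * (x i)\<^sup>2)"
    by (simp add: sum_distrib_right)
  also have "\<dots> \<le> (\<Sum>i\<in>I. D * (x i)\<^sup>2)"
    using rows by (intro sum_mono mult_right_mono) auto
  finally show ?thesis by (simp add: sum_distrib_left)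
qed

text \<open>Bendixson: \<open>2 i Im (v\<^sup>* A v) = v\<^sup>* (A - A\<^sup>T) v\<close> for a real matrix \<open>A\<close>.\<close>
lemma Im_eigenvalue_le_skew_row_sum:
  fixes A :: "real mat"
  assumes A: "A \<in> carrier_mat d d" and z: "z \<in># proots (char_poly (map_mat complex_of_real A))"
    and D: "\<And>i. i < d \<Longrightarrow> (\<Sum>j<d. \<bar>A $$ (i, j) - A $$ (j, i)\<bar>) \<le> D"
  shows "2 * \<bar>Im z\<bar> \<le> D"
proof -
  have "map_mat complex_of_real A \<in> carrier_mat d d" using A by simp
  from proots_char_poly_eigenvector[OF this z]
  obtain v where v: "\<exists>i<d. v i \<noteq> 0"
    "\<And>i. i < d \<Longrightarrow> (\<Sum>j<d. map_mat complex_of_real A $$ (i, j) * v j) = z * v i" by blast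
  let ?a = "\<lambda>i j. complex_of_real (A $$ (i, j))"
  define s where "s = (\<Sum>i<d. (norm (v i))\<^sup>2)"
  have s_pos: "s > 0"
  proof -
    obtain i where "i < d" "v i \<noteq> 0" using v(1) by blast
    then show ?thesis unfolding s_def by (intro sum_pos2[of _ i]) auto
  qed
  define q where "q = (\<Sum>i<d. \<Sum>j<d. cnj (v i) * (?a i j * v j))"
  have "q = (\<Sum>i<d. cnj (v i) * (z * v i))"
    unfolding q_def sum_distrib_left[symmetric] using A v(2) by (intro sum.cong refl) simp
  also have "\<dots> = z * of_real s"
    unfolding s_def of_real_sum sum_distrib_left complex_norm_square
    by (simp only: mult.commute mult.left_commute)
  finally have q: "q = z * of_real s" .
  have "cnj q = (\<Sum>i<d. \<Sum>j<d. v i * (?a i j * cnj (v j)))"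
    unfolding q_def by simp
  also have "\<dots> = (\<Sum>i<d. \<Sum>j<d. cnj (v i) * (?a j i * v j))"
    by (subst sum.swap) (simp add: mult.commute mult.left_commute)
  finally have skew: "q - cnj q = (\<Sum>i<d. \<Sum>j<d. cnj (v i) * (of_real (A $$ (i, j) - A $$ (j, i)) * v j))"
    unfolding q_def by (simp add: sum_subtractf[symmetric] algebra_simps)
  have "q - cnj q = \<i> * of_real (2 * Im z * s)"
    unfolding q by (simp add: complex_eq_iff)
  then have "2 * \<bar>Im z\<bar> * s = norm (q - cnj q)"
    using s_pos by (simp add: norm_mult abs_mult)
  also have "\<dots> \<le> (\<Sum>i<d. \<Sum>j<d. \<bar>A $$ (i, j) - A $$ (j, i)\<bar> * (norm (v i) * norm (v j)))"
    unfolding skew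
    by (intro order.trans[OF norm_sum] sum_mono) (simp add: norm_mult mult.left_commute del: of_real_diff)
  also have "\<dots> \<le> D * s"
    unfolding s_def using D by (intro quadratic_form_le_row_sum) (auto simp: abs_minus_commute)
  finally show ?thesis using s_pos by simp
qed

section \<open>The method of moments\<close>

definition mset_mean :: "('a \<Rightarrow> complex) \<Rightarrow> 'a multiset \<Rightarrow> complex" where
  "mset_mean f M = (\<Sum>z\<in>#M. f z) / of_nat (size M)"

definition box_mean :: "'a::euclidean_space set \<Rightarrow> ('a \<Rightarrow> complex) \<Rightarrow> complex" where
  "box_mean Q f = (1 / measure lborel Q) *\<^sub>R integral Q f"

lemma sum_mset_diff_distrib: "(\<Sum>z\<in>#M. f z - g z) = (\<Sum>z\<in>#M. f z) - (\<Sum>z\<in>#M. g z)"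
  for f :: "'a \<Rightarrow> 'b::ab_group_add"
  by (induction M) auto

lemma norm_mset_mean_diff_le:
  assumes "M \<noteq> {#}" "\<And>z. z \<in># M \<Longrightarrow> norm (f z - g z) \<le> e"
  shows "norm (mset_mean f M - mset_mean g M) \<le> e"
proof -
  have "norm (\<Sum>z\<in>#M. f z - g z) \<le> (\<Sum>z\<in>#M. norm (f z - g z))"
    by (induction M) (auto intro: order.trans[OF norm_triangle_ineq])
  also have "\<dots> \<le> (\<Sum>z\<in>#M. e)"
    using assms(2) by (rule sum_mset_mono)
  finally have "norm (\<Sum>z\<in>#M. f z - g z) / size M \<le> e"
    using assms(1) by (simp add: pos_divide_le_eq nonempty_has_size mult.commute)
  then show ?thesis
    by (simp add: mset_mean_def sum_mset_diff_distrib norm_divide flip: diff_divide_distrib)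
qed

lemma norm_box_mean_diff_le:
  assumes "measure lborel (cbox a b) > 0" "f integrable_on cbox a b" "g integrable_on cbox a b"
    and "\<And>x. x \<in> cbox a b \<Longrightarrow> norm (f x - g x) \<le> e"
  shows "norm (box_mean (cbox a b) f - box_mean (cbox a b) g) \<le> e"
proof -
  have "norm (integral (cbox a b) (\<lambda>x. f x - g x)) \<le> integral (cbox a b) (\<lambda>x. e)"
    using assms by (intro integral_norm_bound_integral integrable_diff) auto
  also have "\<dots> = measure lborel (cbox a b) * e" by simp
  finally show ?thesis
    using assms by (simp add: box_mean_def Henstock_Kurzweil_Integration.integral_diff pos_divide_le_eq
        mult.commute flip: scaleR_diff_right)
qed

lemma complex_poly_approximation:
  fixes f :: "real \<Rightarrow> complex"
  assumes "compact S" "continuous_on S f" "e > 0"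
  obtains p :: "complex poly" where "\<And>x. x \<in> S \<Longrightarrow> norm (f x - poly p (of_real x)) \<le> e"
proof -
  have real: "\<exists>p. \<forall>x\<in>S. \<bar>h x - poly p x\<bar> < e / 2" if h: "continuous_on S h" for h :: "real \<Rightarrow> real"
  proof -
    obtain g where g: "real_polynomial_function g" "\<And>x. x \<in> S \<Longrightarrow> \<bar>h x - g x\<bar> < e / 2"
      using Stone_Weierstrass_real_polynomial_function[OF assms(1) h half_gt_zero[OF assms(3)]] by blast
    then obtain a n where "g = (\<lambda>x. \<Sum>i\<le>n. a i * x ^ i)"
      unfolding real_polynomial_function_iff_sum by blast
    then have "g x = poly (\<Sum>i\<le>n. monom (a i) i) x" for x
      by (simp add: poly_sum poly_monom)
    then show ?thesis using g(2) by metis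
  qed
  obtain p where p: "\<And>x. x \<in> S \<Longrightarrow> \<bar>Re (f x) - poly p x\<bar> < e / 2"
    using real[OF continuous_on_Re[OF assms(2)]] by blast
  obtain q where q: "\<And>x. x \<in> S \<Longrightarrow> \<bar>Im (f x) - poly q x\<bar> < e / 2"
    using real[OF continuous_on_Im[OF assms(2)]] by blast
  show thesis
  proof (rule that)
    fix x assume "x \<in> S"
    let ?p = "map_poly complex_of_real p + [:\<i>:] * map_poly complex_of_real q"
    have "poly ?p (of_real x) = Complex (poly p x) (poly q x)"
      by (simp add: complex_eq_iff)
    then have "norm (f x - poly ?p (of_real x)) \<le> \<bar>Re (f x) - poly p x\<bar> + \<bar>Im (f x) - poly q x\<bar>"
      using cmod_le[of "f x - poly ?p (of_real x)"] by simp
    also have "\<dots> \<le> e" using p q \<open>x \<in> S\<close> by fastforce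
    finally show "norm (f x - poly ?p (of_real x)) \<le> e" .
  qed
qed

lemma poly_approximation_near_real_axis:
  fixes F :: "complex \<Rightarrow> complex"
  assumes F: "continuous_on UNIV F" and e: "e > 0"
  obtains p \<delta> where "\<delta> > 0" "\<And>z. norm z \<le> R \<Longrightarrow> \<bar>Im z\<bar> < \<delta> \<Longrightarrow> norm (F z - poly p z) \<le> e"
proof -
  have "continuous_on {-R..R} (\<lambda>x. F (of_real x))"
    by (rule continuous_on_compose2[OF F]) (auto intro!: continuous_intros)
  then obtain p where p: "\<And>x. x \<in> {-R..R} \<Longrightarrow> norm (F (of_real x) - poly p (of_real x)) \<le> e / 2"
    using complex_poly_approximation[of "{-R..R}" "\<lambda>x. F (of_real x)" "e / 2"] e by auto
  have "uniformly_continuous_on (cball 0 R) (\<lambda>z. F z - poly p z)"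
    by (intro compact_uniformly_continuous continuous_intros continuous_on_subset[OF F]) auto
  then obtain \<delta> where \<delta>: "\<delta> > 0" "\<And>x y. x \<in> cball 0 R \<Longrightarrow> y \<in> cball 0 R \<Longrightarrow> dist x y < \<delta>
      \<Longrightarrow> dist (F x - poly p x) (F y - poly p y) < e / 2"
    unfolding uniformly_continuous_on_def using e by (metis half_gt_zero)
  show thesis
  proof (rule that[OF \<delta>(1)])
    fix z assume z: "norm z \<le> R" "\<bar>Im z\<bar> < \<delta>"
    let ?x = "complex_of_real (Re z)"
    have "\<bar>Re z\<bar> \<le> R" using abs_Re_le_cmod[of z] z by linarith
    moreover have "z - ?x = \<i> * of_real (Im z)" by (simp add: complex_eq_iff)
    then have "dist z ?x < \<delta>" using z by (simp add: dist_norm norm_mult)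
    ultimately have "norm ((F z - poly p z) - (F ?x - poly p ?x)) < e / 2" "norm (F ?x - poly p ?x) \<le> e / 2"
      using z \<delta>(2)[of z ?x] p[of "Re z"] unfolding dist_norm by (auto simp: abs_le_iff)
    then show "norm (F z - poly p z) \<le> e"
      using norm_triangle_sub[of "F z - poly p z" "F ?x - poly p ?x"] by linarith
  qed
qed

lemma tendsto_approx:
  fixes x :: "'a \<Rightarrow> 'b::metric_space"
  assumes "\<And>e. e > 0 \<Longrightarrow> \<exists>y m. (y \<longlongrightarrow> m) F \<and> (\<forall>\<^sub>F n in F. dist (x n) (y n) \<le> e) \<and> dist l m \<le> e"
  shows "(x \<longlongrightarrow> l) F"
proof (rule tendstoI)
  fix e :: real assume "e > 0"
  then have "e / 4 > 0" by simp
  then obtain y m where y: "(y \<longlongrightarrow> m) F" "\<forall>\<^sub>F n in F. dist (x n) (y n) \<le> e / 4" "dist l m \<le> e / 4"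
    using assms by blast
  from tendstoD[OF y(1) \<open>e / 4 > 0\<close>] y(2) show "\<forall>\<^sub>F n in F. dist (x n) l < e"
  proof eventually_elim
    case (elim n)
    have "dist (x n) l \<le> dist (x n) (y n) + dist (y n) m + dist l m"
      using dist_triangle[of "x n" l "y n"] dist_triangle[of "y n" l m] by (simp add: dist_commute)
    then show ?case using elim y(3) \<open>e > 0\<close> by linarith
  qed
qed

lemma tendsto_mset_mean_poly:
  fixes M :: "nat \<Rightarrow> complex multiset" and g :: "'a::euclidean_space \<Rightarrow> real"
  assumes moments: "\<And>k. (\<lambda>n. mset_mean (\<lambda>z. z ^ k) (M n)) \<longlonglongrightarrow> box_mean (cbox a b) (\<lambda>\<theta>. of_real (g \<theta>) ^ k)"
    and g: "continuous_on (cbox a b) g"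
  shows "(\<lambda>n. mset_mean (poly p) (M n)) \<longlonglongrightarrow> box_mean (cbox a b) (\<lambda>\<theta>. poly p (of_real (g \<theta>)))"
proof -
  have "(\<lambda>n. \<Sum>i\<le>degree p. coeff p i * mset_mean (\<lambda>z. z ^ i) (M n))
      \<longlonglongrightarrow> (\<Sum>i\<le>degree p. coeff p i * box_mean (cbox a b) (\<lambda>\<theta>. of_real (g \<theta>) ^ i))"
    by (intro tendsto_intros moments)
  moreover have "(\<Sum>i\<le>degree p. coeff p i * mset_mean (\<lambda>z. z ^ i) N) = mset_mean (poly p) N" for N
  proof -
    have "(\<Sum>z\<in>#N. poly p z) = (\<Sum>i\<le>degree p. coeff p i * (\<Sum>z\<in>#N. z ^ i))"
      by (induction N) (auto simp: poly_altdef sum.distrib distrib_left)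
    then show ?thesis by (simp add: mset_mean_def sum_divide_distrib)
  qed
  moreover have "(\<Sum>i\<le>degree p. coeff p i * box_mean (cbox a b) (\<lambda>\<theta>. of_real (g \<theta>) ^ i))
      = box_mean (cbox a b) (\<lambda>\<theta>. poly p (of_real (g \<theta>)))"
  proof -
    have "integral (cbox a b) (\<lambda>\<theta>. poly p (of_real (g \<theta>)))
        = (\<Sum>i\<le>degree p. integral (cbox a b) (\<lambda>\<theta>. coeff p i * of_real (g \<theta>) ^ i))"
      unfolding poly_altdef by (intro integral_sum integrable_continuous continuous_intros g) auto
    then show ?thesis by (simp add: box_mean_def scaleR_sum_right)
  qed
  ultimately show ?thesis by simp
qed

theorem tendsto_mset_mean_of_moments:
  fixes M :: "nat \<Rightarrow> complex multiset" and g :: "'a::euclidean_space \<Rightarrow> real"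
  assumes nonempty: "\<forall>\<^sub>F n in sequentially. M n \<noteq> {#}"
    and bounded: "\<forall>\<^sub>F n in sequentially. \<forall>z\<in>#M n. norm z \<le> R"
    and Im: "\<And>e. e > 0 \<Longrightarrow> \<forall>\<^sub>F n in sequentially. \<forall>z\<in>#M n. \<bar>Im z\<bar> < e"
    and moments: "\<And>k. (\<lambda>n. mset_mean (\<lambda>z. z ^ k) (M n)) \<longlonglongrightarrow> box_mean (cbox a b) (\<lambda>\<theta>. of_real (g \<theta>) ^ k)"
    and box: "measure lborel (cbox a b) > 0" and g: "continuous_on (cbox a b) g" and F: "continuous_on UNIV F"
  shows "(\<lambda>n. mset_mean F (M n)) \<longlonglongrightarrow> box_mean (cbox a b) (\<lambda>\<theta>. F (of_real (g \<theta>)))"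
proof (rule tendsto_approx)
  fix e :: real assume e: "e > 0"
  have int: "(\<lambda>\<theta>. h (complex_of_real (g \<theta>))) integrable_on cbox a b" if "continuous_on UNIV h"
      for h :: "complex \<Rightarrow> complex"
    by (intro integrable_continuous continuous_on_compose2[OF that] continuous_intros g) auto
  obtain G where G: "\<And>\<theta>. \<theta> \<in> cbox a b \<Longrightarrow> \<bar>g \<theta>\<bar> \<le> G"
    using compact_imp_bounded[OF compact_continuous_image[OF g compact_cbox]] by (auto simp: bounded_iff)
  obtain p \<delta> where p: "\<delta> > 0" "\<And>z. norm z \<le> max R G \<Longrightarrow> \<bar>Im z\<bar> < \<delta> \<Longrightarrow> norm (F z - poly p z) \<le> e"
    using poly_approximation_near_real_axis[OF F e] by blast
  have "(\<lambda>n. mset_mean (poly p) (M n)) \<longlonglongrightarrow> box_mean (cbox a b) (\<lambda>\<theta>. poly p (of_real (g \<theta>)))"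
    by (rule tendsto_mset_mean_poly[OF moments g])
  moreover have "\<forall>\<^sub>F n in sequentially. dist (mset_mean F (M n)) (mset_mean (poly p) (M n)) \<le> e"
    using nonempty bounded Im[OF p(1)] unfolding dist_norm
    by eventually_elim (intro norm_mset_mean_diff_le p(2), auto)
  moreover have "dist (box_mean (cbox a b) (\<lambda>\<theta>. F (of_real (g \<theta>))))
      (box_mean (cbox a b) (\<lambda>\<theta>. poly p (of_real (g \<theta>)))) \<le> e"
    unfolding dist_norm
  proof (intro norm_box_mean_diff_le box int F)
    show "norm (F (of_real (g \<theta>)) - poly p (of_real (g \<theta>))) \<le> e" if "\<theta> \<in> cbox a b" for \<theta>
      using G[OF that] p(1) by (intro p(2)) auto
  qed (intro continuous_intros)
  ultimately show "\<exists>y m. y \<longlonglongrightarrow> m \<and> (\<forall>\<^sub>F n in sequentially. dist (mset_mean F (M n)) (y n) \<le> e)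
      \<and> dist (box_mean (cbox a b) (\<lambda>\<theta>. F (of_real (g \<theta>)))) m \<le> e" by blast
qed

section \<open>Eigenvalue distribution of Toeplitz sequences\<close>

context toeplitz_sequence
begin

lemma size_eigvals: "size (eigvals (A n)) = d n"
  using degree_monic_char_poly[of "map_mat complex_of_real (A n)" "d n"] carrier[of n]
  by (simp add: eigvals_def size_proots_complex)

lemma sum_eigvals_power: "(\<Sum>z\<in>#eigvals (A n). z ^ k) = of_real (mat_trace (A n ^\<^sub>m k))"
proof -
  let ?Ac = "map_mat complex_of_real (A n)"
  have complex_carrier: "?Ac \<in> carrier_mat (d n) (d n)" using carrier by simp
  have "?Ac ^\<^sub>m k = map_mat complex_of_real (A n ^\<^sub>m k)"
    by (rule of_real_hom.mat_hom_pow[OF carrier, symmetric])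
  then show ?thesis
    unfolding eigvals_def sum_proots_char_poly_power[OF complex_carrier]
    using carrier_matD[OF pow_carrier_mat[OF carrier]] by (simp add: mat_trace_def)
qed

lemma eigvals_moments_tendsto:
  "(\<lambda>n. mset_mean (\<lambda>z. z ^ k) (eigvals (A n))) \<longlonglongrightarrow> of_real (conv_pow a W k 0)"
  using tendsto_of_real[OF trace_power_tendsto[of k], where 'a = complex]
  by (simp add: mset_mean_def size_eigvals sum_eigvals_power)

lemma eigvals_bounded:
  obtains R where "\<forall>\<^sub>F n in sequentially. \<forall>z\<in>#eigvals (A n). norm z \<le> R"
proof -
  obtain R where R: "\<forall>\<^sub>F n in sequentially. \<forall>r<d n. (\<Sum>s<d n. \<bar>A n $$ (r, s)\<bar>) \<le> R"
    using row_column_sums_bounded by blast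
  have "\<forall>\<^sub>F n in sequentially. \<forall>z\<in>#eigvals (A n). norm z \<le> R"
    using R
  proof eventually_elim
    case (elim n)
    then show ?case
      using carrier[of n] unfolding eigvals_def
      by (intro ballI norm_eigenvalue_le_row_sum[where d = "d n"]) auto
  qed
  then show thesis by (rule that)
qed

lemma eigvals_Im_small:
  assumes sym: "asymp_symmetric d A" and e: "e > 0"
  shows "\<forall>\<^sub>F n in sequentially. \<forall>z\<in>#eigvals (A n). \<bar>Im z\<bar> < e"
proof -
  define \<epsilon> where "\<epsilon> = e / (card W + 1)"
  have \<epsilon>: "\<epsilon> > 0" "card W * \<epsilon> < e" using e by (simp_all add: \<epsilon>_def field_simps)
  have "\<forall>\<^sub>F n in sequentially. \<forall>r<d n. \<forall>s<d n. \<bar>A n $$ (r, s) - A n $$ (s, r)\<bar> < \<epsilon>"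
    using tendstoD[OF sym[unfolded asymp_symmetric_def] \<epsilon>(1)]
    by (simp add: eventually_entries entry_def transpose_index_def)
  then show ?thesis using eventually_banded
  proof eventually_elim
    case (elim n)
    have rows: "(\<Sum>j<d n. \<bar>A n $$ (i, j) - A n $$ (j, i)\<bar>) \<le> real (2 * card W) * \<epsilon>" if i: "i < d n" for i
    proof (rule sum_le_card_mult)
      let ?P = "\<lambda>j. pos n i - pos n j \<in> W \<or> pos n j - pos n i \<in> W"
      have "{j \<in> {..<d n}. ?P j}
          = {j \<in> {..<d n}. pos n i - pos n j \<in> W} \<union> {j \<in> {..<d n}. pos n j - pos n i \<in> W}" by blast
      then have "card {j \<in> {..<d n}. ?P j}
          \<le> card {j \<in> {..<d n}. pos n i - pos n j \<in> W} + card {j \<in> {..<d n}. pos n j - pos n i \<in> W}"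
        by (simp only: card_Un_le)
      then show "card {j \<in> {..<d n}. ?P j} \<le> 2 * card W"
        using card_band_le[where n = n, of i] by linarith
      show "\<bar>A n $$ (i, j) - A n $$ (j, i)\<bar> \<le> \<epsilon>" if "j \<in> {..<d n}" for j
        using elim(1) i that by (auto intro: less_imp_le)
    qed (use elim(2) \<epsilon>(1) i in auto)
    show ?case
    proof
      fix z assume "z \<in># eigvals (A n)"
      then have "2 * \<bar>Im z\<bar> \<le> real (2 * card W) * \<epsilon>"
        using rows carrier[of n] unfolding eigvals_def by (intro Im_eigenvalue_le_skew_row_sum) auto
      then show "\<bar>Im z\<bar> < e" using \<epsilon>(2) by simp
    qed
  qed
qed

end

subsection \<open>Fourier series on the torus\<close>

definition torus :: "(real \<times> real) set" where
  "torus = cbox (-pi, -pi) (pi, pi)"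

definition fourier_char :: "int \<times> int \<Rightarrow> real \<times> real \<Rightarrow> complex" where
  "fourier_char z \<theta> = cis (of_int (fst z) * fst \<theta>) * cis (of_int (snd z) * snd \<theta>)"

lemma content_torus: "measure lborel torus = 4 * pi\<^sup>2"
  by (simp add: torus_def content_Pair power2_eq_square)

lemma fourier_char_add: "fourier_char (z + w) \<theta> = fourier_char z \<theta> * fourier_char w \<theta>"
  by (simp add: fourier_char_def distrib_right flip: cis_mult)

lemma continuous_on_fourier_char [continuous_intros]: "continuous_on S (fourier_char z)"
  unfolding fourier_char_def cis_conv_exp by (intro continuous_intros)

lemma integral_cis_of_int:
  "integral {-pi..pi} (\<lambda>x. cis (of_int k * x)) = (if k = 0 then of_real (2 * pi) else 0)"
proof (cases "k = 0")
  case False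
  let ?f = "\<lambda>x. cis (of_int k * x) / (\<i> * of_int k)"
  have "((\<lambda>x. cis (of_int k * x)) has_integral (?f pi - ?f (-pi))) {-pi..pi}"
  proof (rule fundamental_theorem_of_calculus)
    fix x :: real
    have "((\<lambda>z. exp (\<i> * of_int k * z) / (\<i> * of_int k)) has_field_derivative exp (\<i> * of_int k * of_real x))
        (at (of_real x))"
      using False by (auto intro!: derivative_eq_intros)
    from has_vector_derivative_real_field[OF this]
    show "(?f has_vector_derivative cis (of_int k * x)) (at x within {-pi..pi})"
      by (simp add: cis_conv_exp mult.assoc)
  qed simp
  moreover have "cis (of_int k * pi) = cis (of_int k * - pi)"
    by (simp add: cis.ctr complex_eq_iff sin_zero_iff_int2)
  ultimately show ?thesis using False by (simp add: integral_unique)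
qed (simp add: scaleR_conv_of_real)

lemma integral_fourier_char: "integral torus (fourier_char z) = (if z = 0 then of_real (4 * pi\<^sup>2) else 0)"
proof -
  have "integral torus (fourier_char z)
      = integral {-pi..pi} (\<lambda>x. integral {-pi..pi} (\<lambda>y. fourier_char z (x, y)))"
    using integral_prod_continuous[OF continuous_on_fourier_char] by (simp add: torus_def)
  also have "\<dots> = integral {-pi..pi} (\<lambda>x. cis (of_int (fst z) * x))
      * integral {-pi..pi} (\<lambda>y. cis (of_int (snd z) * y))"
    by (simp add: fourier_char_def)
  finally show ?thesis
    by (auto simp: integral_cis_of_int prod_eq_iff power2_eq_square)
qed

lemma conv_pow_eq_fourier_coefficient:
  assumes "finite W"
  shows "conv_pow a W k z
    = box_mean torus (\<lambda>\<theta>. (\<Sum>w\<in>W. a w * fourier_char w \<theta>) ^ k * fourier_char (- z) \<theta>)"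
proof (induction k arbitrary: z)
  case 0
  show ?case using integral_fourier_char[of "- z"]
    by (simp add: box_mean_def content_torus scaleR_conv_of_real)
next
  case (Suc k)
  let ?g = "\<lambda>\<theta>. \<Sum>w\<in>W. a w * fourier_char w \<theta>"
  have expand: "?g \<theta> ^ Suc k * fourier_char (- z) \<theta>
      = (\<Sum>w\<in>W. a w * (?g \<theta> ^ k * fourier_char (- (z - w)) \<theta>))" for \<theta>
  proof -
    have "fourier_char (- (z - w)) \<theta> = fourier_char w \<theta> * fourier_char (- z) \<theta>" for w
      using fourier_char_add[of w "- z" \<theta>] by simp
    then show ?thesis
      by (simp add: sum_distrib_right sum_distrib_left mult.assoc mult.commute mult.left_commute)
  qed
  have "integral torus (\<lambda>\<theta>. ?g \<theta> ^ Suc k * fourier_char (- z) \<theta>)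
     = (\<Sum>w\<in>W. a w * integral torus (\<lambda>\<theta>. ?g \<theta> ^ k * fourier_char (- (z - w)) \<theta>))"
    unfolding expand torus_def
    by (subst integral_sum) (auto intro!: assms integrable_continuous continuous_intros)
  then have "box_mean torus (\<lambda>\<theta>. ?g \<theta> ^ Suc k * fourier_char (- z) \<theta>)
      = (\<Sum>w\<in>W. a w * box_mean torus (\<lambda>\<theta>. ?g \<theta> ^ k * fourier_char (- (z - w)) \<theta>))"
    by (simp add: box_mean_def scaleR_sum_right)
  then show ?case unfolding Suc[symmetric] by (simp add: mult.commute)
qed

lemma of_real_conv_pow: "of_real (conv_pow a W k z) = conv_pow (\<lambda>w. of_real (a w)) W k z"
  by (induction k arbitrary: z) auto

theorem toeplitz_eigenvalue_distribution:
  fixes W :: "(int \<times> int) set" and g :: "real \<times> real \<Rightarrow> real"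
  assumes "toeplitz_sequence W pos d A a" and sym: "asymp_symmetric d A"
    and g: "\<And>\<theta>. complex_of_real (g \<theta>) = (\<Sum>w\<in>W. of_real (a w) * fourier_char w \<theta>)"
    and F: "continuous_on UNIV F"
  shows "(\<lambda>n. mset_mean F (eigvals (A n))) \<longlonglongrightarrow> box_mean torus (\<lambda>\<theta>. F (complex_of_real (g \<theta>)))"
proof -
  interpret toeplitz_sequence W pos d A a by fact
  obtain R where R: "\<forall>\<^sub>F n in sequentially. \<forall>z\<in>#eigvals (A n). norm z \<le> R"
    by (rule eigvals_bounded)
  have nonempty: "\<forall>\<^sub>F n in sequentially. eigvals (A n) \<noteq> {#}"
    using d_pos by eventually_elim (metis less_irrefl size_eigvals size_empty)
  have "continuous_on torus (\<lambda>\<theta>. Re (complex_of_real (g \<theta>)))"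
    unfolding g by (intro continuous_intros)
  then have cont: "continuous_on torus g" by simp
  have "of_real (conv_pow a W k 0) = box_mean torus (\<lambda>\<theta>. complex_of_real (g \<theta>) ^ k)" for k
    unfolding of_real_conv_pow conv_pow_eq_fourier_coefficient[OF finite_W]
    by (simp add: g fourier_char_def)
  then have moments: "(\<lambda>n. mset_mean (\<lambda>z. z ^ k) (eigvals (A n))) \<longlonglongrightarrow> box_mean torus (\<lambda>\<theta>. of_real (g \<theta>) ^ k)"
      for k
    using eigvals_moments_tendsto[of k] by simp
  show ?thesis
    unfolding torus_def
    by (rule tendsto_mset_mean_of_moments[OF nonempty R eigvals_Im_small[OF sym]])
      (use moments cont F content_torus in \<open>simp_all add: torus_def\<close>)
qed

section \<open>Kronecker products of Toeplitz sequences\<close>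

definition symmetric_toeplitz ::
    "'g::ab_group_add set \<Rightarrow> (nat \<Rightarrow> nat \<Rightarrow> 'g) \<Rightarrow> (nat \<Rightarrow> nat) \<Rightarrow> (nat \<Rightarrow> real mat) \<Rightarrow> ('g \<Rightarrow> real) \<Rightarrow> bool" where
  "symmetric_toeplitz W pos d A a \<longleftrightarrow>
    banded_bounded W pos d A \<and> asymp_toeplitz W pos d A a \<and> asymp_symmetric d A"

lemma Bfun_add:
  fixes f g :: "'a \<Rightarrow> 'b::real_normed_vector"
  assumes "Bfun f F" "Bfun g F"
  shows "Bfun (\<lambda>x. f x + g x) F"
proof -
  obtain K L where KL: "K > 0" "\<forall>\<^sub>F x in F. norm (f x) \<le> K" "L > 0" "\<forall>\<^sub>F x in F. norm (g x) \<le> L"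
    using assms by (auto elim!: BfunE)
  from KL(2,4) have "\<forall>\<^sub>F x in F. norm (f x + g x) \<le> K + L"
    by eventually_elim (rule norm_triangle_mono)
  then show ?thesis by (rule BfunI)
qed

lemma Bfun_mult:
  fixes f g :: "'a \<Rightarrow> 'b::real_normed_algebra"
  assumes "Bfun f F" "Bfun g F"
  shows "Bfun (\<lambda>x. f x * g x) F"
proof -
  obtain K L where KL: "K > 0" "\<forall>\<^sub>F x in F. norm (f x) \<le> K" "L > 0" "\<forall>\<^sub>F x in F. norm (g x) \<le> L"
    using assms by (auto elim!: BfunE)
  from KL(2,4) have "\<forall>\<^sub>F x in F. norm (f x * g x) \<le> K * L"
    by eventually_elim (use KL(1) in \<open>auto intro!: order.trans[OF norm_mult_ineq] mult_mono\<close>)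
  then show ?thesis by (rule BfunI)
qed

lemma Bfun_transform_eventually:
  fixes f g :: "'a \<Rightarrow> 'b::real_normed_vector"
  assumes "Bfun f F" "\<forall>\<^sub>F x in F. f x = g x"
  shows "Bfun g F"
proof -
  obtain K where "\<forall>\<^sub>F x in F. norm (f x) \<le> K" using assms(1) by (rule BfunE)
  with assms(2) have "\<forall>\<^sub>F x in F. norm (g x) \<le> K" by eventually_elim simp
  then show ?thesis by (rule BfunI)
qed

lemma filterlim_transpose_index: "filterlim transpose_index (entries d) (entries d)"
  by (auto simp: filterlim_iff eventually_entries transpose_index_def elim!: eventually_mono)

lemma entry_add:
  assumes "banded_bounded W pos d A" "banded_bounded W' pos' d B"
  shows "\<forall>\<^sub>F x in entries d. entry (\<lambda>n. A n + B n) x = entry A x + entry B x"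
  using banded_boundedD(1)[OF assms(1)] carrier_matD[OF banded_boundedD(1)[OF assms(2)]]
  by (simp add: eventually_entries entry_def)

lemma entry_smult:
  assumes "banded_bounded W pos d A"
  shows "\<forall>\<^sub>F x in entries d. entry (\<lambda>n. c n \<cdot>\<^sub>m A n) x = c (fst x) * entry A x"
  using carrier_matD[OF banded_boundedD(1)[OF assms]]
  by (simp add: eventually_entries entry_def)

lemma entry_cong:
  assumes "\<forall>\<^sub>F n in sequentially. A n = B n"
  shows "\<forall>\<^sub>F x in entries d. entry A x = entry B x"
  unfolding eventually_entries using assms by eventually_elim (simp add: entry_def)

lemma banded_bounded_cong:
  assumes A: "banded_bounded W pos d A" and eq: "\<forall>\<^sub>F n in sequentially. A n = B n"
    and carrier: "\<And>n. B n \<in> carrier_mat (d n) (d n)"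
  shows "banded_bounded W pos d B"
  unfolding banded_bounded_def
proof (intro conjI allI carrier)
  show "\<forall>\<^sub>F x in entries d. offset pos x \<notin> W \<longrightarrow> entry B x = 0"
    using banded_boundedD(2)[OF A] entry_cong[OF eq] by eventually_elim simp
  show "Bfun (entry B) (entries d)"
    by (rule Bfun_transform_eventually[OF banded_boundedD(3)[OF A] entry_cong[OF eq]])
qed

lemma banded_bounded_add:
  assumes "banded_bounded W pos d A" "banded_bounded W pos d B"
  shows "banded_bounded W pos d (\<lambda>n. A n + B n)"
  unfolding banded_bounded_def
proof (intro conjI allI)
  show "A n + B n \<in> carrier_mat (d n) (d n)" for n
    by (intro add_carrier_mat banded_boundedD(1)[OF assms(2)])
  show "\<forall>\<^sub>F x in entries d. offset pos x \<notin> W \<longrightarrow> entry (\<lambda>n. A n + B n) x = 0"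
    using entry_add[OF assms] banded_boundedD(2)[OF assms(1)] banded_boundedD(2)[OF assms(2)]
    by eventually_elim simp
  show "Bfun (entry (\<lambda>n. A n + B n)) (entries d)"
    by (rule Bfun_transform_eventually[OF
      Bfun_add[OF banded_boundedD(3)[OF assms(1)] banded_boundedD(3)[OF assms(2)]]])
      (use entry_add[OF assms] in \<open>eventually_elim, simp\<close>)
qed

lemma banded_bounded_smult:
  assumes "Bseq c" "banded_bounded W pos d A"
  shows "banded_bounded W pos d (\<lambda>n. c n \<cdot>\<^sub>m A n)"
  unfolding banded_bounded_def
proof (intro conjI allI)
  show "c n \<cdot>\<^sub>m A n \<in> carrier_mat (d n) (d n)" for n
    by (intro smult_carrier_mat banded_boundedD(1)[OF assms(2)])
  show "\<forall>\<^sub>F x in entries d. offset pos x \<notin> W \<longrightarrow> entry (\<lambda>n. c n \<cdot>\<^sub>m A n) x = 0"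
    using entry_smult[OF assms(2), of c] banded_boundedD(2)[OF assms(2)]
    by eventually_elim simp
  have "Bfun (\<lambda>x. c (fst x)) (entries d)"
    using assms(1) filterlim_fst_entries by (rule Bfun_filterlim_compose)
  then show "Bfun (entry (\<lambda>n. c n \<cdot>\<^sub>m A n)) (entries d)"
    by (rule Bfun_transform_eventually[OF Bfun_mult[OF _ banded_boundedD(3)[OF assms(2)]]])
      (use entry_smult[OF assms(2), of c] in \<open>eventually_elim, simp\<close>)
qed

lemma eventually_erodedI: "eventually P (entries d) \<Longrightarrow> eventually P (eroded_entries W pos d k)"
  using eroded_entries_le by (rule filter_leD)

lemma eventually_entries_transpose:
  "eventually P (entries d) \<Longrightarrow> \<forall>\<^sub>F x in entries d. P (transpose_index x)"
  by (rule eventually_compose_filterlim[OF _ filterlim_transpose_index])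

lemma symmetric_toeplitz_cong:
  assumes A: "symmetric_toeplitz W pos d A a" and eq: "\<forall>\<^sub>F n in sequentially. A n = B n"
    and carrier: "\<And>n. B n \<in> carrier_mat (d n) (d n)"
  shows "symmetric_toeplitz W pos d B a"
proof -
  note entry = entry_cong[OF eq, of d]
  have "((\<lambda>x. entry B x - a (offset pos x)) \<longlongrightarrow> 0) (eroded_entries W pos d 1)"
    by (rule Lim_transform_eventually[of "\<lambda>x. entry A x - a (offset pos x)"])
      (use A eventually_erodedI[OF entry] in \<open>auto simp: symmetric_toeplitz_def asymp_toeplitz_def
          elim: eventually_mono\<close>)
  moreover have "((\<lambda>x. entry B x - entry B (transpose_index x)) \<longlongrightarrow> 0) (entries d)"
    by (rule Lim_transform_eventually[of "\<lambda>x. entry A x - entry A (transpose_index x)"])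
      (use A eventually_conj[OF entry eventually_entries_transpose[OF entry]]
        in \<open>auto simp: symmetric_toeplitz_def asymp_symmetric_def elim: eventually_mono\<close>)
  ultimately show ?thesis
    using banded_bounded_cong[OF _ eq carrier, of W pos] A
    by (simp add: symmetric_toeplitz_def asymp_toeplitz_def asymp_symmetric_def)
qed

lemma symmetric_toeplitz_add:
  assumes A: "symmetric_toeplitz W pos d A a" and B: "symmetric_toeplitz W pos d B b"
  shows "symmetric_toeplitz W pos d (\<lambda>n. A n + B n) (\<lambda>z. a z + b z)"
proof -
  have banded: "banded_bounded W pos d A" "banded_bounded W pos d B"
    using A B by (simp_all add: symmetric_toeplitz_def)
  note sum = entry_add[OF banded]
  have "((\<lambda>x. (entry A x - a (offset pos x)) + (entry B x - b (offset pos x))) \<longlongrightarrow> 0)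
      (eroded_entries W pos d 1)"
    using A B by (intro tendsto_add_zero) (simp_all add: symmetric_toeplitz_def asymp_toeplitz_def)
  then have "asymp_toeplitz W pos d (\<lambda>n. A n + B n) (\<lambda>z. a z + b z)"
    unfolding asymp_toeplitz_def
    by (rule Lim_transform_eventually) (use eventually_erodedI[OF sum] in \<open>eventually_elim, simp\<close>)
  moreover have "((\<lambda>x. (entry A x - entry A (transpose_index x)) + (entry B x - entry B (transpose_index x)))
      \<longlongrightarrow> 0) (entries d)"
    using A B by (intro tendsto_add_zero) (simp_all add: symmetric_toeplitz_def asymp_symmetric_def)
  then have "asymp_symmetric d (\<lambda>n. A n + B n)"
    unfolding asymp_symmetric_def
    by (rule Lim_transform_eventually)
      (use sum eventually_entries_transpose[OF sum] in \<open>eventually_elim, simp\<close>)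
  ultimately show ?thesis
    using banded_bounded_add[OF banded] by (simp add: symmetric_toeplitz_def)
qed

lemma symmetric_toeplitz_smult:
  assumes A: "symmetric_toeplitz W pos d A a"
  shows "symmetric_toeplitz W pos d (\<lambda>n. c \<cdot>\<^sub>m A n) (\<lambda>z. c * a z)"
proof -
  have banded: "banded_bounded W pos d A"
    using A by (simp add: symmetric_toeplitz_def)
  note scaled = entry_smult[OF banded, of "\<lambda>_. c"]
  have "((\<lambda>x. c * (entry A x - a (offset pos x))) \<longlongrightarrow> 0) (eroded_entries W pos d 1)"
    using A by (intro tendsto_mult_right_zero) (simp add: symmetric_toeplitz_def asymp_toeplitz_def)
  then have "asymp_toeplitz W pos d (\<lambda>n. c \<cdot>\<^sub>m A n) (\<lambda>z. c * a z)"
    unfolding asymp_toeplitz_def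
    by (rule Lim_transform_eventually)
      (use eventually_erodedI[OF scaled] in \<open>eventually_elim, simp add: right_diff_distrib\<close>)
  moreover have "((\<lambda>x. c * (entry A x - entry A (transpose_index x))) \<longlongrightarrow> 0) (entries d)"
    using A by (intro tendsto_mult_right_zero) (simp add: symmetric_toeplitz_def asymp_symmetric_def)
  then have "asymp_symmetric d (\<lambda>n. c \<cdot>\<^sub>m A n)"
    unfolding asymp_symmetric_def
    by (rule Lim_transform_eventually)
      (use scaled eventually_entries_transpose[OF scaled] in \<open>eventually_elim, simp add: right_diff_distrib\<close>)
  ultimately show ?thesis
    using banded_bounded_smult[OF _ banded] by (simp add: symmetric_toeplitz_def)
qed

lemma symmetric_toeplitz_vanishing:
  assumes c: "c \<longlonglongrightarrow> 0" and A: "banded_bounded W pos d A"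
  shows "symmetric_toeplitz W pos d (\<lambda>n. c n \<cdot>\<^sub>m A n) (\<lambda>_. 0)"
proof -
  note scaled = entry_smult[OF A, of c]
  have "((\<lambda>x. c (fst x)) \<longlongrightarrow> 0) (entries d)"
    using c filterlim_fst_entries by (rule filterlim_compose)
  then have "((\<lambda>x. c (fst x) * entry A x) \<longlongrightarrow> 0) (entries d)"
    using banded_boundedD(3)[OF A]
    by (simp add: tendsto_Zfun_iff bounded_bilinear.Zfun_prod_Bfun[OF bounded_bilinear_mult])
  then have small: "(entry (\<lambda>n. c n \<cdot>\<^sub>m A n) \<longlongrightarrow> 0) (entries d)"
    by (rule Lim_transform_eventually) (use scaled in \<open>eventually_elim, simp\<close>)
  then have "asymp_toeplitz W pos d (\<lambda>n. c n \<cdot>\<^sub>m A n) (\<lambda>_. 0)"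
    unfolding asymp_toeplitz_def using tendsto_mono[OF eroded_entries_le] by simp
  moreover have "asymp_symmetric d (\<lambda>n. c n \<cdot>\<^sub>m A n)"
    unfolding asymp_symmetric_def
    using tendsto_diff[OF small filterlim_compose[OF small filterlim_transpose_index]] by simp
  moreover have "Bseq c" using c by (intro convergent_imp_Bseq convergentI)
  ultimately show ?thesis
    using banded_bounded_smult[OF _ A] by (simp add: symmetric_toeplitz_def)
qed

subsection \<open>Rectangular grids\<close>

definition grid_pos :: "(nat \<Rightarrow> nat) \<Rightarrow> nat \<Rightarrow> nat \<Rightarrow> int \<times> int" where
  "grid_pos N n r = (int (r div N n), int (r mod N n))"

definition row_block :: "(nat \<Rightarrow> nat) \<Rightarrow> nat \<times> nat \<times> nat \<Rightarrow> nat \<times> nat \<times> nat" where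
  "row_block N = (\<lambda>(n, r, s). (n, r div N n, s div N n))"

definition within_block :: "(nat \<Rightarrow> nat) \<Rightarrow> nat \<times> nat \<times> nat \<Rightarrow> nat \<times> nat \<times> nat" where
  "within_block N = (\<lambda>(n, r, s). (n, r mod N n, s mod N n))"

lemma inj_grid_pos: "inj_on (grid_pos N n) S"
  by (rule inj_onI, simp add: grid_pos_def, metis mod_mult_div_eq)

lemma grid_pos_div_mod_less:
  assumes "r < M * N"
  shows "r div N < M" "r mod N < (N::nat)"
  using assms by (cases "N = 0"; simp add: less_mult_imp_div_less)+

lemma grid_pos_image: "grid_pos N n ` {..<M * N n} = int ` {..<M} \<times> int ` {..<N n}"
proof
  show "grid_pos N n ` {..<M * N n} \<subseteq> int ` {..<M} \<times> int ` {..<N n}"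
    using grid_pos_div_mod_less by (auto simp: grid_pos_def)
  show "int ` {..<M} \<times> int ` {..<N n} \<subseteq> grid_pos N n ` {..<M * N n}"
  proof
    fix z assume "z \<in> int ` {..<M} \<times> int ` {..<N n}"
    then obtain x y where z: "z = (int x, int y)" and xy: "x < M" "y < N n" by auto
    have "x * N n + y < Suc x * N n" using xy by simp
    also have "\<dots> \<le> M * N n" using xy by (intro mult_right_mono) auto
    finally have "x * N n + y < M * N n" .
    moreover have "grid_pos N n (x * N n + y) = (int x, int y)" using xy by (simp add: grid_pos_def)
    ultimately show "z \<in> grid_pos N n ` {..<M * N n}" unfolding z by (metis imageI lessThan_iff)
  qed
qed

lemma erosion_Times:
  assumes "V \<noteq> {}" "W \<noteq> {}"
  shows "erosion (V \<times> W) (S \<times> T) = erosion V S \<times> erosion W T"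
  using assms by (auto simp: erosion_def)

lemma filterlim_grid_blocks:
  fixes M N :: "nat \<Rightarrow> nat"
  assumes "V \<noteq> {}" "W \<noteq> {}"
  defines "G \<equiv> eroded_entries (V \<times> W) (grid_pos N) (\<lambda>n. M n * N n) 1"
  shows "filterlim (row_block N) (eroded_entries V (\<lambda>_. int) M 1) G"
    "filterlim (within_block N) (eroded_entries W (\<lambda>_. int) N 1) G"
proof -
  have "int (s div N n) \<in> erosion V (int ` {..<M n})" "int (s mod N n) \<in> erosion W (int ` {..<N n})"
    if "grid_pos N n s \<in> (erosion (V \<times> W) ^^ 1) (grid_pos N n ` {..<M n * N n})" for n s
    using that unfolding grid_pos_image by (simp_all add: erosion_Times[OF assms(1,2)] grid_pos_def)
  then show "filterlim (row_block N) (eroded_entries V (\<lambda>_. int) M 1) G"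
    "filterlim (within_block N) (eroded_entries W (\<lambda>_. int) N 1) G"
    unfolding G_def row_block_def within_block_def
    by (intro filterlim_eroded_entries filterlim_ident always_eventually allI impI;
        simp add: grid_pos_div_mod_less)+
qed

lemma filterlim_entries_grid_blocks:
  "filterlim (row_block N) (entries M) (entries (\<lambda>n. M n * N n))"
  "filterlim (within_block N) (entries N) (entries (\<lambda>n. M n * N n))"
  by (auto simp: filterlim_iff eventually_entries row_block_def within_block_def grid_pos_div_mod_less
      elim!: eventually_mono)

lemma offset_grid_pos:
  "offset (grid_pos N) x = (offset (\<lambda>_. int) (row_block N x), offset (\<lambda>_. int) (within_block N x))"
  by (simp add: offset_def grid_pos_def row_block_def within_block_def case_prod_unfold)

lemma block_transpose:
  "row_block N (transpose_index x) = transpose_index (row_block N x)"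
  "within_block N (transpose_index x) = transpose_index (within_block N x)"
  by (simp_all add: row_block_def within_block_def transpose_index_def case_prod_unfold)

lemma entry_kron:
  assumes "\<And>n. X n \<in> carrier_mat (M n) (M n)" "\<And>n. Y n \<in> carrier_mat (N n) (N n)"
  shows "\<forall>\<^sub>F x in entries (\<lambda>n. M n * N n).
    entry (\<lambda>n. kron (X n) (Y n)) x = entry X (row_block N x) * entry Y (within_block N x)"
  using carrier_matD[OF assms(1)] carrier_matD[OF assms(2)]
  by (simp add: eventually_entries entry_def kron_def row_block_def within_block_def)

lemma banded_bounded_kron:
  assumes X: "banded_bounded V (\<lambda>_. int) M X" and Y: "banded_bounded W (\<lambda>_. int) N Y"
  shows "banded_bounded (V \<times> W) (grid_pos N) (\<lambda>n. M n * N n) (\<lambda>n. kron (X n) (Y n))"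
  unfolding banded_bounded_def
proof (intro conjI allI)
  let ?d = "\<lambda>n. M n * N n"
  note kron = entry_kron[OF banded_boundedD(1)[OF X] banded_boundedD(1)[OF Y]]
  show "kron (X n) (Y n) \<in> carrier_mat (?d n) (?d n)" for n
    using banded_boundedD(1)[OF X, of n] banded_boundedD(1)[OF Y, of n] by (simp add: kron_def)
  show "\<forall>\<^sub>F x in entries ?d. offset (grid_pos N) x \<notin> V \<times> W \<longrightarrow> entry (\<lambda>n. kron (X n) (Y n)) x = 0"
    using kron eventually_compose_filterlim[OF banded_boundedD(2)[OF X]
      filterlim_entries_grid_blocks(1)[of N M]]
      eventually_compose_filterlim[OF banded_boundedD(2)[OF Y] filterlim_entries_grid_blocks(2)[of N M]]
    by eventually_elim (auto simp: offset_grid_pos)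
  have "Bfun (\<lambda>x. entry X (row_block N x)) (entries ?d)" "Bfun (\<lambda>x. entry Y (within_block N x)) (entries ?d)"
    by (intro Bfun_filterlim_compose[OF banded_boundedD(3)[OF X]]
      Bfun_filterlim_compose[OF banded_boundedD(3)[OF Y]]
        filterlim_entries_grid_blocks)+
  from Bfun_mult[OF this] show "Bfun (entry (\<lambda>n. kron (X n) (Y n))) (entries ?d)"
    by (rule Bfun_transform_eventually) (use kron in \<open>eventually_elim, simp\<close>)
qed

lemma symmetric_toeplitz_kron:
  assumes X: "symmetric_toeplitz V (\<lambda>_. int) M X a" and Y: "symmetric_toeplitz W (\<lambda>_. int) N Y b"
    and ne: "V \<noteq> {}" "W \<noteq> {}"
  shows "symmetric_toeplitz (V \<times> W) (grid_pos N) (\<lambda>n. M n * N n) (\<lambda>n. kron (X n) (Y n))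
    (\<lambda>z. a (fst z) * b (snd z))"
proof -
  let ?d = "\<lambda>n. M n * N n" and ?Z = "\<lambda>n. kron (X n) (Y n)"
  have banded: "banded_bounded V (\<lambda>_. int) M X" "banded_bounded W (\<lambda>_. int) N Y"
    using X Y by (simp_all add: symmetric_toeplitz_def)
  note kron = entry_kron[OF banded_boundedD(1)[OF banded(1)] banded_boundedD(1)[OF banded(2)]]
  have bounded: "Bfun (\<lambda>x. entry X (row_block N x)) (entries ?d)"
      "Bfun (\<lambda>x. entry Y (within_block N x)) (entries ?d)"
    by (intro Bfun_filterlim_compose[OF banded_boundedD(3)[OF banded(1)]]
      Bfun_filterlim_compose[OF banded_boundedD(3)[OF banded(2)]]
        filterlim_entries_grid_blocks)+
  have "((\<lambda>x. entry X (row_block N x) * entry Y (within_block N x)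
      - a (offset (\<lambda>_. int) (row_block N x)) * b (offset (\<lambda>_. int) (within_block N x))) \<longlongrightarrow> 0)
    (eroded_entries (V \<times> W) (grid_pos N) ?d 1)"
    using X Y filterlim_grid_blocks[OF ne, of N M] unfolding symmetric_toeplitz_def asymp_toeplitz_def
    by (intro tendsto_mult_diff_0 Bfun_mono[OF bounded(1) eroded_entries_le]
      Bfun_mono[OF bounded(2) eroded_entries_le])
      (auto dest: filterlim_compose)
  then have "asymp_toeplitz (V \<times> W) (grid_pos N) ?d ?Z (\<lambda>z. a (fst z) * b (snd z))"
    unfolding asymp_toeplitz_def
    by (rule Lim_transform_eventually)
      (use eventually_erodedI[OF kron] in \<open>eventually_elim, simp add: offset_grid_pos\<close>)
  moreover have "((\<lambda>x. entry X (row_block N x) * entry Y (within_block N x)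
      - entry X (transpose_index (row_block N x)) * entry Y (transpose_index (within_block N x)))
    \<longlongrightarrow> 0) (entries ?d)"
    using X Y filterlim_entries_grid_blocks[of N M] unfolding symmetric_toeplitz_def asymp_symmetric_def
    by (intro tendsto_mult_diff_0 bounded) (auto dest: filterlim_compose)
  then have "asymp_symmetric ?d ?Z"
    unfolding asymp_symmetric_def
    by (rule Lim_transform_eventually)
      (use kron eventually_entries_transpose[OF kron] in \<open>eventually_elim, simp add: block_transpose\<close>)
  ultimately show ?thesis
    using banded_bounded_kron[OF banded] by (simp add: symmetric_toeplitz_def)
qed

lemma grid_boundary_negligible:
  assumes "V \<noteq> {}" "W \<noteq> {}"
    and V: "(\<lambda>n. card (int ` {..<M n} - erosion V (int ` {..<M n})) / M n) \<longlonglongrightarrow> 0"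
    and W: "(\<lambda>n. card (int ` {..<N n} - erosion W (int ` {..<N n})) / N n) \<longlonglongrightarrow> 0"
  defines "\<Lambda> \<equiv> \<lambda>n. grid_pos N n ` {..<M n * N n}"
  shows "(\<lambda>n. card (\<Lambda> n - erosion (V \<times> W) (\<Lambda> n)) / real (M n * N n)) \<longlonglongrightarrow> 0"
proof (rule Lim_null_comparison)
  let ?S = "\<lambda>n. int ` {..<M n}" and ?T = "\<lambda>n. int ` {..<N n}"
  let ?\<rho> = "\<lambda>n. card (?S n - erosion V (?S n)) / M n + card (?T n - erosion W (?T n)) / N n"
  show "?\<rho> \<longlonglongrightarrow> 0" using tendsto_add[OF V W] by simp
  have "card (\<Lambda> n - erosion (V \<times> W) (\<Lambda> n)) / real (M n * N n) \<le> ?\<rho> n" for n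
  proof -
    have "\<Lambda> n - erosion (V \<times> W) (\<Lambda> n) \<subseteq> (?S n - erosion V (?S n)) \<times> ?T n \<union> ?S n \<times> (?T n - erosion W (?T n))"
      unfolding \<Lambda>_def grid_pos_image erosion_Times[OF assms(1,2)] by auto
    then have "card (\<Lambda> n - erosion (V \<times> W) (\<Lambda> n))
        \<le> card ((?S n - erosion V (?S n)) \<times> ?T n \<union> ?S n \<times> (?T n - erosion W (?T n)))"
      by (intro card_mono) auto
    also have "\<dots> \<le> card (?S n - erosion V (?S n)) * N n + M n * card (?T n - erosion W (?T n))"
      by (rule order.trans[OF card_Un_le]) (simp add: card_cartesian_product card_image)
    finally have "real (card (\<Lambda> n - erosion (V \<times> W) (\<Lambda> n)))
        \<le> real (card (?S n - erosion V (?S n)) * N n + M n * card (?T n - erosion W (?T n)))"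
      by (rule of_nat_mono)
    then have "card (\<Lambda> n - erosion (V \<times> W) (\<Lambda> n)) / real (M n * N n)
        \<le> real (card (?S n - erosion V (?S n)) * N n + M n * card (?T n - erosion W (?T n)))
          / real (M n * N n)"
      by (rule divide_right_mono) simp
    also have "\<dots> \<le> ?\<rho> n" by (simp add: add_divide_distrib)
    finally show ?thesis .
  qed
  then show "\<forall>\<^sub>F n in sequentially. norm (card (\<Lambda> n - erosion (V \<times> W) (\<Lambda> n)) / real (M n * N n)) \<le> ?\<rho> n"
    by simp
qed

lemma interval_boundary_negligible:
  assumes "filterlim N at_top sequentially"
  shows "(\<lambda>n. card (int ` {..<N n} - erosion {- int L..int L} (int ` {..<N n})) / N n) \<longlonglongrightarrow> 0"
proof (rule Lim_null_comparison)
  show "(\<lambda>n. real (2 * L) / real (N n)) \<longlonglongrightarrow> 0"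
    by (intro real_tendsto_divide_at_top[OF tendsto_const] filterlim_compose[OF filterlim_real_sequentially]
      assms)
  have "card (int ` {..<m} - erosion {- int L..int L} (int ` {..<m})) \<le> 2 * L" for m
  proof -
    have deep: "x \<in> erosion {- int L..int L} (int ` {..<m})" if "int L \<le> x" "x < int m - int L" for x
      using that by (auto simp: erosion_def image_iff intro!: bexI[of _ "nat _"])
    have "int ` {..<m} - erosion {- int L..int L} (int ` {..<m}) \<subseteq> int ` ({..<L} \<union> {m - L..<m})"
    proof
      fix x assume "x \<in> int ` {..<m} - erosion {- int L..int L} (int ` {..<m})"
      then obtain k where k: "x = int k" "k < m" "int k \<notin> erosion {- int L..int L} (int ` {..<m})" by auto
      then have "k \<in> {..<L} \<union> {m - L..<m}" using deep[of "int k"] by force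
      then show "x \<in> int ` ({..<L} \<union> {m - L..<m})" using k(1) by blast
    qed
    then have "card (int ` {..<m} - erosion {- int L..int L} (int ` {..<m}))
        \<le> card (int ` ({..<L} \<union> {m - L..<m}))"
      by (intro card_mono) auto
    also have "\<dots> \<le> card {..<L} + card {m - L..<m}"
      by (rule order.trans[OF card_image_le card_Un_le]) simp
    finally show ?thesis by simp
  qed
  then have "real (card (int ` {..<N n} - erosion {- int L..int L} (int ` {..<N n}))) \<le> real (2 * L)" for n
    by (rule of_nat_mono)
  then show "\<forall>\<^sub>F n in sequentially.
      norm (card (int ` {..<N n} - erosion {- int L..int L} (int ` {..<N n})) / N n)
        \<le> real (2 * L) / real (N n)"
    by (simp add: divide_right_mono)
qed

lemma toeplitz_sequence_grid:
  assumes A: "symmetric_toeplitz ({- int K..int K} \<times> {- int L..int L}) (grid_pos N) (\<lambda>n. M n * N n) A a"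
    and M: "filterlim M at_top sequentially" and N: "filterlim N at_top sequentially"
  shows "toeplitz_sequence ({- int K..int K} \<times> {- int L..int L}) (grid_pos N) (\<lambda>n. M n * N n) A a"
proof
  show "\<forall>\<^sub>F n in sequentially. M n * N n > 0"
    using eventually_compose_filterlim[OF eventually_gt_at_top[of 0] M]
      eventually_compose_filterlim[OF eventually_gt_at_top[of 0] N] by eventually_elim simp
  show "(\<lambda>n. card (grid_pos N n ` {..<M n * N n} - erosion ({- int K..int K} \<times> {- int L..int L})
      (grid_pos N n ` {..<M n * N n}))
      / real (M n * N n)) \<longlonglongrightarrow> 0"
    by (intro grid_boundary_negligible interval_boundary_negligible M N) auto
qed (use A inj_grid_pos in \<open>auto simp: symmetric_toeplitz_def\<close>)

lemma filterlim_reindex_entries: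
  assumes "filterlim \<phi> sequentially sequentially"
  shows "filterlim (\<lambda>(n, r, s). (\<phi> n, r, s)) (eroded_entries W (\<lambda>_. pos) d k)
    (eroded_entries W (\<lambda>_. pos) (\<lambda>n. d (\<phi> n)) k)"
  using assms by (rule filterlim_eroded_entries) simp

lemma banded_bounded_reindex:
  assumes \<phi>: "filterlim \<phi> sequentially sequentially" and A: "banded_bounded W (\<lambda>_. pos) d A"
  shows "banded_bounded W (\<lambda>_. pos) (\<lambda>n. d (\<phi> n)) (\<lambda>n. A (\<phi> n))"
  unfolding banded_bounded_def
proof (intro conjI allI)
  note lim = filterlim_reindex_entries[OF \<phi>, of W pos d 0, unfolded eroded_entries_0]
  show "A (\<phi> n) \<in> carrier_mat (d (\<phi> n)) (d (\<phi> n))" for n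
    by (rule banded_boundedD(1)[OF A])
  show "\<forall>\<^sub>F x in entries (\<lambda>n. d (\<phi> n)). offset (\<lambda>_. pos) x \<notin> W \<longrightarrow> entry (\<lambda>n. A (\<phi> n)) x = 0"
    using eventually_compose_filterlim[OF banded_boundedD(2)[OF A] lim]
    by (simp add: entry_def offset_def case_prod_unfold)
  show "Bfun (entry (\<lambda>n. A (\<phi> n))) (entries (\<lambda>n. d (\<phi> n)))"
    using Bfun_filterlim_compose[OF banded_boundedD(3)[OF A] lim]
    by (simp add: entry_def case_prod_unfold)
qed

lemma symmetric_toeplitz_reindex:
  assumes \<phi>: "filterlim \<phi> sequentially sequentially" and A: "symmetric_toeplitz W (\<lambda>_. pos) d A a"
  shows "symmetric_toeplitz W (\<lambda>_. pos) (\<lambda>n. d (\<phi> n)) (\<lambda>n. A (\<phi> n)) a"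
proof -
  have "((\<lambda>x. entry A x - a (offset (\<lambda>_. pos) x)) \<longlongrightarrow> 0) (eroded_entries W (\<lambda>_. pos) d 1)"
    "((\<lambda>x. entry A x - entry A (transpose_index x)) \<longlongrightarrow> 0) (entries d)"
    using A by (simp_all add: symmetric_toeplitz_def asymp_toeplitz_def asymp_symmetric_def)
  from filterlim_compose[OF this(1) filterlim_reindex_entries[OF \<phi>]]
    filterlim_compose[OF this(2) filterlim_reindex_entries[OF \<phi>, of W pos d 0, unfolded eroded_entries_0]]
  have "asymp_toeplitz W (\<lambda>_. pos) (\<lambda>n. d (\<phi> n)) (\<lambda>n. A (\<phi> n)) a"
      "asymp_symmetric (\<lambda>n. d (\<phi> n)) (\<lambda>n. A (\<phi> n))"
    by (simp_all add: asymp_toeplitz_def asymp_symmetric_def entry_def offset_def transpose_index_def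
      case_prod_unfold)
  then show ?thesis
    using banded_bounded_reindex[OF \<phi>, of W pos d A] A by (simp add: symmetric_toeplitz_def)
qed

section \<open>Gram matrices of asymptotically shifted profiles\<close>

lemma correlation_minus: "correlation f g (- y) = correlation g f y"
  unfolding correlation_def
  by (subst lborel_integral_real_affine[where c = 1 and t = y]) (auto simp: add.commute mult.commute)

lemma correlation_eq_0:
  assumes "\<And>t. t \<notin> {0..c} \<Longrightarrow> f t = 0" "\<And>t. t \<notin> {0..c} \<Longrightarrow> g t = 0" "c \<le> \<bar>y\<bar>"
  shows "correlation f g y = 0"
  unfolding correlation_def
proof (rule integral_eq_zero_AE)
  have "AE t in lborel. t \<noteq> (0::real)" "AE t in lborel. t \<noteq> c" by (rule AE_lborel_singleton)+
  then show "AE t in lborel. f t * g (t + y) = 0"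
  proof eventually_elim
    case (elim t)
    then have "t \<notin> {0..c} \<or> t + y \<notin> {0..c}" using assms(3) by auto
    then show ?case using assms(1,2) by auto
  qed
qed

definition profile :: "real \<Rightarrow> (real \<Rightarrow> real) \<Rightarrow> bool" where
  "profile c \<phi> \<longleftrightarrow> \<phi> \<in> borel_measurable borel \<and> (\<exists>B. \<forall>t. \<bar>\<phi> t\<bar> \<le> B) \<and> (\<forall>t. t \<notin> {0..c} \<longrightarrow> \<phi> t = 0)"

lemma integrable_mult_profile:
  assumes "profile c \<phi>" "profile c \<psi>"
  shows "integrable lborel (\<lambda>t. \<phi> t * \<psi> (t + y))"
proof -
  obtain B C where "\<And>t. \<bar>\<phi> t\<bar> \<le> B" "\<And>t. \<bar>\<psi> t\<bar> \<le> C"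
    using assms unfolding profile_def by auto
  moreover have "\<phi> \<in> borel_measurable borel" "(\<lambda>t. \<psi> (t + y)) \<in> borel_measurable borel"
    using assms unfolding profile_def by auto
  moreover have "\<phi> t = 0" if "t \<notin> {0..c}" for t using assms(1) that by (simp add: profile_def)
  ultimately show ?thesis by (intro integrable_mult_bounded_support)
qed

lemma integral_mult_profile_shifts:
  assumes n: "n > 0" and \<phi>: "profile c \<phi>" and \<psi>: "profile c \<psi>" and u: "0 \<le> u" "u + c \<le> n"
  shows "n * integral {0..1} (\<lambda>x. \<phi> (n * x - u) * \<psi> (n * x - v)) = correlation \<phi> \<psi> (u - v)"
proof -
  let ?F = "\<lambda>x. \<phi> (n * x - u) * \<psi> (n * x - v)"
  have "integrable lborel ?F"
    using lborel_integrable_real_affine[OF integrable_mult_profile[OF \<phi> \<psi>, of "u - v"], of n "- u"] n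
    by (simp add: algebra_simps)
  then have "(\<integral>x. ?F x \<partial>lborel) = integral UNIV ?F" by (simp add: integral_lborel)
  also have "\<dots> = integral UNIV (\<lambda>x. if x \<in> {0..1} then ?F x else 0)"
  proof (rule integral_cong)
    fix x :: real
    have "n * x - u \<notin> {0..c}" if "x \<notin> {0..1}"
    proof (cases "x < 0")
      case True
      then have "n * x < 0" using n by (simp add: mult_pos_neg)
      then show ?thesis using u(1) by simp
    next
      case False
      then have "n * 1 < n * x" using that n by (intro mult_strict_left_mono) auto
      then show ?thesis using u(2) by simp
    qed
    then show "?F x = (if x \<in> {0..1} then ?F x else 0)" using \<phi> by (auto simp: profile_def)
  qed
  also have "\<dots> = integral {0..1} ?F" by (rule integral_restrict_UNIV)
  finally have "n * integral {0..1} ?F = n * (\<integral>x. ?F x \<partial>lborel)" by simp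
  also have "\<dots> = correlation \<phi> \<psi> (u - v)"
    unfolding correlation_def using n
    by (subst lborel_integral_real_affine[where c = n and t = "- u"]) (simp_all add: algebra_simps)
  finally show ?thesis .
qed

definition gram :: "nat \<Rightarrow> (nat \<Rightarrow> real \<Rightarrow> real) \<Rightarrow> (nat \<Rightarrow> real \<Rightarrow> real) \<Rightarrow> nat \<Rightarrow> nat \<Rightarrow> real" where
  "gram n u v i j = real n * integral {0..1} (\<lambda>x. u j x * v i x)"

definition knot_localized :: "nat \<Rightarrow> nat \<Rightarrow> real \<Rightarrow> (nat \<Rightarrow> real \<Rightarrow> real) \<Rightarrow> bool" where
  "knot_localized n p C u \<longleftrightarrow> (\<forall>i. localized (knot n p i) (knot n p (i + p + 1)) C (u i))"

lemma knot_localizedD: "knot_localized n p C u \<Longrightarrow> localized (knot n p i) (knot n p (i + p + 1)) C (u i)"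
  by (simp add: knot_localized_def)

lemma knot_localized_bound_nonneg: "knot_localized n p C u \<Longrightarrow> 0 \<le> C"
  using knot_localizedD localized_bound_nonneg by blast

lemma gram_eq_0:
  assumes n: "n > 0" and u: "knot_localized n p B u" and v: "knot_localized n p C v"
    and ij: "int p < \<bar>int i - int j\<bar>"
  shows "gram n u v i j = 0"
proof -
  interpret open_knots "knot n p" by (rule open_knots_knot[OF n])
  consider (left) "i + p + 1 \<le> j" | (right) "j + p + 1 \<le> i" using ij by linarith
  then have "integral {0..1} (\<lambda>x. u j x * v i x) = 0"
  proof cases
    case left
    then show ?thesis
      using integral_mult_localized_disjoint[OF knot_localizedD[OF v] knot_localizedD[OF u] mono]
      by (simp add: mult.commute)
  next
    case right
    then show ?thesis
      using integral_mult_localized_disjoint[OF knot_localizedD[OF u] knot_localizedD[OF v] mono] by simp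
  qed
  then show ?thesis by (simp add: gram_def)
qed

lemma abs_gram_le:
  assumes n: "n > 0" and u: "knot_localized n p B u" and v: "knot_localized n p C v"
  shows "\<bar>gram n u v i j\<bar> \<le> B * C * real (p + 1)"
proof -
  interpret open_knots "knot n p" by (rule open_knots_knot[OF n])
  have nonneg_bound: "0 \<le> B * C" using u v knot_localized_bound_nonneg by auto
  have "\<bar>integral {0..1} (\<lambda>x. u j x * v i x)\<bar> \<le> B * C * (knot n p (j + p + 1) - knot n p j)"
    by (rule abs_integral_localized_le[OF localized_mult[OF knot_localizedD[OF u] knot_localizedD[OF v]]])
      (auto intro: mono)
  also have "\<dots> \<le> B * C * (real (p + 1) / real n)"
    using knot_diff_le[OF n, of p j "p + 1"] nonneg_bound by (intro mult_left_mono) (auto simp: add.assoc)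
  finally show ?thesis using n by (simp add: gram_def abs_mult pos_le_divide_eq mult.commute)
qed

lemma abs_gram_diff_le:
  assumes n: "n > 0" and u': "knot_localized n p B u'" and v: "knot_localized n p C v"
    and du: "knot_localized n p e (\<lambda>i x. u i x - u' i x)"
    and dv: "knot_localized n p e (\<lambda>i x. v i x - v' i x)"
  shows "\<bar>gram n u v i j - gram n u' v' i j\<bar> \<le> e * (B + C) * real (p + 1)"
proof -
  have int: "(\<lambda>x. f x * g x) integrable_on {0..1}"
    if "localized a b B f" "localized c d C g" for a b c d B C f g
    using localized_integrable_on[OF localized_mult[OF that]] by simp
  note left = int[OF knot_localizedD[OF du] knot_localizedD[OF v], of j i]
    and right = int[OF knot_localizedD[OF u'] knot_localizedD[OF dv], of j i]
  have "u j x * v i x = ((u j x - u' j x) * v i x + u' j x * (v i x - v' i x)) + u' j x * v' i x" for x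
    by (simp add: algebra_simps)
  moreover have "(\<lambda>x. u' j x * v' i x) integrable_on {0..1}"
    using integrable_diff[OF int[OF knot_localizedD[OF u'] knot_localizedD[OF v], of j i] right]
    by (simp add: algebra_simps)
  ultimately have "gram n u v i j - gram n u' v' i j
      = gram n (\<lambda>i x. u i x - u' i x) v i j + gram n u' (\<lambda>i x. v i x - v' i x) i j"
    using left right
    by (simp add: gram_def Henstock_Kurzweil_Integration.integral_add integrable_add distrib_left)
  also have "\<bar>\<dots>\<bar> \<le> e * C * real (p + 1) + B * e * real (p + 1)"
    using abs_gram_le[OF n du v, of i j] abs_gram_le[OF n u' dv, of i j] by linarith
  finally show ?thesis by (simp add: algebra_simps)
qed

text \<open>Near the boundary the limiting family \<open>w\<close> is only required to be bounded.\<close>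
definition asymp_shifts :: "nat \<Rightarrow> (real \<Rightarrow> real) \<Rightarrow> (nat \<Rightarrow> nat \<Rightarrow> real \<Rightarrow> real) \<Rightarrow> bool" where
  "asymp_shifts p \<phi> u \<longleftrightarrow> profile (real p + 1) \<phi> \<and> (\<exists>w C. (\<forall>n>0. knot_localized n p C (w n))
    \<and> (\<forall>n>0. \<forall>i\<in>{p + 1..n}. \<forall>x\<in>{0..1}. w n i x = \<phi> (real n * x - (real i - real p - 1)))
    \<and> (\<forall>e>0. \<forall>\<^sub>F n in sequentially. knot_localized n p e (\<lambda>i x. u n i x - w n i x)))"

lemma asymp_shifts_localized:
  assumes "asymp_shifts p \<phi> u"
  obtains C where "\<forall>\<^sub>F n in sequentially. knot_localized n p C (u n)"
proof -
  obtain w C where w: "\<forall>n>0. knot_localized n p C (w n)"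
    and close: "\<forall>e>0. \<forall>\<^sub>F n in sequentially. knot_localized n p e (\<lambda>i x. u n i x - w n i x)"
    using assms unfolding asymp_shifts_def by auto
  show thesis
  proof
    from close[rule_format, OF zero_less_one_class.zero_less_one] eventually_gt_at_top[of 0]
    show "\<forall>\<^sub>F n in sequentially. knot_localized n p (1 + C) (u n)"
    proof eventually_elim
      case (elim n)
      have "localized (knot n p i) (knot n p (i + p + 1)) (1 + C) (u n i)" for i
        using localized_add[OF knot_localizedD[OF elim(1)] knot_localizedD[OF w[rule_format, OF elim(2)]]]
        by fastforce
      then show ?case by (simp add: knot_localized_def)
    qed
  qed
qed

text \<open>The matrices have bandwidth \<open>p\<close>; the wider window keeps all neighbours of a position in its erosion
  clear of the splines that meet the boundary knots.\<close>
abbreviation band :: "nat \<Rightarrow> int set" where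
  "band p \<equiv> {- int (2 * p)..int (2 * p)}"

definition gram_mat :: "nat \<Rightarrow> nat \<Rightarrow> (nat \<Rightarrow> real \<Rightarrow> real) \<Rightarrow> (nat \<Rightarrow> real \<Rightarrow> real) \<Rightarrow> real mat" where
  "gram_mat n p u v = mat (n + p - 2) (n + p - 2) (\<lambda>(i, j). gram n u v (i + 2) (j + 2))"

lemma banded_bounded_gram_mat:
  assumes u: "asymp_shifts p \<phi> u" and v: "asymp_shifts p \<psi> v"
  shows "banded_bounded (band p) (\<lambda>_. int) (\<lambda>n. n + p - 2) (\<lambda>n. gram_mat n p (u n) (v n))"
  unfolding banded_bounded_def
proof (intro conjI allI)
  obtain B where B: "\<forall>\<^sub>F n in sequentially. knot_localized n p B (u n)" by (rule asymp_shifts_localized[OF u])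
  obtain C where C: "\<forall>\<^sub>F n in sequentially. knot_localized n p C (v n)" by (rule asymp_shifts_localized[OF v])
  show "gram_mat n p (u n) (v n) \<in> carrier_mat (n + p - 2) (n + p - 2)" for n
    by (simp add: gram_mat_def)
  show "\<forall>\<^sub>F x in entries (\<lambda>n. n + p - 2). offset (\<lambda>_. int) x \<notin> band p \<longrightarrow>
      entry (\<lambda>n. gram_mat n p (u n) (v n)) x = 0"
    unfolding eventually_entries using B C eventually_gt_at_top[of 0]
    by eventually_elim (auto simp: entry_def offset_def gram_mat_def intro!: gram_eq_0)
  have "\<forall>\<^sub>F n in sequentially. \<forall>r<n + p - 2. \<forall>s<n + p - 2. \<bar>gram_mat n p (u n) (v n) $$ (r, s)\<bar>
      \<le> B * C * real (p + 1)"
    using B C eventually_gt_at_top[of 0]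
    by eventually_elim (use abs_gram_le in \<open>fastforce simp: gram_mat_def\<close>)
  then show "Bfun (entry (\<lambda>n. gram_mat n p (u n) (v n))) (entries (\<lambda>n. n + p - 2))"
    unfolding entry_def Bfun_entries_iff by blast
qed

lemma gram_interior:
  assumes n: "n > 0" and \<phi>: "profile (real p + 1) \<phi>" and \<psi>: "profile (real p + 1) \<psi>"
    and u: "\<And>x. x \<in> {0..1} \<Longrightarrow> u j x = \<phi> (real n * x - (real j - real p - 1))"
    and v: "\<And>x. x \<in> {0..1} \<Longrightarrow> v i x = \<psi> (real n * x - (real i - real p - 1))"
    and j: "p + 1 \<le> j" "j \<le> n"
  shows "gram n u v i j = correlation \<phi> \<psi> (- real_of_int (int i - int j))"
proof -
  have "integral {0..1} (\<lambda>x. u j x * v i x)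
      = integral {0..1} (\<lambda>x. \<phi> (real n * x - (real j - real p - 1)) * \<psi> (real n * x - (real i - real p - 1)))"
    using u v by (intro integral_cong) simp
  then show ?thesis
    using integral_mult_profile_shifts[OF _ \<phi> \<psi>, of "real n" "real j - real p - 1" "real i - real p - 1"] n j
    by (simp add: gram_def)
qed

lemma abs_gram_minus_correlation_le:
  assumes n: "n > 0" and \<phi>: "profile (real p + 1) \<phi>"
    and u: "knot_localized n p B u" and w: "knot_localized n p C w"
    and close: "knot_localized n p e (\<lambda>i x. u i x - w i x)"
    and interior: "\<And>i x. i \<in> {p + 1..n} \<Longrightarrow> x \<in> {0..1} \<Longrightarrow> w i x = \<phi> (real n * x - (real i - real p - 1))"
    and s: "int s \<in> erosion (band p) (int ` {..<n + p - 2})"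
  shows "\<bar>gram n u u (r + 2) (s + 2) - correlation \<phi> \<phi> (- real_of_int (int r - int s))\<bar>
    \<le> e * (C + B) * real (p + 1)"
proof (cases "int p < \<bar>int r - int s\<bar>")
  case True
  then have "gram n u u (r + 2) (s + 2) = 0"
    using gram_eq_0[OF n u u, of "r + 2" "s + 2"] by simp
  moreover have "correlation \<phi> \<phi> (- real_of_int (int r - int s)) = 0"
    using \<phi> True by (intro correlation_eq_0[of "real p + 1"]) (auto simp: profile_def)
  ultimately show ?thesis
    using knot_localized_bound_nonneg[OF u] knot_localized_bound_nonneg[OF w]
      knot_localized_bound_nonneg[OF close] by simp
next
  case False
  have "int s - int (2 * p) \<in> int ` {..<n + p - 2}" "int s + int (2 * p) \<in> int ` {..<n + p - 2}"
    using s by (auto simp: erosion_def dest: bspec[of _ _ "- int (2 * p)"] bspec[of _ _ "int (2 * p)"])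
  then have "2 * p \<le> s" "s + 2 * p < n + p - 2" by auto
  then have "r + 2 \<in> {p + 1..n}" "s + 2 \<in> {p + 1..n}" using False by auto
  then have "gram n w w (r + 2) (s + 2) = correlation \<phi> \<phi> (- real_of_int (int r - int s))"
    using gram_interior[OF n \<phi> \<phi>, of w "s + 2" w "r + 2"] interior by simp
  then show ?thesis
    using abs_gram_diff_le[OF n w u close close, of "r + 2" "s + 2"] by simp
qed

lemma asymp_toeplitz_gram_mat:
  assumes "asymp_shifts p \<phi> u"
  shows "asymp_toeplitz (band p) (\<lambda>_. int) (\<lambda>n. n + p - 2)
    (\<lambda>n. gram_mat n p (u n) (u n)) (\<lambda>k. correlation \<phi> \<phi> (- real_of_int k))"
proof -
  obtain w C where \<phi>: "profile (real p + 1) \<phi>" and w: "\<forall>n>0. knot_localized n p C (w n)"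
    and interior: "\<forall>n>0. \<forall>i\<in>{p + 1..n}. \<forall>x\<in>{0..1}. w n i x = \<phi> (real n * x - (real i - real p - 1))"
    and close: "\<forall>e>0. \<forall>\<^sub>F n in sequentially. knot_localized n p e (\<lambda>i x. u n i x - w n i x)"
    using assms unfolding asymp_shifts_def by auto
  obtain B where u: "\<forall>\<^sub>F n in sequentially. knot_localized n p B (u n)"
    by (rule asymp_shifts_localized[OF assms])
  have "\<forall>\<^sub>F n in sequentially. \<forall>r<n + p - 2. \<forall>s<n + p - 2. int s \<in> erosion (band p) (int ` {..<n + p - 2}) \<longrightarrow>
      \<bar>gram n (u n) (u n) (r + 2) (s + 2) - correlation \<phi> \<phi> (- real_of_int (int r - int s))\<bar> < \<epsilon>"
    if \<epsilon>: "\<epsilon> > 0" for \<epsilon>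
  proof -
    let ?K = "(\<bar>C\<bar> + \<bar>B\<bar> + 1) * real (p + 1)"
    have bound_less: "(C + B) * real (p + 1) < ?K" by (intro mult_strict_right_mono) auto
    have pos: "?K > 0" by (intro mult_pos_pos) auto
    then have "\<epsilon> / ?K * ((C + B) * real (p + 1)) < \<epsilon> / ?K * ?K"
      using \<epsilon> bound_less by (intro mult_strict_left_mono) auto
    then have small: "\<epsilon> / ?K * (C + B) * real (p + 1) < \<epsilon>"
      using pos by (simp add: mult.assoc)
    have "\<epsilon> / ?K > 0" using \<epsilon> pos by simp
    from close[rule_format, OF this] u eventually_gt_at_top[of 0] show ?thesis
    proof eventually_elim
      case (elim n)
      then show ?case
        using abs_gram_minus_correlation_le[OF elim(3) \<phi> elim(2) w[rule_format, OF elim(3)] elim(1)] interior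
          small
        by (blast intro: le_less_trans)
    qed
  qed
  then show ?thesis
    by (simp add: asymp_toeplitz_def tendsto_iff eventually_eroded_entries entry_def offset_def gram_mat_def)
qed

theorem symmetric_toeplitz_gram_mat:
  assumes u: "asymp_shifts p \<phi> u"
  shows "symmetric_toeplitz (band p) (\<lambda>_. int) (\<lambda>n. n + p - 2)
    (\<lambda>n. gram_mat n p (u n) (u n)) (\<lambda>k. correlation \<phi> \<phi> (- real_of_int k))"
proof -
  have "asymp_symmetric (\<lambda>n. n + p - 2) (\<lambda>n. gram_mat n p (u n) (u n))"
    unfolding asymp_symmetric_def
    by (rule Lim_transform_eventually[OF tendsto_const])
      (auto simp: eventually_entries entry_def transpose_index_def gram_mat_def gram_def mult.commute)
  then show ?thesis
    using banded_bounded_gram_mat[OF u u] asymp_toeplitz_gram_mat[OF u] by (simp add: symmetric_toeplitz_def)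
qed

section \<open>The isogeometric matrices\<close>

lemma profile_cardB: "profile (real p + 1) (cardB p)"
  using abs_cardB_le by (auto simp: profile_def cardB_eq_0)

lemma profile_cardB_slope: "profile (real (Suc q) + 1) (cardB_slope q)"
proof -
  have "\<bar>cardB_slope q t\<bar> \<le> 2 ^ q + 2 ^ q" for t
    using abs_cardB_le[of q t] abs_cardB_le[of q "t - 1"] unfolding cardB_slope_def by linarith
  then show ?thesis by (auto simp: profile_def cardB_slope_def[abs_def] cardB_eq_0)
qed

definition gb_slope :: "gbkind \<Rightarrow> real \<Rightarrow> nat \<Rightarrow> nat \<Rightarrow> nat \<Rightarrow> real \<Rightarrow> real" where
  "gb_slope Q mu n q i x =
    (gb_density_left Q mu n (Suc q) q i x - gb_density_right Q mu n (Suc q) q (i + 1) x) / real n"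

definition bspline_slope :: "nat \<Rightarrow> nat \<Rightarrow> nat \<Rightarrow> real \<Rightarrow> real" where
  "bspline_slope n q i x =
    (bspline_density (knot n (Suc q)) q i x - bspline_density (knot n (Suc q)) q (i + 1) x) / real n"

lemma knot_localized_bspline:
  assumes "n > 0" shows "knot_localized n p (bspline_bound p) (bspline (knot n p) p)"
  using open_knots.localized_bspline[OF open_knots_knot[OF assms]] by (simp add: knot_localized_def)

lemma localized_bspline_density:
  assumes n: "n > 0"
  shows "localized (knot n p i) (knot n p (i + q + 1)) (bspline_bound q * real (q + 1) * real n)
    (bspline_density (knot n p) q i)"
proof -
  interpret open_knots "knot n p" by (rule open_knots_knot[OF n])
  let ?l = "knot n p (i + q + 1) - knot n p i"
  have "bspline_bound q / (?l / real (q + 1)) \<le> bspline_bound q * real (q + 1) * real n"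
  proof (cases "knot n p i < knot n p (i + q + 1)")
    case True
    then have "bspline_bound q * real (q + 1) / ?l \<le> bspline_bound q * real (q + 1) / (1 / real n)"
      using knot_gap[OF n True] n bspline_bound_ge_1[of q] by (intro divide_left_mono) auto
    then show ?thesis by simp
  next
    case False
    then have "?l = 0" using mono[of i "i + q + 1"] by simp
    then show ?thesis using bspline_bound_ge_1[of q] by simp
  qed
  then show ?thesis
    by (rule localized_mono[OF unit_densityD(4)[OF unit_density_bspline_density] order.refl order.refl])
qed

lemma knot_localized_bspline_slope:
  assumes n: "n > 0"
  shows "knot_localized n (Suc q) (2 * (bspline_bound q * real (q + 1))) (bspline_slope n q)"
proof -
  interpret open_knots "knot n (Suc q)" by (rule open_knots_knot[OF n])
  let ?d = "bspline_density (knot n (Suc q)) q" and ?B = "bspline_bound q * real (q + 1)"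
  have "localized (knot n (Suc q) i) (knot n (Suc q) (i + Suc q + 1)) (2 * ?B) (bspline_slope n q i)" for i
  proof -
    have "localized (knot n (Suc q) i) (knot n (Suc q) (i + Suc q + 1)) (?B * real n) (?d i)"
      by (rule localized_mono[OF localized_bspline_density[OF n]]) (auto intro!: mono)
    moreover have "localized (knot n (Suc q) i) (knot n (Suc q) (i + Suc q + 1)) (?B * real n) (?d (i + 1))"
      by (rule localized_mono[OF localized_bspline_density[OF n]]) (auto intro!: mono)
    ultimately have "localized (knot n (Suc q) i) (knot n (Suc q) (i + Suc q + 1))
        (\<bar>1 / real n\<bar> * (?B * real n + ?B * real n)) (\<lambda>x. 1 / real n * (?d i x - ?d (i + 1) x))"
      by (intro localized_cmult localized_diff)
    moreover have "\<bar>1 / real n\<bar> * (?B * real n + ?B * real n) = 2 * ?B" using n by (simp add: field_simps)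
    ultimately show ?thesis by (simp add: bspline_slope_def[abs_def])
  qed
  then show ?thesis unfolding knot_localized_def by blast
qed

lemma bspline_slope_interior:
  assumes n: "n > 0" and i: "Suc q + 1 \<le> i" "i \<le> n" and x: "x \<in> {0..1}"
  shows "bspline_slope n q i x = cardB_slope q (real n * x - (real i - real (Suc q) - 1))"
proof -
  have "real n * x - (real (i + 1) - real (Suc q) - 1) = real n * x - (real i - real (Suc q) - 1) - 1" by simp
  then show ?thesis
    using bspline_density_interior[OF n, of "Suc q" i q x]
      bspline_density_interior[OF n, of "Suc q" "i + 1" q x]
      bspline_interior[OF n, of "Suc q" i q x] bspline_interior[OF n, of "Suc q" "i + 1" q x] assms
    by (simp only: bspline_slope_def cardB_slope_def) (simp add: field_simps)
qed

lemma asymp_shifts_GBN: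
  assumes "mu > 0"
  shows "asymp_shifts (Suc q) (cardB (Suc q)) (\<lambda>n. GBN Q mu n (Suc q))"
  unfolding asymp_shifts_def
proof (intro conjI profile_cardB exI allI impI ballI)
  show "knot_localized n (Suc q) (bspline_bound (Suc q)) (bspline (knot n (Suc q)) (Suc q))" if "n > 0" for n
    using that by (rule knot_localized_bspline)
  show "bspline (knot n (Suc q)) (Suc q) i x = cardB (Suc q) (real n * x - (real i - real (Suc q) - 1))"
    if "n > 0" "i \<in> {Suc q + 1..n}" "x \<in> {0..1}" for n i x
    using that by (intro bspline_interior) auto
  fix e :: real assume "e > 0"
  then have "e / (2 * real (q + 1)) > 0" by simp
  from eventually_gb_approximation[OF assms this, of Q "Suc q" q]
  show "\<forall>\<^sub>F n in sequentially. knot_localized n (Suc q) e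
      (\<lambda>i x. GBN Q mu n (Suc q) i x - bspline (knot n (Suc q)) (Suc q) i x)"
  proof eventually_elim
    case (elim n)
    show ?case
      using gb_approximation.gbspl_close[OF elim] by (simp add: knot_localized_def GBN_def)
  qed
qed

lemma asymp_shifts_gb_slope:
  assumes "mu > 0"
  shows "asymp_shifts (Suc q) (cardB_slope q) (\<lambda>n. gb_slope Q mu n q)"
  unfolding asymp_shifts_def
proof (intro conjI profile_cardB_slope exI allI impI ballI)
  show "knot_localized n (Suc q) (2 * (bspline_bound q * real (q + 1))) (bspline_slope n q)" if "n > 0" for n
    using that by (rule knot_localized_bspline_slope)
  show "bspline_slope n q i x = cardB_slope q (real n * x - (real i - real (Suc q) - 1))"
    if "n > 0" "i \<in> {Suc q + 1..n}" "x \<in> {0..1}" for n i x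
    using that by (intro bspline_slope_interior) auto
  fix e :: real assume "e > 0"
  then have "e / 2 > 0" by simp
  from eventually_gb_approximation[OF assms this, of Q "Suc q" q]
  show "\<forall>\<^sub>F n in sequentially. knot_localized n (Suc q) e
      (\<lambda>i x. gb_slope Q mu n q i x - bspline_slope n q i x)"
  proof eventually_elim
    case (elim n)
    interpret gb_approximation Q mu n "Suc q" q "e / 2" by fact
    show ?case
      using localized_cmult[OF gb_density_diff_close, of _ "1 / real n"] n_pos
      by (simp add: knot_localized_def gb_slope_def bspline_slope_def diff_divide_distrib)
  qed
qed

context gb_approximation
begin

lemma integral_deriv_gbspl_cong:
  assumes "\<And>x. x \<in> {0<..<1} \<Longrightarrow> real n * x \<notin> \<int> \<Longrightarrow> f x = g x"
  shows "integral {0..1} f = integral {0..1} g"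
proof (rule integral_spike)
  show "negligible ({x \<in> {0..1}. real n * x - 0 \<in> \<int>} :: real set)"
    using n_pos by (intro negligible_finite finite_affine_Ints) simp
  fix x :: real assume "x \<in> {0..1} - {x \<in> {0..1}. real n * x - 0 \<in> \<int>}"
  then have "x \<in> {0..1}" "real n * x \<notin> \<int>" by auto
  moreover from this have "x \<noteq> 0" "x \<noteq> 1" by auto
  ultimately show "g x = f x" using assms[of x] by auto
qed

end

lemma
  assumes "gb_approximation Q mu n (Suc q) q e"
  shows Kmat_eq_gram_mat: "Kmat Q mu n (Suc q) = gram_mat n (Suc q) (gb_slope Q mu n q) (gb_slope Q mu n q)"
    and Hmat_eq_gram_mat: "Hmat Q mu n (Suc q) = gram_mat n (Suc q) (gb_slope Q mu n q) (GBN Q mu n (Suc q))"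
proof -
  interpret gb_approximation Q mu n "Suc q" q e by fact
  have deriv: "deriv (GBN Q mu n (Suc q) i) x = real n * gb_slope Q mu n q i x"
    if "x \<in> {0<..<1}" "real n * x \<notin> \<int>" for i x
    using deriv_gbspl[OF that] n_pos by (simp add: GBN_def gb_slope_def)
  show "Kmat Q mu n (Suc q) = gram_mat n (Suc q) (gb_slope Q mu n q) (gb_slope Q mu n q)"
  proof -
    have "integral {0..1} (\<lambda>x. deriv (GBN Q mu n (Suc q) j) x * deriv (GBN Q mu n (Suc q) i) x)
        = integral {0..1} (\<lambda>x. (real n * real n) * (gb_slope Q mu n q j x * gb_slope Q mu n q i x))" for i j
      by (rule integral_deriv_gbspl_cong) (simp add: deriv)
    then show ?thesis using n_pos by (simp add: Kmat_def gram_mat_def gram_def)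
  qed
  show "Hmat Q mu n (Suc q) = gram_mat n (Suc q) (gb_slope Q mu n q) (GBN Q mu n (Suc q))"
  proof -
    have "integral {0..1} (\<lambda>x. deriv (GBN Q mu n (Suc q) j) x * GBN Q mu n (Suc q) i x)
        = integral {0..1} (\<lambda>x. real n * (gb_slope Q mu n q j x * GBN Q mu n (Suc q) i x))" for i j
      by (rule integral_deriv_gbspl_cong) (simp add: deriv)
    then show ?thesis by (simp add: Hmat_def gram_mat_def gram_def)
  qed
qed

lemma Mmat_eq_gram_mat: "Mmat Q mu n p = gram_mat n p (GBN Q mu n p) (GBN Q mu n p)"
  by (simp add: Mmat_def gram_mat_def gram_def)

definition mass_symbol :: "nat \<Rightarrow> int \<Rightarrow> real" where
  "mass_symbol p k = correlation (cardB p) (cardB p) (- real_of_int k)"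

definition stiffness_symbol :: "nat \<Rightarrow> int \<Rightarrow> real" where
  "stiffness_symbol p k = correlation (cardB_slope (p - 1)) (cardB_slope (p - 1)) (- real_of_int k)"

lemma symmetric_toeplitz_Mmat:
  assumes "p \<ge> 1" "mu > 0"
  shows "symmetric_toeplitz (band p) (\<lambda>_. int) (\<lambda>n. n + p - 2) (\<lambda>n. Mmat Q mu n p) (mass_symbol p)"
  using symmetric_toeplitz_gram_mat[OF asymp_shifts_GBN[OF assms(2), of "p - 1" Q]] assms(1)
  by (simp add: Mmat_eq_gram_mat mass_symbol_def[abs_def])

lemma symmetric_toeplitz_Kmat:
  assumes "p \<ge> 1" and mu: "mu > 0"
  shows "symmetric_toeplitz (band p) (\<lambda>_. int) (\<lambda>n. n + p - 2) (\<lambda>n. Kmat Q mu n p) (stiffness_symbol p)"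
proof -
  obtain q where p: "p = Suc q" using assms(1) by (cases p) auto
  have symbol: "stiffness_symbol p = (\<lambda>k. correlation (cardB_slope q) (cardB_slope q) (- real_of_int k))"
    by (simp add: p stiffness_symbol_def[abs_def])
  show ?thesis
    unfolding p symbol[unfolded p]
  proof (rule symmetric_toeplitz_cong[OF symmetric_toeplitz_gram_mat[OF asymp_shifts_gb_slope[OF mu]]])
    show "\<forall>\<^sub>F n in sequentially. gram_mat n (Suc q) (gb_slope Q mu n q) (gb_slope Q mu n q)
        = Kmat Q mu n (Suc q)"
      using eventually_gb_approximation[OF mu zero_less_one_class.zero_less_one, of Q "Suc q" q]
      by eventually_elim (rule Kmat_eq_gram_mat[symmetric])
  qed (simp add: Kmat_def)
qed

lemma banded_bounded_Hmat:
  assumes "p \<ge> 1" and mu: "mu > 0"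
  shows "banded_bounded (band p) (\<lambda>_. int) (\<lambda>n. n + p - 2) (\<lambda>n. Hmat Q mu n p)"
proof -
  obtain q where p: "p = Suc q" using assms(1) by (cases p) auto
  show ?thesis
    unfolding p
  proof (rule banded_bounded_cong[OF
        banded_bounded_gram_mat[OF asymp_shifts_gb_slope[OF mu] asymp_shifts_GBN[OF mu]]])
    show "\<forall>\<^sub>F n in sequentially. gram_mat n (Suc q) (gb_slope Q mu n q) (GBN Q mu n (Suc q))
        = Hmat Q mu n (Suc q)"
      using eventually_gb_approximation[OF mu zero_less_one_class.zero_less_one, of Q "Suc q" q]
      by eventually_elim (rule Hmat_eq_gram_mat[symmetric])
  qed (simp add: Hmat_def)
qed

subsection \<open>Fourier expansions of the symbols\<close>

lemma sum_symmetric_int: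
  fixes f :: "int \<Rightarrow> 'a :: comm_monoid_add"
  shows "(\<Sum>k\<in>{- int p..int p}. f k) = f 0 + (\<Sum>k=1..p. f (int k) + f (- int k))"
proof (induction p)
  case (Suc p)
  have "{- int (Suc p)..int (Suc p)} = insert (int (Suc p)) (insert (- int (Suc p)) {- int p..int p})" by auto
  then have "(\<Sum>k\<in>{- int (Suc p)..int (Suc p)}. f k)
      = f (int (Suc p)) + (f (- int (Suc p)) + (\<Sum>k\<in>{- int p..int p}. f k))"
    by simp
  then show ?case unfolding Suc by (simp add: ac_simps)
qed simp

lemma fourier_correlation:
  assumes \<phi>: "profile (real p + 1) \<phi>"
  shows "(\<Sum>k\<in>band p. complex_of_real (correlation \<phi> \<phi> (- real_of_int k)) * cis (of_int k * \<theta>))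
    = complex_of_real (correlation \<phi> \<phi> 0 + 2 * (\<Sum>k=1..p. correlation \<phi> \<phi> (- real k) * cos (real k * \<theta>)))"
proof -
  let ?s = "\<lambda>k::int. correlation \<phi> \<phi> (- real_of_int k)"
  have "?s k = 0" if "\<bar>k\<bar> > int p" for k
    using \<phi> that by (intro correlation_eq_0[of "real p + 1"]) (auto simp: profile_def)
  then have "(\<Sum>k\<in>band p. complex_of_real (?s k) * cis (of_int k * \<theta>))
      = (\<Sum>k\<in>{- int p..int p}. complex_of_real (?s k) * cis (of_int k * \<theta>))"
    by (intro sum.mono_neutral_right) auto
  also have "\<dots> = complex_of_real (?s 0)
      + (\<Sum>k=1..p. complex_of_real (?s k) * (cis (real k * \<theta>) + cis (- (real k * \<theta>))))"
    unfolding sum_symmetric_int by (simp add: correlation_minus distrib_left)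
  also have "\<dots> = complex_of_real (?s 0) + (\<Sum>k=1..p. complex_of_real (2 * (?s k * cos (real k * \<theta>))))"
    by (intro arg_cong2[where f = "(+)"] sum.cong refl) (simp add: complex_eq_iff)
  finally show ?thesis by (simp add: sum_distrib_left)
qed

lemma hsym_fourier: "complex_of_real (hsym p \<theta>)
    = (\<Sum>k\<in>band p. complex_of_real (mass_symbol p k) * cis (of_int k * \<theta>))"
proof -
  have autocorrelation: "correlation (cardB p) (cardB p) y = cardB (2 * p + 1) (real p + 1 + y)" for y
    using correlation_cardB[of p p y] by (simp only: mult_2)
  show ?thesis
    unfolding mass_symbol_def fourier_correlation[OF profile_cardB]
    unfolding autocorrelation by (simp add: hsym_def)
qed

lemma fsym_fourier:
  assumes "p \<ge> 1"
  shows "complex_of_real (fsym p \<theta>)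
    = (\<Sum>k\<in>band p. complex_of_real (stiffness_symbol p k) * cis (of_int k * \<theta>))"
proof -
  obtain q where p: "p = Suc q" using assms by (cases p) auto
  have second_difference: "correlation (cardB_slope q) (cardB_slope q) y
      = - deriv (deriv (cardB (2 * p + 1))) (real p + 1 + y)" for y
    using correlation_cardB_slope[of q y] by (simp add: p eval_nat_numeral add_ac)
  have symbol: "stiffness_symbol p k = correlation (cardB_slope q) (cardB_slope q) (- real_of_int k)" for k
    by (simp add: stiffness_symbol_def p)
  have profile: "profile (real p + 1) (cardB_slope q)" unfolding p by (rule profile_cardB_slope)
  show ?thesis
    unfolding symbol fourier_correlation[OF profile]
    unfolding second_difference by (simp add: fsym_def sum_negf)
qed

lemma filterlim_n2of:
  assumes "\<nu> > 0" shows "filterlim (n2of \<nu>) at_top sequentially"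
proof -
  have "filterlim (\<lambda>n. \<nu> * real n) at_top sequentially"
    by (rule filterlim_tendsto_pos_mult_at_top[OF tendsto_const assms filterlim_real_sequentially])
  moreover have "\<nu> * real n \<le> real (n2of \<nu> n) + 1" for n
    using of_int_round_ge[of "\<nu> * real n"] unfolding n2of_def by linarith
  ultimately have "filterlim (\<lambda>n. real (n2of \<nu> n) + 1) at_top sequentially"
    by (rule filterlim_at_top_mono[OF _ always_eventually[OF allI]])
  then have "filterlim (\<lambda>n. - 1 + (real (n2of \<nu> n) + 1)) at_top sequentially"
    by (rule filterlim_tendsto_add_at_top[OF tendsto_const])
  then show ?thesis by (simp add: filterlim_sequentially_iff_filterlim_real)
qed

definition galerkin_symbol :: "real \<Rightarrow> nat \<Rightarrow> nat \<Rightarrow> int \<times> int \<Rightarrow> real" where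
  "galerkin_symbol \<nu> p1 p2 z =
    1 / \<nu> * (mass_symbol p2 (fst z) * stiffness_symbol p1 (snd z))
    + \<nu> * (stiffness_symbol p2 (fst z) * mass_symbol p1 (snd z))"

lemma galerkin_symbol_fourier:
  assumes "p1 \<ge> 1" "p2 \<ge> 1"
  shows "complex_of_real (1 / \<nu> * hsym p2 (fst \<theta>) * fsym p1 (snd \<theta>) + \<nu> * fsym p2 (fst \<theta>) * hsym p1 (snd \<theta>))
    = (\<Sum>w\<in>band p2 \<times> band p1. complex_of_real (galerkin_symbol \<nu> p1 p2 w) * fourier_char w \<theta>)"
proof -
  let ?e = "\<lambda>k t. cis (of_int k * t)"
  have product: "(\<Sum>k\<in>band p2. complex_of_real (f k) * ?e k (fst \<theta>))
      * (\<Sum>l\<in>band p1. complex_of_real (g l) * ?e l (snd \<theta>))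
      = (\<Sum>w\<in>band p2 \<times> band p1. complex_of_real (f (fst w) * g (snd w)) * fourier_char w \<theta>)" for f g
    by (simp add: sum_product sum.cartesian_product fourier_char_def case_prod_unfold mult_ac)
  have "complex_of_real (1 / \<nu> * hsym p2 (fst \<theta>) * fsym p1 (snd \<theta>) + \<nu> * fsym p2 (fst \<theta>) * hsym p1 (snd \<theta>))
      = complex_of_real (1 / \<nu>) * (complex_of_real (hsym p2 (fst \<theta>)) * complex_of_real (fsym p1 (snd \<theta>)))
      + complex_of_real \<nu> * (complex_of_real (fsym p2 (fst \<theta>)) * complex_of_real (hsym p1 (snd \<theta>)))"
    by (simp only: of_real_add of_real_mult mult.assoc)
  also have "\<dots> = (\<Sum>w\<in>band p2 \<times> band p1.
      complex_of_real (1 / \<nu>)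
        * (complex_of_real (mass_symbol p2 (fst w) * stiffness_symbol p1 (snd w)) * fourier_char w \<theta>)
      + complex_of_real \<nu>
        * (complex_of_real (stiffness_symbol p2 (fst w) * mass_symbol p1 (snd w)) * fourier_char w \<theta>))"
    unfolding hsym_fourier fsym_fourier[OF assms(1)] fsym_fourier[OF assms(2)] product
    by (simp only: sum.distrib sum_distrib_left)
  finally show ?thesis
    by (simp only: galerkin_symbol_def of_real_add of_real_mult distrib_right mult.assoc)
qed

lemma symmetric_toeplitz_Amat:
  assumes p: "p1 \<ge> 1" "p2 \<ge> 1" and \<alpha>: "\<alpha>1 > 0" "\<alpha>2 > 0" and \<nu>: "\<nu> > 0"
  shows "symmetric_toeplitz (band p2 \<times> band p1) (grid_pos (\<lambda>n. n + p1 - 2))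
    (\<lambda>n. (n2of \<nu> n + p2 - 2) * (n + p1 - 2)) (Amat Q \<alpha>1 \<alpha>2 p1 p2 \<beta>1 \<beta>2 \<gamma> \<nu>) (galerkin_symbol \<nu> p1 p2)"
proof -
  note n2 = filterlim_n2of[OF \<nu>]
  note M1 = symmetric_toeplitz_Mmat[OF p(1) \<alpha>(1), of Q] and K1 = symmetric_toeplitz_Kmat[OF p(1) \<alpha>(1), of Q]
    and H1 = banded_bounded_Hmat[OF p(1) \<alpha>(1), of Q]
  note M2 = symmetric_toeplitz_reindex[OF n2 symmetric_toeplitz_Mmat[OF p(2) \<alpha>(2), of Q]]
    and K2 = symmetric_toeplitz_reindex[OF n2 symmetric_toeplitz_Kmat[OF p(2) \<alpha>(2), of Q]]
    and H2 = banded_bounded_reindex[OF n2 banded_bounded_Hmat[OF p(2) \<alpha>(2), of Q]]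
  have bounded: "banded_bounded W pos d A" if "symmetric_toeplitz W pos d A a"
    for W :: "int set" and pos d A a
    using that by (simp add: symmetric_toeplitz_def)
  have "(\<lambda>n. \<beta>1 / (\<nu> * real n)) \<longlonglongrightarrow> 0" "(\<lambda>n. \<beta>2 / real n) \<longlonglongrightarrow> 0" "(\<lambda>n. \<gamma> / (\<nu> * (real n)\<^sup>2)) \<longlonglongrightarrow> 0"
    using \<nu> by real_asymp+
  note lower_order = symmetric_toeplitz_vanishing[OF this(1) banded_bounded_kron[OF bounded[OF M2] H1]]
    symmetric_toeplitz_vanishing[OF this(2) banded_bounded_kron[OF H2 bounded[OF M1]]]
    symmetric_toeplitz_vanishing[OF this(3) banded_bounded_kron[OF bounded[OF M2] bounded[OF M1]]]
  have nonempty: "band q \<noteq> {}" for q by simp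
  note leading = symmetric_toeplitz_add[OF
      symmetric_toeplitz_smult[OF symmetric_toeplitz_kron[OF M2 K1 nonempty nonempty], of "1 / \<nu>"]
      symmetric_toeplitz_smult[OF symmetric_toeplitz_kron[OF K2 M1 nonempty nonempty], of \<nu>]]
  from symmetric_toeplitz_add[OF symmetric_toeplitz_add[OF symmetric_toeplitz_add[OF leading
        lower_order(1)] lower_order(2)] lower_order(3)]
  show ?thesis
    by (simp add: Amat_def[abs_def] Let_def galerkin_symbol_def[abs_def])
qed

theorem theorem18:
  fixes p1 p2 :: nat and \<alpha>1 \<alpha>2 \<beta>1 \<beta>2 \<gamma> \<nu> :: real and Q :: gbkind
    and F :: "complex \<Rightarrow> complex"
  assumes "p1 \<ge> 1" "p2 \<ge> 1" "\<alpha>1 > 0" "\<alpha>2 > 0" "\<gamma> \<ge> 0" "\<nu> > 0"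
    and "continuous_on UNIV F" and "compact (closure {z. F z \<noteq> 0})"
  shows "(\<lambda>n1. (\<Sum>z\<in>#eigvals (Amat Q \<alpha>1 \<alpha>2 p1 p2 \<beta>1 \<beta>2 \<gamma> \<nu> n1). F z)
                / of_nat ((n1 + p1 - 2) * (n2of \<nu> n1 + p2 - 2)))
     \<longlonglongrightarrow> (1 / (4 * pi\<^sup>2)) *\<^sub>R integral (cbox (-pi, -pi) (pi, pi))
           (\<lambda>(\<theta>1, \<theta>2). F (complex_of_real
              ((1 / \<nu>) * hsym p2 \<theta>1 * fsym p1 \<theta>2 + \<nu> * fsym p2 \<theta>1 * hsym p1 \<theta>2)))"
proof -
  note A = symmetric_toeplitz_Amat[OF assms(1-4,6), of Q \<beta>1 \<beta>2 \<gamma>]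
  have size: "filterlim (\<lambda>n. N n + p - 2) at_top sequentially" if "filterlim N at_top sequentially"
    for N :: "nat \<Rightarrow> nat" and p
    by (intro filterlim_compose[OF filterlim_minus_const_nat_at_top]
      filterlim_compose[OF filterlim_add_const_nat_at_top] that)
  have toeplitz: "toeplitz_sequence (band p2 \<times> band p1) (grid_pos (\<lambda>n. n + p1 - 2))
      (\<lambda>n. (n2of \<nu> n + p2 - 2) * (n + p1 - 2)) (Amat Q \<alpha>1 \<alpha>2 p1 p2 \<beta>1 \<beta>2 \<gamma> \<nu>) (galerkin_symbol \<nu> p1 p2)"
    by (rule toeplitz_sequence_grid[OF A size[OF filterlim_n2of[OF assms(6)]] size[OF filterlim_ident]])
  have "asymp_symmetric (\<lambda>n. (n2of \<nu> n + p2 - 2) * (n + p1 - 2)) (Amat Q \<alpha>1 \<alpha>2 p1 p2 \<beta>1 \<beta>2 \<gamma> \<nu>)"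
    using A unfolding symmetric_toeplitz_def by blast
  from toeplitz_eigenvalue_distribution[OF toeplitz this galerkin_symbol_fourier[OF assms(1,2)] assms(7)]
  show ?thesis
    unfolding mset_mean_def box_mean_def content_torus toeplitz_sequence.size_eigvals[OF toeplitz]
    by (simp only: torus_def case_prod_unfold mult.commute[of "n2of \<nu> _ + p2 - 2"])
qed

end
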